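(* Let $(\mathcal{B},\mathcal{L},\theta,\mathcal{I}_\alpha)$ be a generalized Boolean dynamical system and let $M$ be the abelian core of $C^*(\mathcal{B},\mathcal{L},\theta,\mathcal{I}_\alpha)$. If $(\mathcal{B},\mathcal{L},\theta)$ satisfies Condition (L), then $M$ is a maximal abelian subalgebra (MASA) in $C^*(\mathcal{B},\mathcal{L},\theta,\mathcal{I}_\alpha)$.
   Context: Boolean dynamical systems. A Boolean algebra is a relatively complemented distributive lattice $\mathcal{B}$ with least element $\emptyset$ (no greatest element is required), with meet $\cap$, join $\cup$, relative complement $\setminus$ and order $A\subseteq B \iff A\cap B=A$. An ideal of $\mathcal{B}$ is a non-empty subset closed under finite unions and downward closed. An action on $\mathcal{B}$ is a map $\mathcal{B}\to\mathcal{B}$ preserving $\cap,\cup,\setminus$ and sending $\emptyset$ to $\emptyset$. For a set $\mathcal{L}$, $\mathcal{L}^{\geq 1}$ is the set of non-empty finite words over $\mathcal{L}$ and $\mathcal{L}^*=\mathcal{L}^{\ge1}\cup\{\emptyset\}$, where $\emptyset$ also denotes the empty word; $\alpha_{i,j}=\alpha_i\cdots\alpha_j$. A Boolean dynamical system is a triple $(\mathcal{B},\mathcal{L},\theta)$ with $\mathcal{B}$ a Boolean algebra, $\mathcal{L}$ a set and $\{\theta_\alpha\}_{\alpha\in\mathcal{L}}$ a family of actions on $\mathcal{B}$; for $\alpha=\alpha_1\cdots\alpha_n$ put $\theta_\alpha=\theta_{\alpha_n}\circ\cdots\circ\theta_{\alpha_1}$, and $\theta_\emptyset=\mathrm{Id}$.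 For $B\in\mathcal{B}$, $\Delta_B=\{\alpha\in\mathcal{L}:\theta_\alpha(B)\ne\emptyset\}$. $A\in\mathcal{B}$ is regular if $0<|\Delta_B|<\infty$ for every $\emptyset\neq B\subseteq A$; $\mathcal{B}_{reg}$ is the set of regular elements (including $\emptyset$). Condition (L). For $\alpha=\alpha_1\cdots\alpha_n\in\mathcal{L}^{\ge1}$ and $\emptyset\ne A\in\mathcal{B}$, the pair $(\alpha,A)$ is a cycle if $\theta_\alpha(B)=B$ for all $B\subseteq A$. A cycle $(\alpha,A)$ has no exits if for every $t\in\{1,\dots,n\}$ and every $\emptyset\ne B\subseteq\theta_{\alpha_{1,t}}(A)$ we have $B\in\mathcal{B}_{reg}$ and $\Delta_B=\{\alpha_{t+1}\}$ (where $\alpha_{n+1}:=\alpha_1$). $(\mathcal{B},\mathcal{L},\theta)$ satisfies Condition (L) if it has no cycle with no exits. $C^*$-algebra. A generalized Boolean dynamical system $(\mathcal{B},\mathcal{L},\theta,\mathcal{I}_\alpha)$ is a Boolean dynamical system together with ideals $\mathcal{I}_\alpha\subseteq\mathcal{B}$ ($\alpha\in\mathcal{L}$) such that $\theta_\alpha(\mathcal{B})\subseteq\mathcal{I}_\alpha$. A representation of it in a $C^*$-algebra consists of projections $\{P_A:A\in\mathcal{B}\}$ and partial isometries $\{S_{\alpha,B}:\alpha\in\mathcal{L},B\in\mathcal{I}_\alpha\}$ such that: (i) $P_\emptyset=0$, $P_{A\cap A'}=P_AP_{A'}$, $P_{A\cup A'}=P_A+P_{A'}-P_{A\cap A'}$;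 (ii) $P_AS_{\alpha,B}=S_{\alpha,B}P_{\theta_\alpha(A)}$; (iii) $S_{\alpha,B}^*S_{\alpha',B'}=\delta_{\alpha,\alpha'}P_{B\cap B'}$; (iv) $P_A=\sum_{\alpha\in\Delta_A}S_{\alpha,\theta_\alpha(A)}S_{\alpha,\theta_\alpha(A)}^*$ for $A\in\mathcal{B}_{reg}$. $C^*(\mathcal{B},\mathcal{L},\theta,\mathcal{I}_\alpha)$ is the $C^*$-algebra generated by a universal representation $\{p_A,s_{\alpha,B}\}$. Put $\mathcal{I}_\emptyset=\mathcal{B}$ and, for $\alpha=\alpha_1\cdots\alpha_n$, $\mathcal{I}_\alpha=\{A\in\mathcal{B}: A\subseteq\theta_{\alpha_2\cdots\alpha_n}(B)\text{ for some }B\in\mathcal{I}_{\alpha_1}\}$. Put $s_{\emptyset,A}=p_A$ and, for $\alpha=\alpha_1\cdots\alpha_n$ and $A\in\mathcal{I}_\alpha$, $s_{\alpha,A}=s_{\alpha_1,B}s_{\alpha_2,\theta_{\alpha_2}(B)}s_{\alpha_3,\theta_{\alpha_2\alpha_3}(B)}\cdots s_{\alpha_n,A}$, where $B\in\mathcal{I}_{\alpha_1}$ satisfies $A\subseteq\theta_{\alpha_2\cdots\alpha_n}(B)$. The abelian core $M$ is the $C^*$-subalgebra generated by all $s_{\alpha,A}s_{\beta,A}^*$ ($\alpha,\beta\in\mathcal{L}^*$, $A\in\mathcal{I}_\alpha\cap\mathcal{I}_\beta$) satisfying one of: (1) $\alpha=\beta$; (2) $\alpha=\beta\gamma$ and $(\gamma,A)$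 is a cycle with no exits; (3) $\beta=\alpha\gamma$ and $(\gamma,A)$ is a cycle with no exits. *)

theory Defs
  imports "HOL-Analysis.Analysis" "HOL-Algebra.Module"
begin

section \<open>Boolean dynamical systems\<close>

text \<open>Boolean algebras without a greatest element; the relative complement of \<open>y\<close> in \<open>x\<close> is
  written \<open>x - y\<close>, and \<open>bot\<close> is the least element.\<close>

class generalized_boolean_algebra = distrib_lattice + order_bot + minus +
  assumes inf_diff_bot: "inf (x - y) y = bot"
    and sup_diff_inf: "sup (x - y) (inf x y) = x"

definition boolean_ideal :: "'b::generalized_boolean_algebra set \<Rightarrow> bool" where
  "boolean_ideal J \<longleftrightarrow> J \<noteq> {} \<and> (\<forall>A\<in>J. \<forall>B\<in>J. sup A B \<in> J) \<and> (\<forall>A\<in>J. \<forall>B. B \<le> A \<longrightarrow> B \<in> J)"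

definition boolean_action :: "('b::generalized_boolean_algebra \<Rightarrow> 'b) \<Rightarrow> bool" where
  "boolean_action f \<longleftrightarrow> (\<forall>A B. f (inf A B) = inf (f A) (f B)) \<and>
     (\<forall>A B. f (sup A B) = sup (f A) (f B)) \<and> (\<forall>A B. f (A - B) = f A - f B) \<and> f bot = bot"

text \<open>The alphabet is a set \<open>L\<close>, possibly empty, rather than a whole type; the values of \<open>\<theta>\<close> and
  \<open>\<I>\<close> outside \<open>L\<close> are irrelevant.\<close>

definition boolean_dynamical_system ::
    "'l set \<Rightarrow> ('l \<Rightarrow> 'b::generalized_boolean_algebra \<Rightarrow> 'b) \<Rightarrow> bool" where
  "boolean_dynamical_system L \<theta> \<longleftrightarrow> (\<forall>\<alpha>\<in>L. boolean_action (\<theta> \<alpha>))"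

definition generalized_boolean_dynamical_system ::
    "'l set \<Rightarrow> ('l \<Rightarrow> 'b::generalized_boolean_algebra \<Rightarrow> 'b) \<Rightarrow> ('l \<Rightarrow> 'b set) \<Rightarrow> bool" where
  "generalized_boolean_dynamical_system L \<theta> \<I> \<longleftrightarrow> boolean_dynamical_system L \<theta> \<and>
     (\<forall>\<alpha>\<in>L. boolean_ideal (\<I> \<alpha>) \<and> range (\<theta> \<alpha>) \<subseteq> \<I> \<alpha>)"

text \<open>For a word \<open>w\<close>, the action \<open>\<theta>\<^sub>w\<close> is \<^term>\<open>fold \<theta> w\<close>: the first letter of \<open>w\<close> acts first.\<close>

definition Delta ::
    "'l set \<Rightarrow> ('l \<Rightarrow> 'b::generalized_boolean_algebra \<Rightarrow> 'b) \<Rightarrow> 'b \<Rightarrow> 'l set" where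
  "Delta L \<theta> B = {\<alpha> \<in> L. \<theta> \<alpha> B \<noteq> bot}"

definition regular_elements ::
    "'l set \<Rightarrow> ('l \<Rightarrow> 'b::generalized_boolean_algebra \<Rightarrow> 'b) \<Rightarrow> 'b set" where
  "regular_elements L \<theta> =
     {A. \<forall>B. B \<noteq> bot \<and> B \<le> A \<longrightarrow> finite (Delta L \<theta> B) \<and> Delta L \<theta> B \<noteq> {}}"

definition cycle ::
    "'l set \<Rightarrow> ('l \<Rightarrow> 'b::generalized_boolean_algebra \<Rightarrow> 'b) \<Rightarrow> 'l list \<Rightarrow> 'b \<Rightarrow> bool" where
  "cycle L \<theta> w A \<longleftrightarrow> w \<in> lists L \<and> w \<noteq> [] \<and> A \<noteq> bot \<and> (\<forall>B\<le>A. fold \<theta> w B = B)"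

text \<open>Lists are indexed from 0, so \<open>w ! (t mod length w)\<close> is the letter \<open>w\<^sub>t\<^sub>+\<^sub>1\<close>, with indices read
  cyclically.\<close>

definition cycle_no_exits ::
    "'l set \<Rightarrow> ('l \<Rightarrow> 'b::generalized_boolean_algebra \<Rightarrow> 'b) \<Rightarrow> 'l list \<Rightarrow> 'b \<Rightarrow> bool" where
  "cycle_no_exits L \<theta> w A \<longleftrightarrow> cycle L \<theta> w A \<and>
     (\<forall>t\<in>{1..length w}. \<forall>B. B \<noteq> bot \<and> B \<le> fold \<theta> (take t w) A \<longrightarrow>
        B \<in> regular_elements L \<theta> \<and> Delta L \<theta> B = {w ! (t mod length w)})"

definition condition_L ::
    "'l set \<Rightarrow> ('l \<Rightarrow> 'b::generalized_boolean_algebra \<Rightarrow> 'b) \<Rightarrow> bool" where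
  "condition_L L \<theta> \<longleftrightarrow> \<not> (\<exists>w A. cycle_no_exits L \<theta> w A)"


section \<open>C*-algebras\<close>

text \<open>C*-algebras (complex, not necessarily unital) appear in two forms. The algebra under study is a
  type of class \<open>cstar_algebra\<close>. The universal property quantifies over all C*-algebras inside a
  formula, which types do not allow; there a C*-algebra is a record with an explicit carrier,
  extending the record \<open>module\<close> of HOL-Algebra. The inherited field \<open>one\<close> carries no meaning.\<close>

record 'a star_alg = "(complex, 'a) module" +
  adj :: "'a \<Rightarrow> 'a"
  nrm :: "'a \<Rightarrow> real"

locale cstar_alg = abelian_group D for D :: "('a, 'm) star_alg_scheme" (structure) +
  assumes mult_closed: "\<lbrakk>x \<in> carrier D; y \<in> carrier D\<rbrakk> \<Longrightarrow> x \<otimes> y \<in> carrier D"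
    and mult_assoc: "\<lbrakk>x \<in> carrier D; y \<in> carrier D; z \<in> carrier D\<rbrakk> \<Longrightarrow> (x \<otimes> y) \<otimes> z = x \<otimes> (y \<otimes> z)"
    and mult_distr_left: "\<lbrakk>x \<in> carrier D; y \<in> carrier D; z \<in> carrier D\<rbrakk>
          \<Longrightarrow> (x \<oplus> y) \<otimes> z = x \<otimes> z \<oplus> y \<otimes> z"
    and mult_distr_right: "\<lbrakk>x \<in> carrier D; y \<in> carrier D; z \<in> carrier D\<rbrakk>
          \<Longrightarrow> z \<otimes> (x \<oplus> y) = z \<otimes> x \<oplus> z \<otimes> y"
    and smult_closed: "x \<in> carrier D \<Longrightarrow> c \<odot>\<^bsub>D\<^esub> x \<in> carrier D"
    and smult_distr_left: "x \<in> carrier D \<Longrightarrow> (a + b) \<odot>\<^bsub>D\<^esub> x = a \<odot>\<^bsub>D\<^esub> x \<oplus> b \<odot>\<^bsub>D\<^esub> x"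
    and smult_distr_right: "\<lbrakk>x \<in> carrier D; y \<in> carrier D\<rbrakk>
          \<Longrightarrow> c \<odot>\<^bsub>D\<^esub> (x \<oplus> y) = c \<odot>\<^bsub>D\<^esub> x \<oplus> c \<odot>\<^bsub>D\<^esub> y"
    and smult_assoc: "x \<in> carrier D \<Longrightarrow> (a * b) \<odot>\<^bsub>D\<^esub> x = a \<odot>\<^bsub>D\<^esub> (b \<odot>\<^bsub>D\<^esub> x)"
    and smult_one: "x \<in> carrier D \<Longrightarrow> 1 \<odot>\<^bsub>D\<^esub> x = x"
    and smult_mult_left: "\<lbrakk>x \<in> carrier D; y \<in> carrier D\<rbrakk>
          \<Longrightarrow> (c \<odot>\<^bsub>D\<^esub> x) \<otimes> y = c \<odot>\<^bsub>D\<^esub> (x \<otimes> y)"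
    and smult_mult_right: "\<lbrakk>x \<in> carrier D; y \<in> carrier D\<rbrakk>
          \<Longrightarrow> x \<otimes> (c \<odot>\<^bsub>D\<^esub> y) = c \<odot>\<^bsub>D\<^esub> (x \<otimes> y)"
    and adj_closed: "x \<in> carrier D \<Longrightarrow> adj D x \<in> carrier D"
    and adj_adj: "x \<in> carrier D \<Longrightarrow> adj D (adj D x) = x"
    and adj_add: "\<lbrakk>x \<in> carrier D; y \<in> carrier D\<rbrakk> \<Longrightarrow> adj D (x \<oplus> y) = adj D x \<oplus> adj D y"
    and adj_smult: "x \<in> carrier D \<Longrightarrow> adj D (c \<odot>\<^bsub>D\<^esub> x) = cnj c \<odot>\<^bsub>D\<^esub> adj D x"
    and adj_mult: "\<lbrakk>x \<in> carrier D; y \<in> carrier D\<rbrakk> \<Longrightarrow> adj D (x \<otimes> y) = adj D y \<otimes> adj D x"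
    and nrm_eq_0: "x \<in> carrier D \<Longrightarrow> nrm D x = 0 \<longleftrightarrow> x = \<zero>"
    and nrm_triangle: "\<lbrakk>x \<in> carrier D; y \<in> carrier D\<rbrakk> \<Longrightarrow> nrm D (x \<oplus> y) \<le> nrm D x + nrm D y"
    and nrm_smult: "x \<in> carrier D \<Longrightarrow> nrm D (c \<odot>\<^bsub>D\<^esub> x) = cmod c * nrm D x"
    and nrm_mult: "\<lbrakk>x \<in> carrier D; y \<in> carrier D\<rbrakk> \<Longrightarrow> nrm D (x \<otimes> y) \<le> nrm D x * nrm D y"
    and nrm_adj_mult: "x \<in> carrier D \<Longrightarrow> nrm D (adj D x \<otimes> x) = (nrm D x)\<^sup>2"
    and complete: "\<lbrakk>\<And>n. \<sigma> n \<in> carrier D;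
            \<And>e. 0 < e \<Longrightarrow> \<exists>N. \<forall>m\<ge>N. \<forall>n\<ge>N. nrm D (\<sigma> m \<ominus> \<sigma> n) < e\<rbrakk>
          \<Longrightarrow> \<exists>x\<in>carrier D. (\<lambda>n. nrm D (\<sigma> n \<ominus> x)) \<longlonglongrightarrow> 0"

definition star_hom :: "('a, 'm) star_alg_scheme \<Rightarrow> ('d, 'n) star_alg_scheme \<Rightarrow> ('a \<Rightarrow> 'd) \<Rightarrow> bool" where
  "star_hom A D \<phi> \<longleftrightarrow> \<phi> \<in> carrier A \<rightarrow> carrier D \<and>
     (\<forall>x\<in>carrier A. \<forall>y\<in>carrier A. \<phi> (x \<oplus>\<^bsub>A\<^esub> y) = \<phi> x \<oplus>\<^bsub>D\<^esub> \<phi> y) \<and>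
     (\<forall>x\<in>carrier A. \<forall>y\<in>carrier A. \<phi> (x \<otimes>\<^bsub>A\<^esub> y) = \<phi> x \<otimes>\<^bsub>D\<^esub> \<phi> y) \<and>
     (\<forall>x\<in>carrier A. \<forall>c. \<phi> (c \<odot>\<^bsub>A\<^esub> x) = c \<odot>\<^bsub>D\<^esub> \<phi> x) \<and>
     (\<forall>x\<in>carrier A. \<phi> (adj A x) = adj D (\<phi> x))"

class cstar_algebra = real_normed_algebra + banach +
  fixes scaleC :: "complex \<Rightarrow> 'a \<Rightarrow> 'a" (infixr "*\<^sub>C" 75)
    and star :: "'a \<Rightarrow> 'a"
  assumes scaleR_eq_scaleC: "scaleR r x = complex_of_real r *\<^sub>C x"
    and scaleC_add_left: "(a + b) *\<^sub>C x = a *\<^sub>C x + b *\<^sub>C x"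
    and scaleC_add_right: "a *\<^sub>C (x + y) = a *\<^sub>C x + a *\<^sub>C y"
    and scaleC_scaleC: "a *\<^sub>C b *\<^sub>C x = (a * b) *\<^sub>C x"
    and mult_scaleC_left: "(a *\<^sub>C x) * y = a *\<^sub>C (x * y)"
    and mult_scaleC_right: "x * (a *\<^sub>C y) = a *\<^sub>C (x * y)"
    and norm_scaleC: "norm (a *\<^sub>C x) = cmod a * norm x"
    and star_star: "star (star x) = x"
    and star_add: "star (x + y) = star x + star y"
    and star_scaleC: "star (a *\<^sub>C x) = cnj a *\<^sub>C star x"
    and star_mult: "star (x * y) = star y * star x"
    and norm_star_mult: "norm (star x * x) = (norm x)\<^sup>2"

definition full_alg :: "'a::cstar_algebra star_alg" where
  "full_alg = \<lparr>carrier = UNIV, mult = (*), one = undefined, zero = 0, add = (+),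
     smult = (*\<^sub>C), adj = star, nrm = norm\<rparr>"

definition cstar_subalgebra :: "'a::cstar_algebra set \<Rightarrow> bool" where
  "cstar_subalgebra S \<longleftrightarrow> 0 \<in> S \<and> (\<forall>x\<in>S. \<forall>y\<in>S. x + y \<in> S) \<and> (\<forall>x\<in>S. \<forall>y\<in>S. x * y \<in> S) \<and>
     (\<forall>c. \<forall>x\<in>S. c *\<^sub>C x \<in> S) \<and> (\<forall>x\<in>S. star x \<in> S) \<and> closed S"

definition commuting :: "'a::times set \<Rightarrow> bool" where
  "commuting S \<longleftrightarrow> (\<forall>x\<in>S. \<forall>y\<in>S. x * y = y * x)"

definition masa :: "'a::cstar_algebra set \<Rightarrow> bool" where
  "masa S \<longleftrightarrow> cstar_subalgebra S \<and> commuting S \<and>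
     (\<forall>T. cstar_subalgebra T \<and> commuting T \<and> S \<subseteq> T \<longrightarrow> T = S)"


section \<open>The C*-algebra of a generalized Boolean dynamical system\<close>

text \<open>Only the values \<open>S \<alpha> B\<close> with \<open>\<alpha> \<in> L\<close> and \<open>B \<in> \<I> \<alpha>\<close> matter.\<close>

definition gbds_representation ::
    "'l set \<Rightarrow> ('l \<Rightarrow> 'b::generalized_boolean_algebra \<Rightarrow> 'b) \<Rightarrow> ('l \<Rightarrow> 'b set) \<Rightarrow>
     ('d, 'm) star_alg_scheme \<Rightarrow> ('b \<Rightarrow> 'd) \<Rightarrow> ('l \<Rightarrow> 'b \<Rightarrow> 'd) \<Rightarrow> bool" where
  "gbds_representation L \<theta> \<I> D P S \<longleftrightarrow>
     (\<forall>A. P A \<in> carrier D \<and> P A \<otimes>\<^bsub>D\<^esub> P A = P A \<and> adj D (P A) = P A) \<and>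
     (\<forall>\<alpha>\<in>L. \<forall>B\<in>\<I> \<alpha>. S \<alpha> B \<in> carrier D \<and> S \<alpha> B \<otimes>\<^bsub>D\<^esub> adj D (S \<alpha> B) \<otimes>\<^bsub>D\<^esub> S \<alpha> B = S \<alpha> B) \<and>
     P bot = \<zero>\<^bsub>D\<^esub> \<and>
     (\<forall>A A'. P (inf A A') = P A \<otimes>\<^bsub>D\<^esub> P A') \<and>
     (\<forall>A A'. P (sup A A') = P A \<oplus>\<^bsub>D\<^esub> P A' \<ominus>\<^bsub>D\<^esub> P (inf A A')) \<and>
     (\<forall>A. \<forall>\<alpha>\<in>L. \<forall>B\<in>\<I> \<alpha>. P A \<otimes>\<^bsub>D\<^esub> S \<alpha> B = S \<alpha> B \<otimes>\<^bsub>D\<^esub> P (\<theta> \<alpha> A)) \<and>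
     (\<forall>\<alpha>\<in>L. \<forall>B\<in>\<I> \<alpha>. \<forall>\<alpha>'\<in>L. \<forall>B'\<in>\<I> \<alpha>'.
        adj D (S \<alpha> B) \<otimes>\<^bsub>D\<^esub> S \<alpha>' B' = (if \<alpha> = \<alpha>' then P (inf B B') else \<zero>\<^bsub>D\<^esub>)) \<and>
     (\<forall>A\<in>regular_elements L \<theta>.
        P A = (\<Oplus>\<^bsub>D\<^esub>\<alpha>\<in>Delta L \<theta> A. S \<alpha> (\<theta> \<alpha> A) \<otimes>\<^bsub>D\<^esub> adj D (S \<alpha> (\<theta> \<alpha> A))))"

text \<open>Formal *-polynomials in the generators. In the C*-algebra generated by a representation every
  element is the limit of a sequence of values of such polynomials. Hence every C*-algebra generated
  by a representation is isomorphic to one whose carrier is a subset of the type \<open>universe\<close> below,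
  and the universal property need only be required for target algebras on that type. The theorem
  \<open>universal_representation_hom\<close> at the end of this theory confirms that it then holds for target
  algebras on arbitrary types.\<close>

datatype ('l, 'b) star_term =
    Zero
  | Proj 'b
  | Piso 'l 'b
  | Add "('l, 'b) star_term" "('l, 'b) star_term"
  | Mult "('l, 'b) star_term" "('l, 'b) star_term"
  | Scale complex "('l, 'b) star_term"
  | Adj "('l, 'b) star_term"

type_synonym ('l, 'b) universe = "nat \<Rightarrow> ('l, 'b) star_term"

definition universal_representation ::
    "'l set \<Rightarrow> ('l \<Rightarrow> 'b::generalized_boolean_algebra \<Rightarrow> 'b) \<Rightarrow> ('l \<Rightarrow> 'b set) \<Rightarrow>
     ('b \<Rightarrow> 'a::cstar_algebra) \<Rightarrow> ('l \<Rightarrow> 'b \<Rightarrow> 'a) \<Rightarrow> bool" where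
  "universal_representation L \<theta> \<I> p s \<longleftrightarrow> gbds_representation L \<theta> \<I> full_alg p s \<and>
     (\<forall>(D :: ('l, 'b) universe star_alg) P S. cstar_alg D \<and> gbds_representation L \<theta> \<I> D P S \<longrightarrow>
        (\<exists>\<phi>. star_hom full_alg D \<phi> \<and> (\<forall>A. \<phi> (p A) = P A) \<and>
             (\<forall>\<alpha>\<in>L. \<forall>B\<in>\<I> \<alpha>. \<phi> (s \<alpha> B) = S \<alpha> B)))"

text \<open>The type \<open>'a\<close> together with \<open>p\<close> and \<open>s\<close> is C*(B, L, \<open>\<theta>\<close>, \<open>\<I>\<close>): the representation is universal
  and generates the whole algebra.\<close>

definition gbds_cstar_algebra ::
    "'l set \<Rightarrow> ('l \<Rightarrow> 'b::generalized_boolean_algebra \<Rightarrow> 'b) \<Rightarrow> ('l \<Rightarrow> 'b set) \<Rightarrow>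
     ('b \<Rightarrow> 'a::cstar_algebra) \<Rightarrow> ('l \<Rightarrow> 'b \<Rightarrow> 'a) \<Rightarrow> bool" where
  "gbds_cstar_algebra L \<theta> \<I> p s \<longleftrightarrow> universal_representation L \<theta> \<I> p s \<and>
     cstar_subalgebra hull (range p \<union> {s \<alpha> B |\<alpha> B. \<alpha> \<in> L \<and> B \<in> \<I> \<alpha>}) = UNIV"

fun word_ideal ::
    "('l \<Rightarrow> 'b::generalized_boolean_algebra \<Rightarrow> 'b) \<Rightarrow> ('l \<Rightarrow> 'b set) \<Rightarrow> 'l list \<Rightarrow> 'b set" where
  "word_ideal \<theta> \<I> [] = UNIV"
| "word_ideal \<theta> \<I> (\<alpha> # w) = {A. \<exists>B\<in>\<I> \<alpha>. A \<le> fold \<theta> w B}"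

text \<open>\<open>word_chain \<theta> s B \<alpha> [\<beta>, \<gamma>, ..., \<omega>] A\<close> is the product of \<open>s \<alpha> B\<close>, \<open>s \<beta> (\<theta> \<beta> B)\<close>,
  \<open>s \<gamma> (\<theta> \<gamma> (\<theta> \<beta> B))\<close>, ..., \<open>s \<omega> A\<close>: only the last factor has index \<open>A\<close>.\<close>

fun word_chain ::
    "('l \<Rightarrow> 'b::generalized_boolean_algebra \<Rightarrow> 'b) \<Rightarrow> ('l \<Rightarrow> 'b \<Rightarrow> 'a::times) \<Rightarrow>
     'b \<Rightarrow> 'l \<Rightarrow> 'l list \<Rightarrow> 'b \<Rightarrow> 'a" where
  "word_chain \<theta> s B \<alpha> [] A = s \<alpha> A"
| "word_chain \<theta> s B \<alpha> (\<beta> # w) A = s \<alpha> B * word_chain \<theta> s (\<theta> \<beta> B) \<beta> w A"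

text \<open>The product does not depend on which admissible \<open>B\<close> is chosen.\<close>

fun s_word ::
    "('l \<Rightarrow> 'b::generalized_boolean_algebra \<Rightarrow> 'b) \<Rightarrow> ('l \<Rightarrow> 'b set) \<Rightarrow>
     ('b \<Rightarrow> 'a::times) \<Rightarrow> ('l \<Rightarrow> 'b \<Rightarrow> 'a) \<Rightarrow> 'l list \<Rightarrow> 'b \<Rightarrow> 'a" where
  "s_word \<theta> \<I> p s [] A = p A"
| "s_word \<theta> \<I> p s (\<alpha> # w) A = word_chain \<theta> s (SOME B. B \<in> \<I> \<alpha> \<and> A \<le> fold \<theta> w B) \<alpha> w A"

definition abelian_core ::
    "'l set \<Rightarrow> ('l \<Rightarrow> 'b::generalized_boolean_algebra \<Rightarrow> 'b) \<Rightarrow> ('l \<Rightarrow> 'b set) \<Rightarrow>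
     ('b \<Rightarrow> 'a::cstar_algebra) \<Rightarrow> ('l \<Rightarrow> 'b \<Rightarrow> 'a) \<Rightarrow> 'a set" where
  "abelian_core L \<theta> \<I> p s = cstar_subalgebra hull
     {s_word \<theta> \<I> p s \<alpha> A * star (s_word \<theta> \<I> p s \<beta> A) |\<alpha> \<beta> A.
        \<alpha> \<in> lists L \<and> \<beta> \<in> lists L \<and> A \<in> word_ideal \<theta> \<I> \<alpha> \<inter> word_ideal \<theta> \<I> \<beta> \<and>
        (\<alpha> = \<beta> \<or> (\<exists>\<gamma>. \<alpha> = \<beta> @ \<gamma> \<and> cycle_no_exits L \<theta> \<gamma> A) \<or>
                 (\<exists>\<gamma>. \<beta> = \<alpha> @ \<gamma> \<and> cycle_no_exits L \<theta> \<gamma> A))}"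


section \<open>The universal property for target algebras on arbitrary types\<close>

lemma cstar_alg_full_alg: "cstar_alg (full_alg :: 'a::cstar_algebra star_alg)"
proof -
  let ?D = "full_alg :: 'a star_alg"
  interpret abelian_group ?D
  proof (rule abelian_groupI)
    show "\<exists>y\<in>carrier ?D. y \<oplus>\<^bsub>?D\<^esub> x = \<zero>\<^bsub>?D\<^esub>" for x
      by (rule bexI[of _ "- x"]) (auto simp: full_alg_def)
  qed (auto simp: full_alg_def algebra_simps)
  have neg: "\<ominus>\<^bsub>?D\<^esub> y = - y" for y :: 'a
    by (rule minus_equality) (auto simp: full_alg_def)
  have minus: "x \<ominus>\<^bsub>?D\<^esub> y = x - y" for x y :: 'a
    using neg[of y] by (simp add: a_minus_def full_alg_def)
  have one: "1 *\<^sub>C x = x" for x :: 'a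
    using scaleR_eq_scaleC[of 1 x] by simp
  show ?thesis
  proof
    fix \<sigma> :: "nat \<Rightarrow> 'a"
    assume C: "\<And>e. 0 < e \<Longrightarrow> \<exists>N. \<forall>m\<ge>N. \<forall>n\<ge>N. nrm ?D (\<sigma> m \<ominus>\<^bsub>?D\<^esub> \<sigma> n) < e"
    have "\<exists>N. \<forall>m\<ge>N. \<forall>n\<ge>N. norm (\<sigma> m - \<sigma> n) < e" if "0 < e" for e
      using C[OF that] by (simp add: minus) (simp add: full_alg_def)
    then have "Cauchy \<sigma>" by (simp add: Cauchy_iff)
    then obtain x where "\<sigma> \<longlonglongrightarrow> x" using Cauchy_convergent_iff convergent_def by blast
    then have "(\<lambda>n. norm (\<sigma> n - x)) \<longlonglongrightarrow> 0"
      by (simp add: LIM_zero_iff tendsto_norm_zero)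
    then show "\<exists>x\<in>carrier ?D. (\<lambda>n. nrm ?D (\<sigma> n \<ominus>\<^bsub>?D\<^esub> x)) \<longlonglongrightarrow> 0"
      by (intro bexI[of _ x]) (simp_all add: minus, simp_all add: full_alg_def)
  qed (auto simp: full_alg_def one distrib_left distrib_right mult.assoc norm_triangle_ineq norm_mult_ineq
       scaleC_add_left scaleC_add_right scaleC_scaleC mult_scaleC_left mult_scaleC_right norm_scaleC
       star_star star_add star_scaleC star_mult norm_star_mult)
qed

context cstar_alg
begin

lemma smult_zero_left: "x \<in> carrier D \<Longrightarrow> 0 \<odot>\<^bsub>D\<^esub> x = \<zero>"
  using smult_distr_left[of x 0 0] smult_closed[of x 0] add.l_cancel_one by auto

lemma smult_zero_right: "c \<odot>\<^bsub>D\<^esub> \<zero> = \<zero>"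
  using smult_assoc[of \<zero> c 0] smult_zero_left[of \<zero>] by simp

lemma adj_zero: "adj D \<zero> = \<zero>"
  using adj_smult[of \<zero> 0] smult_zero_left[of "adj D \<zero>"] smult_zero_left[of \<zero>] adj_closed[of \<zero>]
  by simp

lemma neg_eq: "x \<in> carrier D \<Longrightarrow> \<ominus> x = (-1) \<odot>\<^bsub>D\<^esub> x"
proof (rule minus_equality)
  assume x: "x \<in> carrier D"
  have "(-1) \<odot>\<^bsub>D\<^esub> x \<oplus> 1 \<odot>\<^bsub>D\<^esub> x = \<zero>"
    using smult_distr_left[OF x, of "-1" 1] smult_zero_left[OF x] by simp
  then show "(-1) \<odot>\<^bsub>D\<^esub> x \<oplus> x = \<zero>" by (simp add: smult_one x)
qed (auto simp: smult_closed)

lemma diff_eq: "x \<in> carrier D \<Longrightarrow> y \<in> carrier D \<Longrightarrow> x \<ominus> y = x \<oplus> (-1) \<odot>\<^bsub>D\<^esub> y"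
  by (simp add: a_minus_def neg_eq)

lemma nrm_zero: "nrm D \<zero> = 0"
  by (simp add: nrm_eq_0)

lemma nrm_neg: "x \<in> carrier D \<Longrightarrow> nrm D (\<ominus> x) = nrm D x"
  by (simp add: neg_eq nrm_smult)

lemma nrm_nonneg: "x \<in> carrier D \<Longrightarrow> 0 \<le> nrm D x"
  using nrm_triangle[of x "\<ominus> x"] nrm_neg[of x] r_neg[of x] nrm_zero by simp

lemma nrm_diff_sym: "x \<in> carrier D \<Longrightarrow> y \<in> carrier D \<Longrightarrow> nrm D (x \<ominus> y) = nrm D (y \<ominus> x)"
  using nrm_neg[of "x \<ominus> y"] by (simp add: a_minus_def minus_add a_comm)

lemma nrm_diff_triangle:
  assumes "x \<in> carrier D" "y \<in> carrier D" "z \<in> carrier D"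
  shows "nrm D (x \<ominus> z) \<le> nrm D (x \<ominus> y) + nrm D (y \<ominus> z)"
proof -
  have "x \<ominus> z = (x \<ominus> y) \<oplus> (y \<ominus> z)"
    using assms by (simp add: a_minus_def a_assoc r_neg1)
  then show ?thesis using nrm_triangle assms by simp
qed

lemma nrm_le_diff: "x \<in> carrier D \<Longrightarrow> y \<in> carrier D \<Longrightarrow> nrm D x \<le> nrm D (x \<ominus> y) + nrm D y"
  using nrm_diff_triangle[of x y \<zero>] by (simp add: diff_eq smult_closed smult_zero_right)

lemma nrm_adj: assumes x: "x \<in> carrier D" shows "nrm D (adj D x) = nrm D x"
proof -
  have le: "nrm D x \<le> nrm D (adj D x)" if "x \<in> carrier D" for x
  proof (cases "nrm D x = 0")
    case False
    have "nrm D x * nrm D x \<le> nrm D (adj D x) * nrm D x"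
      using nrm_mult[of "adj D x" x] nrm_adj_mult[OF that] adj_closed that
      by (simp add: power2_eq_square)
    then show ?thesis using False nrm_nonneg[OF that] by simp
  qed (use nrm_nonneg adj_closed that in auto)
  show ?thesis using le[OF x] le[of "adj D x"] adj_closed[OF x] adj_adj[OF x] by simp
qed

text \<open>A closed *-subalgebra of \<open>D\<close>, transported along an injection, is a C*-algebra.\<close>

lemma transport:
  fixes f :: "'a \<Rightarrow> 'u"
  assumes C: "C \<subseteq> carrier D" "\<zero> \<in> C"
    and closed: "\<And>x y. x \<in> C \<Longrightarrow> y \<in> C \<Longrightarrow> x \<oplus> y \<in> C" "\<And>x y. x \<in> C \<Longrightarrow> y \<in> C \<Longrightarrow> x \<otimes> y \<in> C"
      "\<And>x c. x \<in> C \<Longrightarrow> c \<odot>\<^bsub>D\<^esub> x \<in> C" "\<And>x. x \<in> C \<Longrightarrow> adj D x \<in> C"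
    and seq: "\<And>\<sigma> x. (\<And>n. \<sigma> n \<in> C) \<Longrightarrow> x \<in> carrier D \<Longrightarrow> (\<lambda>n. nrm D (\<sigma> n \<ominus> x)) \<longlonglongrightarrow> 0 \<Longrightarrow> x \<in> C"
    and inj: "inj_on f C"
  obtains E :: "'u star_alg" and g where "cstar_alg E" "carrier E = f ` C" "star_hom E D g"
    "\<And>x. x \<in> C \<Longrightarrow> g (f x) = x" "\<zero>\<^bsub>E\<^esub> = f \<zero>"
    "\<And>x y. x \<in> C \<Longrightarrow> y \<in> C \<Longrightarrow> f x \<oplus>\<^bsub>E\<^esub> f y = f (x \<oplus> y)"
    "\<And>x y. x \<in> C \<Longrightarrow> y \<in> C \<Longrightarrow> f x \<ominus>\<^bsub>E\<^esub> f y = f (x \<ominus> y)"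
    "\<And>x y. x \<in> C \<Longrightarrow> y \<in> C \<Longrightarrow> f x \<otimes>\<^bsub>E\<^esub> f y = f (x \<otimes> y)"
    "\<And>x. x \<in> C \<Longrightarrow> adj E (f x) = f (adj D x)"
proof -
  define g where "g = inv_into C f"
  have gf [simp]: "g (f x) = x" if "x \<in> C" for x
    using inj that by (simp add: g_def)
  define E :: "'u star_alg" where
    "E = \<lparr>carrier = f ` C, mult = \<lambda>x y. f (g x \<otimes> g y), one = undefined, zero = f \<zero>,
       add = \<lambda>x y. f (g x \<oplus> g y), smult = \<lambda>c x. f (c \<odot>\<^bsub>D\<^esub> g x), adj = \<lambda>x. f (adj D (g x)),
       nrm = \<lambda>x. nrm D (g x)\<rparr>"
  have E [simp]: "carrier E = f ` C" "\<zero>\<^bsub>E\<^esub> = f \<zero>" "\<And>x y. x \<otimes>\<^bsub>E\<^esub> y = f (g x \<otimes> g y)"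
    "\<And>x y. x \<oplus>\<^bsub>E\<^esub> y = f (g x \<oplus> g y)" "\<And>c x. c \<odot>\<^bsub>E\<^esub> x = f (c \<odot>\<^bsub>D\<^esub> g x)"
    "\<And>x. adj E x = f (adj D (g x))" "\<And>x. nrm E x = nrm D (g x)"
    by (simp_all add: E_def)
  have c [simp]: "x \<in> carrier D" if "x \<in> C" for x using C that by auto
  note [simp] = closed C(2)
  have neg_closed [simp]: "\<ominus> x \<in> C" if "x \<in> C" for x using that by (simp add: neg_eq)
  have diff_closed [simp]: "x \<ominus> y \<in> C" if "x \<in> C" "y \<in> C" for x y using that by (simp add: a_minus_def)
  interpret E: abelian_group E
  proof (rule abelian_groupI)
    fix x assume "x \<in> carrier E"
    then obtain x' where x': "x = f x'" "x' \<in> C" by auto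
    then show "\<exists>y\<in>carrier E. y \<oplus>\<^bsub>E\<^esub> x = \<zero>\<^bsub>E\<^esub>"
      by (intro bexI[of _ "f (\<ominus> x')"]) (auto simp: l_neg)
  qed (auto simp: a_ac)
  have neg: "\<ominus>\<^bsub>E\<^esub> f x = f (\<ominus> x)" if "x \<in> C" for x
    by (rule E.minus_equality) (use that in \<open>auto simp: l_neg\<close>)
  have minus: "f x \<ominus>\<^bsub>E\<^esub> f y = f (x \<ominus> y)" if "x \<in> C" "y \<in> C" for x y
    using that by (simp add: a_minus_def neg)
  have inj': "f x = f y \<longleftrightarrow> x = y" if "x \<in> C" "y \<in> C" for x y
    using inj that by (auto dest: inj_onD)
  have "cstar_alg E"
  proof
    fix \<sigma> :: "nat \<Rightarrow> 'u"
    assume s: "\<And>n. \<sigma> n \<in> carrier E"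
      and cau: "\<And>e. 0 < e \<Longrightarrow> \<exists>N. \<forall>m\<ge>N. \<forall>n\<ge>N. nrm E (\<sigma> m \<ominus>\<^bsub>E\<^esub> \<sigma> n) < e"
    define \<tau> where "\<tau> = g \<circ> \<sigma>"
    have \<tau>: "\<tau> n \<in> C" "\<sigma> n = f (\<tau> n)" for n using s[of n] by (auto simp: \<tau>_def)
    have cau': "\<exists>N. \<forall>m\<ge>N. \<forall>n\<ge>N. nrm D (\<tau> m \<ominus> \<tau> n) < e" if "0 < e" for e
      using cau[OF that] by (simp add: \<tau> minus)
    obtain x where x: "x \<in> carrier D" "(\<lambda>n. nrm D (\<tau> n \<ominus> x)) \<longlonglongrightarrow> 0"
      using complete[of \<tau>] cau' \<tau>(1) by auto
    have "x \<in> C" using seq[OF _ x] \<tau>(1) by blast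
    then show "\<exists>x\<in>carrier E. (\<lambda>n. nrm E (\<sigma> n \<ominus>\<^bsub>E\<^esub> x)) \<longlonglongrightarrow> 0"
      using x(2) by (intro bexI[of _ "f x"]) (auto simp: \<tau> minus)
  qed (auto simp: inj' mult_assoc mult_distr_left mult_distr_right smult_distr_left smult_distr_right
      smult_assoc smult_one smult_mult_left smult_mult_right adj_adj adj_add adj_smult adj_mult
      nrm_eq_0 nrm_triangle nrm_smult nrm_mult nrm_adj_mult)
  moreover have "star_hom E D g" by (auto simp: star_hom_def)
  ultimately show ?thesis by (intro that) (use minus in auto)
qed

end

primrec eval_term ::
    "('d, 'm) star_alg_scheme \<Rightarrow> ('b \<Rightarrow> 'd) \<Rightarrow> ('l \<Rightarrow> 'b \<Rightarrow> 'd) \<Rightarrow> ('l, 'b) star_term \<Rightarrow> 'd" where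
  "eval_term D P S Zero = \<zero>\<^bsub>D\<^esub>"
| "eval_term D P S (Proj A) = P A"
| "eval_term D P S (Piso \<alpha> B) = S \<alpha> B"
| "eval_term D P S (Add t u) = eval_term D P S t \<oplus>\<^bsub>D\<^esub> eval_term D P S u"
| "eval_term D P S (Mult t u) = eval_term D P S t \<otimes>\<^bsub>D\<^esub> eval_term D P S u"
| "eval_term D P S (Scale c t) = c \<odot>\<^bsub>D\<^esub> eval_term D P S t"
| "eval_term D P S (Adj t) = adj D (eval_term D P S t)"

context cstar_alg
begin

lemma generated_subalgebra:
  fixes P :: "'b \<Rightarrow> 'a" and S :: "'l \<Rightarrow> 'b \<Rightarrow> 'a"
  assumes P: "\<And>A. P A \<in> carrier D" and S: "\<And>\<alpha> B. S \<alpha> B \<in> carrier D"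
  obtains C and f :: "'a \<Rightarrow> ('l, 'b) universe" where
    "C \<subseteq> carrier D" "\<zero> \<in> C" "\<And>x y. x \<in> C \<Longrightarrow> y \<in> C \<Longrightarrow> x \<oplus> y \<in> C"
    "\<And>x y. x \<in> C \<Longrightarrow> y \<in> C \<Longrightarrow> x \<otimes> y \<in> C"
    "\<And>x c. x \<in> C \<Longrightarrow> c \<odot>\<^bsub>D\<^esub> x \<in> C" "\<And>x. x \<in> C \<Longrightarrow> adj D x \<in> C"
    "\<And>\<sigma> x. (\<And>n. \<sigma> n \<in> C) \<Longrightarrow> x \<in> carrier D \<Longrightarrow> (\<lambda>n. nrm D (\<sigma> n \<ominus> x)) \<longlonglongrightarrow> 0 \<Longrightarrow> x \<in> C"
    "inj_on f C" "\<And>A. P A \<in> C" "\<And>\<alpha> B. S \<alpha> B \<in> C"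
proof -
  let ?ev = "eval_term D P S"
  have ev [simp]: "?ev t \<in> carrier D" for t
    by (induction t) (auto simp: P S mult_closed smult_closed adj_closed)
  define C where "C = {x \<in> carrier D. \<forall>e>0. \<exists>t. nrm D (?ev t \<ominus> x) < e}"
  have CD: "x \<in> carrier D" if "x \<in> C" for x using that by (simp add: C_def)
  have CI: "x \<in> C" if "x \<in> carrier D" "\<And>e. 0 < e \<Longrightarrow> \<exists>t. nrm D (?ev t \<ominus> x) < e" for x
    using that by (simp add: C_def)
  have CE: "\<exists>t. nrm D (?ev t \<ominus> x) < e" if "x \<in> C" "0 < e" for x e
    using that by (auto simp: C_def)
  have diff_self: "x \<ominus> x = \<zero>" if "x \<in> carrier D" for x using that by (simp add: a_minus_def r_neg)
  have evC: "?ev t \<in> C" for t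
    by (rule CI) (auto intro!: exI[of _ t] simp: diff_self nrm_zero)
  have add: "x \<oplus> y \<in> C" if xy: "x \<in> C" "y \<in> C" for x y
  proof (rule CI)
    fix e :: real assume "0 < e"
    then obtain t u where t: "nrm D (?ev t \<ominus> x) < e/2" and u: "nrm D (?ev u \<ominus> y) < e/2"
      using CE[OF xy(1), of "e/2"] CE[OF xy(2), of "e/2"] by auto
    have "?ev (Add t u) \<ominus> (x \<oplus> y) = (?ev t \<ominus> x) \<oplus> (?ev u \<ominus> y)"
      using CD[OF xy(1)] CD[OF xy(2)] by (simp add: a_minus_def minus_add a_ac)
    then have "nrm D (?ev (Add t u) \<ominus> (x \<oplus> y)) < e"
      using nrm_triangle[of "?ev t \<ominus> x" "?ev u \<ominus> y"] CD[OF xy(1)] CD[OF xy(2)] t u by simp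
    then show "\<exists>t. nrm D (?ev t \<ominus> (x \<oplus> y)) < e" by blast
  qed (use CD xy in auto)
  have scale: "c \<odot>\<^bsub>D\<^esub> x \<in> C" if x: "x \<in> C" for c x
  proof (rule CI)
    fix e :: real assume e: "0 < e"
    obtain t where t: "nrm D (?ev t \<ominus> x) < e / (cmod c + 1)"
      using CE[OF x, of "e / (cmod c + 1)"] e by (auto simp: add_nonneg_pos)
    have "?ev (Scale c t) \<ominus> c \<odot>\<^bsub>D\<^esub> x = c \<odot>\<^bsub>D\<^esub> (?ev t \<ominus> x)"
      using CD[OF x] by (simp add: diff_eq smult_closed smult_distr_right flip: smult_assoc)
    then have "nrm D (?ev (Scale c t) \<ominus> c \<odot>\<^bsub>D\<^esub> x) = cmod c * nrm D (?ev t \<ominus> x)"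
      using CD[OF x] by (simp add: nrm_smult)
    also have "\<dots> \<le> (cmod c + 1) * nrm D (?ev t \<ominus> x)"
      using CD[OF x] by (intro mult_right_mono nrm_nonneg) auto
    also have "\<dots> < e" using t by (simp add: pos_less_divide_eq add_nonneg_pos mult.commute)
    finally show "\<exists>t. nrm D (?ev t \<ominus> c \<odot>\<^bsub>D\<^esub> x) < e" by blast
  qed (use CD x smult_closed in auto)
  have adj: "adj D x \<in> C" if x: "x \<in> C" for x
  proof (rule CI)
    fix e :: real assume "0 < e"
    then obtain t where t: "nrm D (?ev t \<ominus> x) < e" using CE[OF x] by blast
    have "?ev (Adj t) \<ominus> adj D x = adj D (?ev t \<ominus> x)"
      using CD[OF x] by (simp add: diff_eq smult_closed adj_closed adj_add adj_smult)
    then have "nrm D (?ev (Adj t) \<ominus> adj D x) < e" using CD[OF x] t by (simp add: nrm_adj)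
    then show "\<exists>t. nrm D (?ev t \<ominus> adj D x) < e" by blast
  qed (use CD x adj_closed in auto)
  have mult: "x \<otimes> y \<in> C" if xy: "x \<in> C" "y \<in> C" for x y
  proof (rule CI)
    fix e :: real assume e: "0 < e"
    have x: "x \<in> carrier D" and y: "y \<in> carrier D" using CD xy by auto
    define K where "K = nrm D x + 1"
    define M where "M = nrm D y + 1"
    have KM: "0 < K" "0 < M" using nrm_nonneg x y by (auto simp: K_def M_def add_nonneg_pos)
    obtain t where t: "nrm D (?ev t \<ominus> x) < min 1 (e / (2 * M))"
      using CE[OF xy(1), of "min 1 (e / (2 * M))"] e KM by auto
    obtain u where u: "nrm D (?ev u \<ominus> y) < e / (2 * K)"
      using CE[OF xy(2), of "e / (2 * K)"] e KM by auto
    have tK: "nrm D (?ev t) \<le> K" using nrm_le_diff[of "?ev t" x] x t by (simp add: K_def)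
    have "?ev t \<otimes> ?ev u \<ominus> ?ev t \<otimes> y = ?ev t \<otimes> (?ev u \<ominus> y)"
      using y by (simp add: diff_eq mult_closed smult_closed mult_distr_right smult_mult_right)
    then have 1: "nrm D (?ev t \<otimes> ?ev u \<ominus> ?ev t \<otimes> y) \<le> nrm D (?ev t) * nrm D (?ev u \<ominus> y)"
      using nrm_mult y by simp
    have "?ev t \<otimes> y \<ominus> x \<otimes> y = (?ev t \<ominus> x) \<otimes> y"
      using x y by (simp add: diff_eq mult_closed smult_closed mult_distr_left smult_mult_left)
    then have 2: "nrm D (?ev t \<otimes> y \<ominus> x \<otimes> y) \<le> nrm D (?ev t \<ominus> x) * nrm D y"
      using nrm_mult x y by simp
    have 3: "nrm D (?ev t) * nrm D (?ev u \<ominus> y) < e/2"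
    proof -
      have "nrm D (?ev t) * nrm D (?ev u \<ominus> y) \<le> K * nrm D (?ev u \<ominus> y)"
        using tK y by (intro mult_right_mono nrm_nonneg) auto
      also have "\<dots> < K * (e / (2 * K))" using u KM by (intro mult_strict_left_mono)
      finally show ?thesis using KM by simp
    qed
    have 4: "nrm D (?ev t \<ominus> x) * nrm D y \<le> e/2"
    proof -
      have "nrm D (?ev t \<ominus> x) * nrm D y \<le> (e / (2 * M)) * M"
        using t x y e KM by (intro mult_mono) (auto simp: M_def nrm_nonneg)
      then show ?thesis using KM by simp
    qed
    have "nrm D (?ev (Mult t u) \<ominus> x \<otimes> y) < e"
      using nrm_diff_triangle[of "?ev t \<otimes> ?ev u" "?ev t \<otimes> y" "x \<otimes> y"] x y 1 2 3 4
      by (simp add: mult_closed)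
    then show "\<exists>t. nrm D (?ev t \<ominus> x \<otimes> y) < e" by blast
  qed (use CD xy mult_closed in auto)
  have seq: "x \<in> C" if s: "\<And>n. \<sigma> n \<in> C" and x: "x \<in> carrier D"
    and lim: "(\<lambda>n. nrm D (\<sigma> n \<ominus> x)) \<longlonglongrightarrow> 0" for \<sigma> x
  proof (rule CI[OF x])
    fix e :: real assume e: "0 < e"
    then have "eventually (\<lambda>n. nrm D (\<sigma> n \<ominus> x) < e/2) sequentially"
      using order_tendstoD(2)[OF lim, of "e/2"] by simp
    then obtain n where n: "nrm D (\<sigma> n \<ominus> x) < e/2"
      using eventually_happens[of _ sequentially] by auto
    obtain t where t: "nrm D (?ev t \<ominus> \<sigma> n) < e/2" using CE[OF s[of n], of "e/2"] e by auto
    have "nrm D (?ev t \<ominus> x) < e"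
      using nrm_diff_triangle[of "?ev t" "\<sigma> n" x] CD[OF s[of n]] x n t by simp
    then show "\<exists>t. nrm D (?ev t \<ominus> x) < e" by blast
  qed
  define f where "f x = (SOME \<sigma>. \<forall>n. nrm D (?ev (\<sigma> n) \<ominus> x) < 1 / real (Suc n))" for x
  have f: "nrm D (?ev (f x n) \<ominus> x) < 1 / real (Suc n)" if "x \<in> C" for x n
  proof -
    have "\<exists>\<sigma>. \<forall>n. nrm D (?ev (\<sigma> n) \<ominus> x) < 1 / real (Suc n)"
      by (rule choice) (use CE[OF that] in auto)
    then have "\<forall>n. nrm D (?ev (f x n) \<ominus> x) < 1 / real (Suc n)"
      unfolding f_def by (rule someI_ex)
    then show ?thesis by blast
  qed
  have "inj_on f C"
  proof (rule inj_onI)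
    fix x y assume xy: "x \<in> C" "y \<in> C" "f x = f y"
    have c: "x \<in> carrier D" "y \<in> carrier D" using CD xy by auto
    have small: "nrm D (x \<ominus> y) < 2 * (1 / real (Suc n))" for n
      using nrm_diff_triangle[of x "?ev (f x n)" y] nrm_diff_sym[of x "?ev (f x n)"]
        f[OF xy(1), of n] f[OF xy(2), of n] xy(3) c by simp
    have "nrm D (x \<ominus> y) \<le> 0"
    proof (rule ccontr)
      assume "\<not> nrm D (x \<ominus> y) \<le> 0"
      then have "0 < nrm D (x \<ominus> y) / 2" by simp
      then obtain n where "1 / real (Suc n) < nrm D (x \<ominus> y) / 2"
        using nat_approx_posE by blast
      then show False using small[of n] by simp
    qed
    then have "x \<ominus> y = \<zero>" using nrm_nonneg[of "x \<ominus> y"] nrm_eq_0[of "x \<ominus> y"] c by simp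
    then have "(x \<ominus> y) \<oplus> y = \<zero> \<oplus> y" by simp
    then show "x = y" using c by (simp add: a_minus_def a_assoc l_neg)
  qed
  have sub: "C \<subseteq> carrier D" using CD by blast
  have zero: "\<zero> \<in> C" using evC[of Zero] by simp
  have PC: "P A \<in> C" for A using evC[of "Proj A"] by simp
  have SC: "S \<alpha> B \<in> C" for \<alpha> B using evC[of "Piso \<alpha> B"] by simp
  show ?thesis by (rule that[of C f]) (fact sub zero add mult scale adj seq \<open>inj_on f C\<close> PC SC)+
qed

end

theorem universal_representation_hom:
  fixes L :: "'l set" and \<theta> :: "'l \<Rightarrow> 'b::generalized_boolean_algebra \<Rightarrow> 'b"
    and p :: "'b \<Rightarrow> 'a::cstar_algebra" and D :: "('d, 'm) star_alg_scheme" (structure)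
  assumes sys: "generalized_boolean_dynamical_system L \<theta> \<I>"
    and univ: "universal_representation L \<theta> \<I> p s"
    and D: "cstar_alg D" and rep: "gbds_representation L \<theta> \<I> D P S"
  shows "\<exists>\<phi>. star_hom full_alg D \<phi> \<and> (\<forall>A. \<phi> (p A) = P A) \<and> (\<forall>\<alpha>\<in>L. \<forall>B\<in>\<I> \<alpha>. \<phi> (s \<alpha> B) = S \<alpha> B)"
proof -
  interpret cstar_alg D by (rule D)
  define T where "T = (\<lambda>\<alpha> B. if \<alpha> \<in> L \<and> B \<in> \<I> \<alpha> then S \<alpha> B else \<zero>)"
  have P: "P A \<in> carrier D" for A using rep by (simp add: gbds_representation_def)
  have S: "S \<alpha> B \<in> carrier D" if "\<alpha> \<in> L" "B \<in> \<I> \<alpha>" for \<alpha> B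
    using rep that by (simp add: gbds_representation_def)
  have T: "T \<alpha> B \<in> carrier D" for \<alpha> B using S by (simp add: T_def)
  obtain C and f :: "'d \<Rightarrow> ('l, 'b) universe" where C: "C \<subseteq> carrier D" "\<zero> \<in> C"
    "\<And>x y. x \<in> C \<Longrightarrow> y \<in> C \<Longrightarrow> x \<oplus> y \<in> C" "\<And>x y. x \<in> C \<Longrightarrow> y \<in> C \<Longrightarrow> x \<otimes> y \<in> C"
    "\<And>x c. x \<in> C \<Longrightarrow> c \<odot>\<^bsub>D\<^esub> x \<in> C" "\<And>x. x \<in> C \<Longrightarrow> adj D x \<in> C"
    "\<And>\<sigma> x. (\<And>n. \<sigma> n \<in> C) \<Longrightarrow> x \<in> carrier D \<Longrightarrow> (\<lambda>n. nrm D (\<sigma> n \<ominus> x)) \<longlonglongrightarrow> 0 \<Longrightarrow> x \<in> C"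
    and inj: "inj_on f C" and PC: "\<And>A. P A \<in> C" and TC: "\<And>\<alpha> B. T \<alpha> B \<in> C"
  proof (rule generated_subalgebra[of P T, OF P T], goal_cases)
    case (1 C f)
    show ?case by (rule 1(1)) (fact 1)+
  qed
  obtain E :: "('l, 'b) universe star_alg" and g where E: "cstar_alg E" "carrier E = f ` C"
    and hom: "star_hom E D g" and gf: "\<And>x. x \<in> C \<Longrightarrow> g (f x) = x" and zero: "\<zero>\<^bsub>E\<^esub> = f \<zero>"
    and add: "\<And>x y. x \<in> C \<Longrightarrow> y \<in> C \<Longrightarrow> f x \<oplus>\<^bsub>E\<^esub> f y = f (x \<oplus> y)"
    and minus: "\<And>x y. x \<in> C \<Longrightarrow> y \<in> C \<Longrightarrow> f x \<ominus>\<^bsub>E\<^esub> f y = f (x \<ominus> y)"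
    and mult: "\<And>x y. x \<in> C \<Longrightarrow> y \<in> C \<Longrightarrow> f x \<otimes>\<^bsub>E\<^esub> f y = f (x \<otimes> y)"
    and adj: "\<And>x. x \<in> C \<Longrightarrow> adj E (f x) = f (adj D x)"
  proof (rule transport[of C f], goal_cases)
    case (9 E g)
    show ?case by (rule 9(1)) (fact 9)+
  qed (rule inj C(1,2) | (rule C(3-6); assumption) | (rule C(7); assumption))+
  interpret E: cstar_alg E by (rule E)
  have SC: "S \<alpha> B \<in> C" if "\<alpha> \<in> L" "B \<in> \<I> \<alpha>" for \<alpha> B
    using TC[of \<alpha> B] that by (simp add: T_def)
  have sum: "finsum E (\<lambda>a. f (h a)) X = f (finsum D h X) \<and> finsum D h X \<in> C"
    if "finite X" "\<And>a. a \<in> X \<Longrightarrow> h a \<in> C" for h :: "'l \<Rightarrow> 'd" and X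
    using that
  proof (induction X)
    case empty
    then show ?case by (simp add: zero C(2))
  next
    case (insert a X)
    have D': "h \<in> X \<rightarrow> carrier D" "h a \<in> carrier D" using insert.prems C(1) by auto
    have E': "(\<lambda>a. f (h a)) \<in> X \<rightarrow> carrier E" "f (h a) \<in> carrier E"
      using insert.prems E(2) by auto
    show ?case using insert by (simp add: D' E' add C(3))
  qed
  have "gbds_representation L \<theta> \<I> E (\<lambda>A. f (P A)) (\<lambda>\<alpha> B. f (S \<alpha> B))"
    unfolding gbds_representation_def
  proof (intro conjI allI ballI, goal_cases)
    case (11 A)
    have fin: "finite (Delta L \<theta> A)"
    proof (cases "A = bot")
      case True
      have "Delta L \<theta> bot = {}" using sys
        by (auto simp: Delta_def generalized_boolean_dynamical_system_def boolean_dynamical_system_def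
            boolean_action_def)
      then show ?thesis using True by simp
    next
      case False
      then show ?thesis using 11 by (auto simp: regular_elements_def)
    qed
    have SA: "S \<alpha> (\<theta> \<alpha> A) \<in> C" if "\<alpha> \<in> Delta L \<theta> A" for \<alpha>
    proof (rule SC)
      show \<alpha>: "\<alpha> \<in> L" using that by (simp add: Delta_def)
      then have "range (\<theta> \<alpha>) \<subseteq> \<I> \<alpha>"
        using sys by (simp add: generalized_boolean_dynamical_system_def)
      then show "\<theta> \<alpha> A \<in> \<I> \<alpha>" by auto
    qed
    have "(\<Oplus>\<^bsub>E\<^esub>\<alpha>\<in>Delta L \<theta> A. f (S \<alpha> (\<theta> \<alpha> A)) \<otimes>\<^bsub>E\<^esub> adj E (f (S \<alpha> (\<theta> \<alpha> A))))
        = (\<Oplus>\<^bsub>E\<^esub>\<alpha>\<in>Delta L \<theta> A. f (S \<alpha> (\<theta> \<alpha> A) \<otimes> adj D (S \<alpha> (\<theta> \<alpha> A))))"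
      by (rule E.finsum_cong') (auto simp: SA mult adj C E(2))
    also have "\<dots> = f (\<Oplus>\<alpha>\<in>Delta L \<theta> A. S \<alpha> (\<theta> \<alpha> A) \<otimes> adj D (S \<alpha> (\<theta> \<alpha> A)))"
      using sum[OF fin, of "\<lambda>\<alpha>. S \<alpha> (\<theta> \<alpha> A) \<otimes> adj D (S \<alpha> (\<theta> \<alpha> A))"] by (simp add: SA C)
    also have "\<dots> = f (P A)" using rep 11 by (simp add: gbds_representation_def)
    finally show ?case by simp
  qed (use rep in \<open>auto simp: gbds_representation_def PC SC mult adj add minus zero E(2) C\<close>)
  then obtain \<psi> where \<psi>: "star_hom full_alg E \<psi>" "\<And>A. \<psi> (p A) = f (P A)"
    "\<And>\<alpha> B. \<alpha> \<in> L \<Longrightarrow> B \<in> \<I> \<alpha> \<Longrightarrow> \<psi> (s \<alpha> B) = f (S \<alpha> B)"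
    using univ E(1) unfolding universal_representation_def by blast
  have "star_hom full_alg D (g \<circ> \<psi>)"
    using \<psi>(1) hom by (auto simp: star_hom_def Pi_iff)
  then show ?thesis using \<psi>(2,3) by (intro exI[of _ "g \<circ> \<psi>"]) (auto simp: gf PC SC)
qed

end

theory Submission
  imports Defs
begin

text \<open>Under Condition (L) no generator of the abelian core comes from a cycle without exits, so the core
  is generated by the range projections \<open>e w A = S w A (S w A)\<^sup>*\<close>, which commute with one another. Let
  \<open>D\<close> be their closed span; it is contained in the core. Everything rests on showing that an
  element \<open>x\<close> that commutes with all range projections lies in \<open>D\<close> (\<open>centralizer_subset_diagonal\<close>).

  By the universal property the circle acts on the algebra (\<open>gauge\<close>) and fixes the range projections,
  so the Fourier coefficients of \<open>x\<close> commute with them too. The coefficient of degree \<open>k\<close> is a limit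
  of combinations of monomials \<open>S \<alpha> A (S \<beta> A)\<^sup>*\<close> with \<open>|\<alpha>| - |\<beta>| = k\<close>, and by Fejer's theorem \<open>x\<close> is
  its zeroth coefficient as soon as the others vanish (\<open>equal_zeroth_coefficient\<close>).

  In degree 0 a monomial either belongs to \<open>D\<close>, or \<open>\<alpha>\<close> and \<open>\<beta>\<close> are different words of the same length.
  In that case it maps the complement of a range projection into its range, and replacing \<open>z\<close> by
  \<open>q z q + (1 - q) z (1 - q)\<close> for this projection \<open>q\<close> removes it. This operation is contractive and
  does not change \<open>x\<close>, so an approximation of \<open>x\<close> by degree 0 monomials can be improved to one from
  \<open>D\<close> (\<open>centralizer_degree_0\<close>).

  In degree \<open>k \<noteq> 0\<close> the coefficient \<open>x\<close> vanishes (\<open>centralizer_nonzero_degree\<close>). Its square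
  \<open>x\<^sup>* x\<close> has degree 0 and thus lies in \<open>D\<close>. If \<open>x \<noteq> 0\<close>, there is a nonzero range projection on which
  \<open>x\<^sup>* x\<close> is nearly a scalar close to its norm (\<open>atom_contains_range\<close>). Condition (L) provides a
  smaller nonzero range projection \<open>q\<close> with \<open>q v q = 0\<close> for each of the finitely many monomials \<open>v\<close> in
  an approximation of \<open>x\<close> (\<open>avoidable_monomial\<close>). Then \<open>x q = q x q\<close> is small, a contradiction.

  The last argument needs that \<open>p A \<noteq> 0\<close> for every nonempty \<open>A\<close> (\<open>universal_projection_nonzero\<close>), for
  otherwise Condition (L) would say nothing about the algebra. This is shown by representing the
  system on the Hilbert space over a set of paths.\<close>

section \<open>Elementary facts about C*-algebras\<close>

lemma scaleC_one [simp]: "1 *\<^sub>C x = (x::'a::cstar_algebra)"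
  using scaleR_eq_scaleC[of 1 x] by simp

lemma scaleC_zero_left [simp]: "0 *\<^sub>C x = (0::'a::cstar_algebra)"
  using scaleR_eq_scaleC[of 0 x] by simp

lemma scaleC_zero_right [simp]: "c *\<^sub>C (0::'a::cstar_algebra) = 0"
  using scaleC_add_right[of c 0 "0::'a"] by simp

lemma scaleC_minus_right: "c *\<^sub>C (- x) = - (c *\<^sub>C (x::'a::cstar_algebra))"
  using scaleC_add_right[of c x "- x"] by (simp add: eq_neg_iff_add_eq_0 add.commute)

lemma scaleC_minus_left: "(- c) *\<^sub>C x = - (c *\<^sub>C (x::'a::cstar_algebra))"
  using scaleC_add_left[of c "- c" x] by (simp add: eq_neg_iff_add_eq_0 add.commute)

lemma scaleC_diff_right: "c *\<^sub>C (x - y) = c *\<^sub>C x - c *\<^sub>C (y::'a::cstar_algebra)"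
  using scaleC_add_right[of c x "- y"] by (simp add: scaleC_minus_right)

lemma scaleC_scaleR_commute: "c *\<^sub>C r *\<^sub>R x = r *\<^sub>R c *\<^sub>C (x::'a::cstar_algebra)"
  by (simp add: scaleR_eq_scaleC scaleC_scaleC mult.commute)

lemma bounded_linear_scaleC: "bounded_linear (\<lambda>x. c *\<^sub>C (x::'a::cstar_algebra))"
  by (rule bounded_linear_intro[of _ "cmod c"])
    (auto simp: scaleC_add_right scaleC_scaleR_commute norm_scaleC)

lemma star_zero [simp]: "star (0::'a::cstar_algebra) = 0"
  using star_add[of 0 "0::'a"] by simp

lemma star_minus: "star (- x) = - star (x::'a::cstar_algebra)"
  using star_add[of x "- x"] by (simp add: eq_neg_iff_add_eq_0 add.commute)

lemma star_diff: "star (x - y) = star x - star (y::'a::cstar_algebra)"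
  using star_add[of x "- y"] by (simp add: star_minus)

lemma star_scaleR: "star (r *\<^sub>R x) = r *\<^sub>R star (x::'a::cstar_algebra)"
  by (simp add: scaleR_eq_scaleC star_scaleC)

lemma norm_star: "norm (star x) = norm (x::'a::cstar_algebra)"
proof -
  have le: "norm x \<le> norm (star x)" for x :: 'a
  proof (cases "x = 0")
    case False
    have "norm x * norm x \<le> norm (star x) * norm x"
      using norm_mult_ineq[of "star x" x] by (simp add: norm_star_mult power2_eq_square)
    then show ?thesis using False by simp
  qed simp
  show ?thesis using le[of x] le[of "star x"] by (simp add: star_star)
qed

lemma bounded_linear_star: "bounded_linear (star :: 'a::cstar_algebra \<Rightarrow> 'a)"
  by (rule bounded_linear_intro[of _ 1]) (auto simp: star_add star_scaleR norm_star)

lemma star_mult_self_eq_0: "star x * x = 0 \<Longrightarrow> x = (0::'a::cstar_algebra)"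
  using norm_star_mult[of x] by simp

lemma eq_if_star_mult_diff_eq_0: "star (x - y) * (x - y) = 0 \<Longrightarrow> x = (y::'a::cstar_algebra)"
  using star_mult_self_eq_0[of "x - y"] by simp

definition projection :: "'a::cstar_algebra \<Rightarrow> bool" where
  "projection q \<longleftrightarrow> q * q = q \<and> star q = q"

lemma projection_idem: "projection q \<Longrightarrow> q * q = q"
  and projection_star: "projection q \<Longrightarrow> star q = q"
  by (simp_all add: projection_def)

lemma projection_idem_left: "projection q \<Longrightarrow> q * (q * x) = q * x"
  by (simp add: projection_def flip: mult.assoc)

lemma norm_projection: "projection q \<Longrightarrow> q \<noteq> 0 \<Longrightarrow> norm q = 1"
  using norm_star_mult[of q] by (simp add: projection_def power2_eq_square)

lemma norm_projection_le: "projection q \<Longrightarrow> norm q \<le> 1"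
  using norm_projection[of q] by (cases "q = 0") auto

lemma norm_projection_mult_le: "projection q \<Longrightarrow> norm (q * x) \<le> norm x"
  using norm_mult_ineq[of q x] norm_projection_le[of q] mult_right_mono[of "norm q" 1 "norm x"] by simp

lemma norm_mult_projection_le: "projection q \<Longrightarrow> norm (x * q) \<le> norm x"
  using norm_mult_ineq[of x q] norm_projection_le[of q] mult_left_mono[of "norm q" 1 "norm x"] by simp

lemma norm_projection_compression_le: "projection q \<Longrightarrow> norm (q * x * q) \<le> norm x"
  by (meson norm_mult_projection_le norm_projection_mult_le order_trans)

definition reflect :: "'a::cstar_algebra \<Rightarrow> 'a \<Rightarrow> 'a" where
  "reflect q x = 2 *\<^sub>R (q * x) - x"

lemma norm_reflect: assumes "projection q" shows "norm (reflect q x) = norm x"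
proof -
  have "star (reflect q x) * reflect q x = star x * x"
    using assms by (simp add: reflect_def star_diff star_scaleR star_mult projection_def algebra_simps
        flip: mult.assoc) (simp add: mult.assoc projection_idem_left[OF assms] flip: scaleR_left.add)
  then have "(norm (reflect q x))\<^sup>2 = (norm x)\<^sup>2" by (metis norm_star_mult)
  then show ?thesis by simp
qed

text \<open>Cutting down to the two corners of \<open>q\<close> averages \<open>x\<close> with its conjugate by the unitary
  \<open>2q - 1\<close>, which need not belong to the algebra.\<close>

definition pinch :: "'a::cstar_algebra \<Rightarrow> 'a \<Rightarrow> 'a" where
  "pinch q x = x - q * x - x * q + 2 *\<^sub>R (q * x * q)"

lemma pinch_eq: assumes "projection q"
  shows "pinch q x = (1/2) *\<^sub>R (x + star (reflect q (star (reflect q x))))"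
proof -
  have "star (reflect q (star y)) = 2 *\<^sub>R (y * q) - y" for y
    using assms by (simp add: reflect_def star_diff star_scaleR star_mult star_star projection_star)
  then have "x + star (reflect q (star (reflect q x))) = x + (2 *\<^sub>R (reflect q x * q) - reflect q x)"
    by simp
  also have "\<dots> = 2 *\<^sub>R pinch q x"
    by (simp add: pinch_def reflect_def left_diff_distrib distrib_right scaleR_diff_right scaleR_add_right scaleR_2)
  finally show ?thesis by simp
qed

lemma norm_pinch_le: assumes "projection q" shows "norm (pinch q x) \<le> norm x"
proof -
  have "norm (x + star (reflect q (star (reflect q x)))) \<le> norm x + norm x"
    by (rule norm_triangle_le) (simp add: norm_star norm_reflect assms)
  then show ?thesis by (simp add: pinch_eq assms)
qed

lemma pinch_add: "pinch q (x + y) = pinch q x + pinch q y"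
  by (simp add: pinch_def algebra_simps)

lemma pinch_diff: "pinch q (x - y) = pinch q x - pinch q y"
  by (simp add: pinch_def algebra_simps)

lemma pinch_commute: "projection q \<Longrightarrow> q * x = x * q \<Longrightarrow> pinch q x = x"
  by (simp add: pinch_def mult.assoc projection_idem scaleR_2)

lemma pinch_eq_0: "q * x = x \<Longrightarrow> x * q = 0 \<Longrightarrow> pinch q x = 0"
  by (simp add: pinch_def)

lemma norm_selfadjoint_square: "star h = h \<Longrightarrow> norm (h * h) = (norm (h::'a::cstar_algebra))\<^sup>2"
  using norm_star_mult[of h] by simp

lemma norm_orthogonal_selfadjoint_power_le:
  fixes \<alpha> \<beta> :: "'a::cstar_algebra"
  assumes "star \<alpha> = \<alpha>" "star \<beta> = \<beta>" "\<alpha> * \<beta> = 0" "\<beta> * \<alpha> = 0" "norm \<alpha> \<le> M" "norm \<beta> \<le> M"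
  shows "norm (\<alpha> + \<beta>) ^ (2 ^ n) \<le> 2 * M ^ (2 ^ n)"
  using assms
proof (induction n arbitrary: \<alpha> \<beta> M)
  case 0
  then show ?case using norm_triangle_ineq[of \<alpha> \<beta>] by simp
next
  case (Suc n)
  have sq: "(\<alpha> + \<beta>) * (\<alpha> + \<beta>) = \<alpha> * \<alpha> + \<beta> * \<beta>" using Suc.prems by (simp add: algebra_simps)
  have "norm (\<alpha> * \<alpha> + \<beta> * \<beta>) ^ (2 ^ n) \<le> 2 * (M\<^sup>2) ^ (2 ^ n)"
  proof (rule Suc.IH)
    show "\<alpha> * \<alpha> * (\<beta> * \<beta>) = 0" "\<beta> * \<beta> * (\<alpha> * \<alpha>) = 0"
      using Suc.prems by (metis mult.assoc mult_zero_left mult_zero_right)+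
  qed (use Suc.prems in \<open>auto simp: star_mult norm_selfadjoint_square intro!: power_mono\<close>)
  moreover have "norm (\<alpha> * \<alpha> + \<beta> * \<beta>) = (norm (\<alpha> + \<beta>))\<^sup>2"
    using norm_selfadjoint_square[of "\<alpha> + \<beta>"] Suc.prems sq by (simp add: star_add)
  ultimately show ?case by (simp add: power_mult [symmetric])
qed

text \<open>Powers of orthogonal elements add, so the factor 2 in the bound for the \<open>2\<^sup>n\<close>-th power disappears
  after taking roots.\<close>

lemma norm_orthogonal_selfadjoint_le:
  fixes \<alpha> \<beta> :: "'a::cstar_algebra"
  assumes "star \<alpha> = \<alpha>" "star \<beta> = \<beta>" "\<alpha> * \<beta> = 0" "\<beta> * \<alpha> = 0" "norm \<alpha> \<le> M" "norm \<beta> \<le> M"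
  shows "norm (\<alpha> + \<beta>) \<le> M"
proof (rule ccontr)
  assume less: "\<not> norm (\<alpha> + \<beta>) \<le> M"
  have "0 \<le> M" using assms(5) norm_ge_zero order_trans by blast
  show False
  proof (cases "M = 0")
    case True
    then show ?thesis using assms(5,6) less by auto
  next
    case False
    then have M: "0 < M" using \<open>0 \<le> M\<close> by simp
    define t where "t = norm (\<alpha> + \<beta>) / M"
    have t: "1 < t" using less M by (simp add: t_def)
    obtain n where n: "2 < t ^ n" using real_arch_pow[OF t] by blast
    have "t ^ n \<le> t ^ (2 ^ n)" using t by (intro power_increasing) (auto simp: less_imp_le)
    also have "\<dots> \<le> 2"
      using norm_orthogonal_selfadjoint_power_le[OF assms, of n] M
      by (simp add: t_def power_divide divide_le_eq)
    finally show False using n by simp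
  qed
qed

text \<open>The squares of the two corners are orthogonal, so the norm of \<open>g\<close> is the larger of their norms.\<close>

lemma norm_le_max_corners:
  fixes g :: "'a::cstar_algebra"
  assumes q: "projection q" and comm: "q * g = g * q"
  shows "norm g \<le> norm (q * g) \<or> norm g \<le> norm (g - q * g)"
proof -
  let ?a = "q * g" and ?b = "g - q * g"
  define M where "M = max (norm ?a) (norm ?b)"
  have qq: "q * (q * x) = q * x" for x using q by (simp add: projection_idem_left)
  have sq: "star q = q" using q by (rule projection_star)
  have comm': "star g * q = q * star g"
    using arg_cong[OF comm, of star] by (simp add: star_mult sq)
  have a1: "star ?a = star g * q" and b1: "star ?b = star g - star g * q"
    by (simp_all add: star_mult star_diff sq)
  have ab: "star ?a * ?b = 0" "star ?b * ?a = 0"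
    unfolding a1 b1 by (simp_all add: left_diff_distrib right_diff_distrib mult.assoc qq)
  have ba: "?a * star ?b = 0" "?b * star ?a = 0"
    unfolding a1 b1 unfolding comm comm'
    by (simp_all add: left_diff_distrib right_diff_distrib mult.assoc qq)
  have "norm (star ?a * ?a + star ?b * ?b) \<le> M\<^sup>2"
  proof (rule norm_orthogonal_selfadjoint_le)
    have "star ?a * ?a * (star ?b * ?b) = star ?a * (?a * star ?b) * ?b"
      "star ?b * ?b * (star ?a * ?a) = star ?b * (?b * star ?a) * ?a" by (simp_all only: mult.assoc)
    then show "star ?a * ?a * (star ?b * ?b) = 0" "star ?b * ?b * (star ?a * ?a) = 0"
      unfolding ab ba by simp_all
    show "star (star ?a * ?a) = star ?a * ?a" "star (star ?b * ?b) = star ?b * ?b"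
      by (simp_all only: star_mult star_star)
    show "norm (star ?a * ?a) \<le> M\<^sup>2" "norm (star ?b * ?b) \<le> M\<^sup>2"
      unfolding norm_star_mult by (auto simp: M_def intro!: power_mono)
  qed
  also have "star ?a * ?a + star ?b * ?b = star (?a + ?b) * (?a + ?b)"
    using ab by (simp only: star_add distrib_left distrib_right) simp
  finally have "(norm g)\<^sup>2 \<le> M\<^sup>2" by (simp add: norm_star_mult)
  then have "norm g \<le> M" by (rule power2_le_imp_le) (simp add: M_def le_max_iff_disj)
  then show ?thesis by (auto simp: M_def)
qed

text \<open>The square root of \<open>1 - a\<^sup>2\<close> is written as \<open>1 - c\<close> because the algebra need not have a unit. The
  map \<open>c \<mapsto> (a\<^sup>2 + c\<^sup>2)/2\<close>, whose fixed point is \<open>c\<close>, is a contraction of the ball of radius \<open>\<parallel>a\<parallel> < 1\<close>.\<close>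

lemma sqrt_one_minus_square:
  fixes a :: "'a::cstar_algebra"
  assumes sa: "star a = a" and na: "norm a < 1"
  obtains c where "star c = c" "c * a = a * c" "2 *\<^sub>R c = a * a + c * c"
proof -
  define r where "r = norm a"
  have r: "0 \<le> r" "r < 1" using na by (simp_all add: r_def)
  let ?S = "cball 0 r \<inter> {c. star c = c} \<inter> {c. c * a = a * c}"
  let ?f = "\<lambda>c. (1/2) *\<^sub>R (a * a + c * c)"
  interpret st: bounded_linear "star :: 'a \<Rightarrow> 'a" by (rule bounded_linear_star)
  have sq: "norm (c * c) \<le> r" if "norm c \<le> r" for c :: 'a
  proof -
    have "norm (c * c) \<le> r * r"
      using norm_mult_ineq[of c c] mult_mono[OF that that] r by simp
    also have "\<dots> \<le> r" using r by (simp add: mult_left_le_one_le)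
    finally show ?thesis .
  qed
  have "\<exists>!c\<in>?S. ?f c = c"
  proof (rule Banach_fix[of _ r])
    have "closed ?S"
      by (intro closed_Int closed_cball closed_Collect_eq continuous_intros st.continuous_on)
    then show "complete ?S" by (simp add: complete_eq_closed)
    have "0 \<in> ?S" using r by simp
    then show "?S \<noteq> {}" by blast
    show "?f ` ?S \<subseteq> ?S"
    proof (intro image_subsetI IntI CollectI)
      fix c assume c: "c \<in> ?S"
      have "norm (a * a + c * c) \<le> r + r"
        using sq[of a] sq[of c] c by (intro norm_triangle_le) (simp add: r_def)
      then show "?f c \<in> cball 0 r" by simp
      show "star (?f c) = ?f c" using c sa by (simp add: star_scaleR star_add star_mult)
      have "c * a = a * c" using c by simp
      then have "c * c * a = a * (c * c)" by (metis mult.assoc)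
      then show "?f c * a = a * ?f c"
        by (simp only: mult_scaleR_left mult_scaleR_right distrib_left distrib_right) (simp add: mult.assoc)
    qed
    fix x y assume x: "x \<in> ?S" and y: "y \<in> ?S"
    have "?f x - ?f y = (1/2) *\<^sub>R (x * (x - y) + (x - y) * y)"
      by (simp add: algebra_simps)
    moreover have "norm (x * (x - y) + (x - y) * y) \<le> r * norm (x - y) + r * norm (x - y)"
    proof (rule norm_triangle_le, rule add_mono)
      show "norm (x * (x - y)) \<le> r * norm (x - y)"
        using x norm_mult_ineq[of x "x - y"] mult_right_mono[of "norm x" r "norm (x - y)"] by simp
      show "norm ((x - y) * y) \<le> r * norm (x - y)"
        using y norm_mult_ineq[of "x - y" y] mult_right_mono[of "norm y" r "norm (x - y)"]
        by (simp add: mult.commute)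
    qed
    ultimately show "dist (?f x) (?f y) \<le> r * dist x y" by (simp add: dist_norm)
  qed (use r in auto)
  then obtain c where c: "c \<in> ?S" "?f c = c" by blast
  have "2 *\<^sub>R ?f c = a * a + c * c" by simp
  then show ?thesis using that[of c] c by simp
qed

text \<open>The hypothesis says \<open>b\<^sup>2 + (1 - h)\<^sup>2 = 1\<close>. Hence \<open>b + i(1 - h)\<close> and its adjoint are unitary, and \<open>b\<close> is
  their average.\<close>

lemma norm_le_1_if_sum_of_squares:
  fixes b h :: "'a::cstar_algebra"
  assumes sa: "star b = b" "star h = h" and comm: "h * b = b * h" and eq: "2 *\<^sub>R h = b * b + h * h"
  shows "norm b \<le> 1"
proof -
  define u where "u s x = b * x + (s * \<i>) *\<^sub>C (x - h * x)" for s x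
  \<comment> \<open>Left multiplication by the formal unitary \<open>b \<plusminus> i(1 - h)\<close>.\<close>
  have iso: "norm (u s x) = norm x" if s: "s = 1 \<or> s = -1" for s x
  proof -
    let ?y = "x - h * x"
    have hb: "h * (b * z) = b * (h * z)" for z using comm by (metis mult.assoc)
    have "star (u s x) * u s x = star x * (b * (b * x)) + star x * (x - h * x - (h * x - h * (h * x)))"
      using s by (auto simp: u_def star_add star_scaleC star_diff star_mult sa distrib_left distrib_right
          mult_scaleC_left mult_scaleC_right scaleC_scaleC left_diff_distrib right_diff_distrib mult.assoc
          hb scaleC_diff_right scaleC_add_right scaleC_minus_right scaleC_minus_left)
    also have "\<dots> = star x * ((b * b + h * h - 2 *\<^sub>R h) * x) + star x * x"
      by (simp add: algebra_simps scaleR_2)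
    also have "\<dots> = star x * x" by (simp add: eq)
    finally have "(norm (u s x))\<^sup>2 = (norm x)\<^sup>2" by (metis norm_star_mult)
    then show ?thesis by simp
  qed
  have "u 1 b + u (-1) b = 2 *\<^sub>R (b * b) + (\<i> + - \<i>) *\<^sub>C (b - h * b)"
    unfolding u_def scaleC_add_left by (simp add: scaleR_2)
  then have "2 * norm (b * b) = norm (u 1 b + u (-1) b)" by simp
  also have "\<dots> \<le> norm b + norm b" by (rule norm_triangle_le) (simp add: iso)
  finally have "(norm b)\<^sup>2 \<le> norm b" using sa(1) norm_selfadjoint_square[of b] by simp
  then show ?thesis by (cases "b = 0") (auto simp: power2_eq_square)
qed

locale star_endomorphism =
  fixes \<phi> :: "'a::cstar_algebra \<Rightarrow> 'a"
  assumes add: "\<phi> (x + y) = \<phi> x + \<phi> y"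
    and mult: "\<phi> (x * y) = \<phi> x * \<phi> y"
    and scaleC: "\<phi> (c *\<^sub>C x) = c *\<^sub>C \<phi> x"
    and star: "\<phi> (star x) = star (\<phi> x)"
begin

lemma scaleR: "\<phi> (r *\<^sub>R x) = r *\<^sub>R \<phi> x"
  by (simp add: scaleR_eq_scaleC scaleC)

text \<open>Contractivity is automatic: \<open>\<phi>\<close> maps the element \<open>c\<close> with \<open>(1 - c)\<^sup>2 = 1 - a\<^sup>2\<close> to one that
  certifies the bound for \<open>\<phi> a\<close>.\<close>

lemma selfadjoint_contraction: assumes sa: "star a = a" and na: "norm a < 1" shows "norm (\<phi> a) \<le> 1"
proof -
  obtain c where "star c = c" "c * a = a * c" "2 *\<^sub>R c = a * a + c * c"
    using sqrt_one_minus_square[OF sa na] by blast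
  then show ?thesis
    using sa by (intro norm_le_1_if_sum_of_squares[of _ "\<phi> c"])
      (simp_all flip: scaleR add mult star)
qed

lemma selfadjoint_norm_le: assumes sa: "star a = a" shows "norm (\<phi> a) \<le> norm a"
proof (rule ccontr)
  assume "\<not> norm (\<phi> a) \<le> norm a"
  then obtain t where t: "norm a < t" "t < norm (\<phi> a)" using dense[of "norm a" "norm (\<phi> a)"] by auto
  then have t0: "0 < t" using norm_ge_zero[of a] by linarith
  have "norm (\<phi> ((1/t) *\<^sub>R a)) \<le> 1"
    using t t0 sa by (intro selfadjoint_contraction) (auto simp: star_scaleR)
  then show False using t t0 by (simp add: scaleR divide_le_eq)
qed

lemma norm_le: "norm (\<phi> x) \<le> norm x"
proof -
  have "(norm (\<phi> x))\<^sup>2 = norm (\<phi> (star x * x))" by (simp add: norm_star_mult mult star)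
  also have "\<dots> \<le> norm (star x * x)" by (rule selfadjoint_norm_le) (simp add: star_mult star_star)
  finally have "(norm (\<phi> x))\<^sup>2 \<le> (norm x)\<^sup>2" by (simp add: norm_star_mult)
  then show ?thesis by (rule power2_le_imp_le) simp
qed

lemma bounded_linear: "bounded_linear \<phi>"
  by (rule bounded_linear_intro[of _ 1]) (auto simp: add scaleR norm_le)

end

definition commutant :: "'a::times set \<Rightarrow> 'a set" where
  "commutant S = {x. \<forall>y\<in>S. x * y = y * x}"

lemma cstar_subalgebra_commutant:
  fixes S :: "'a::cstar_algebra set"
  assumes S: "\<And>x. x \<in> S \<Longrightarrow> star x \<in> S"
  shows "cstar_subalgebra (commutant S)"
proof -
  have "commutant S = (\<Inter>y\<in>S. {x. x * y = y * x})" by (auto simp: commutant_def)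
  then have "closed (commutant S)"
    by (simp add: closed_INT closed_Collect_eq continuous_on_mult_left continuous_on_mult_right continuous_on_id)
  moreover have "x * y * z = z * (x * y)" if "x * z = z * x" "y * z = z * y" for x y z :: 'a
  proof -
    have "x * y * z = x * (z * y)" by (simp only: mult.assoc that(2))
    also have "\<dots> = z * x * y" by (simp only: that(1) flip: mult.assoc)
    finally show ?thesis by (simp only: mult.assoc)
  qed
  then have "x * y \<in> commutant S" if "x \<in> commutant S" "y \<in> commutant S" for x y
    using that by (simp add: commutant_def)
  moreover have "star x \<in> commutant S" if "x \<in> commutant S" for x
  proof -
    have "star x * y = y * star x" if y: "y \<in> S" for y
    proof -
      have "x * star y = star y * x" using S[OF y] \<open>x \<in> commutant S\<close> by (simp add: commutant_def)
      from arg_cong[OF this, of star] show ?thesis by (simp add: star_mult star_star)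
    qed
    then show ?thesis by (simp add: commutant_def)
  qed
  moreover have "x + y \<in> commutant S" "c *\<^sub>C x \<in> commutant S"
    if "x \<in> commutant S" "y \<in> commutant S" for x y c
    using that by (simp_all add: commutant_def distrib_left distrib_right mult_scaleC_left mult_scaleC_right)
  moreover have "0 \<in> commutant S" by (simp add: commutant_def)
  ultimately show ?thesis by (simp add: cstar_subalgebra_def)
qed

lemma cstar_subalgebra_hull: "cstar_subalgebra (cstar_subalgebra hull S)"
  by (rule hull_in) (auto simp: cstar_subalgebra_def)

text \<open>The commutant of a self-adjoint set is a C*-subalgebra. This is used twice: the hull lies in the
  commutant of \<open>S\<close>, hence \<open>S\<close> and then the hull lie in the commutant of the hull.\<close>

lemma commuting_hull:
  fixes S :: "'a::cstar_algebra set"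
  assumes S: "\<And>x. x \<in> S \<Longrightarrow> star x \<in> S" and comm: "commuting S"
  shows "commuting (cstar_subalgebra hull S)"
proof -
  let ?M = "cstar_subalgebra hull S"
  have "S \<subseteq> commutant S" using comm by (auto simp: commuting_def commutant_def)
  then have "?M \<subseteq> commutant S" by (intro hull_minimal cstar_subalgebra_commutant S)
  then have "S \<subseteq> commutant ?M" by (force simp: commutant_def)
  moreover have "cstar_subalgebra (commutant ?M)"
    using cstar_subalgebra_hull[of S] by (intro cstar_subalgebra_commutant) (simp add: cstar_subalgebra_def)
  ultimately have "?M \<subseteq> commutant ?M" by (rule hull_minimal)
  then show ?thesis by (auto simp: commuting_def commutant_def)
qed

section \<open>Square-summable functions\<close>

typedef 'x ell2 = "{f :: 'x \<Rightarrow> real. (\<lambda>x. (f x)\<^sup>2) summable_on UNIV}"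
  morphisms ell2_fun Abs_ell2
  by (rule exI[of _ "\<lambda>_. 0"]) simp

lemma ell2_summable: "(\<lambda>x. (ell2_fun f x)\<^sup>2) summable_on UNIV"
  using ell2_fun[of f] by simp

lemma summable_square_comparison:
  fixes f g :: "'x \<Rightarrow> real"
  assumes "g summable_on A" "\<And>x. x \<in> A \<Longrightarrow> 0 \<le> f x" "\<And>x. x \<in> A \<Longrightarrow> f x \<le> g x"
  shows "f summable_on A"
  using summable_on_comparison_test[OF assms(1), of f] assms(2,3) by auto

lemma ell2_prod_summable: "(\<lambda>x. ell2_fun f x * ell2_fun g x) summable_on UNIV"
proof -
  have "(\<lambda>x. \<bar>ell2_fun f x * ell2_fun g x\<bar>) summable_on UNIV"
  proof (rule summable_square_comparison)
    show "(\<lambda>x. (ell2_fun f x)\<^sup>2 + (ell2_fun g x)\<^sup>2) summable_on UNIV"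
      by (intro summable_on_add ell2_summable)
    show "\<bar>ell2_fun f x * ell2_fun g x\<bar> \<le> (ell2_fun f x)\<^sup>2 + (ell2_fun g x)\<^sup>2" for x
    proof -
      have "2 * (\<bar>ell2_fun f x\<bar> * \<bar>ell2_fun g x\<bar>) \<le> (ell2_fun f x)\<^sup>2 + (ell2_fun g x)\<^sup>2"
        using sum_squares_bound[of "\<bar>ell2_fun f x\<bar>" "\<bar>ell2_fun g x\<bar>"] by (simp add: mult.assoc)
      moreover have "0 \<le> \<bar>ell2_fun f x\<bar> * \<bar>ell2_fun g x\<bar>" by simp
      ultimately show ?thesis unfolding abs_mult by linarith
    qed
  qed simp
  then show ?thesis by (subst summable_on_iff_abs_summable_on_real) simp
qed

instantiation ell2 :: (type) real_inner
begin

definition "0 = Abs_ell2 (\<lambda>_. 0)"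
definition "f + g = Abs_ell2 (\<lambda>x. ell2_fun f x + ell2_fun g x)"
definition "- f = Abs_ell2 (\<lambda>x. - ell2_fun f x)"
definition "f - g = Abs_ell2 (\<lambda>x. ell2_fun f x - ell2_fun g x)"
definition "r *\<^sub>R f = Abs_ell2 (\<lambda>x. r * ell2_fun f x)"
definition "inner f g = (\<Sum>\<^sub>\<infinity>x. ell2_fun f x * ell2_fun g x)"
definition norm_ell2_def: "norm (f::'a ell2) = sqrt (inner f f)"
definition "dist (f::'a ell2) g = norm (f - g)"
definition "sgn (f::'a ell2) = scaleR (inverse (norm f)) f"
definition [code del]: "uniformity = (INF e\<in>{0<..}. principal {(x, y). dist (x::'a ell2) y < e})"
definition [code del]: "open (U :: 'a ell2 set) \<longleftrightarrow> (\<forall>x\<in>U. eventually (\<lambda>(x', y). x' = x \<longrightarrow> y \<in> U) uniformity)"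

lemma ell2_fun_zero: "ell2_fun 0 x = 0"
  by (simp add: zero_ell2_def Abs_ell2_inverse)

lemma ell2_fun_scaleR: "ell2_fun (r *\<^sub>R f) x = r * ell2_fun f x"
  by (simp add: scaleR_ell2_def Abs_ell2_inverse power_mult_distrib summable_on_cmult_right ell2_summable)

lemma ell2_fun_add: "ell2_fun (f + g) x = ell2_fun f x + ell2_fun g x"
proof -
  have "(\<lambda>x. (ell2_fun f x + ell2_fun g x)\<^sup>2) summable_on UNIV"
    unfolding power2_sum mult.assoc
    by (intro summable_on_add ell2_summable summable_on_cmult_right ell2_prod_summable)
  then show ?thesis by (simp add: plus_ell2_def Abs_ell2_inverse)
qed

lemma ell2_fun_minus: "ell2_fun (- f) x = - ell2_fun f x"
  by (simp add: uminus_ell2_def Abs_ell2_inverse ell2_summable)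

lemma ell2_fun_diff: "ell2_fun (f - g) x = ell2_fun f x - ell2_fun g x"
proof -
  have "Abs_ell2 (\<lambda>x. ell2_fun f x - ell2_fun g x) = f + - g"
    by (simp add: plus_ell2_def ell2_fun_minus)
  then show ?thesis by (simp add: minus_ell2_def ell2_fun_add ell2_fun_minus)
qed

lemma ell2_eqI: "(\<And>x. ell2_fun f x = ell2_fun g x) \<Longrightarrow> f = g"
  using ell2_fun_inject[of f g] by auto

lemma ell2_inner_add: "inner (f + g) h = inner f h + inner g (h :: 'a ell2)"
  by (simp add: inner_ell2_def ell2_fun_add distrib_right infsum_add ell2_prod_summable)

instance
proof
  fix f g h :: "'a ell2" and r :: real
  show "inner f g = inner g f" by (simp add: inner_ell2_def mult.commute)
  show "inner (f + g) h = inner f h + inner g h" by (rule ell2_inner_add)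
  show "inner (r *\<^sub>R f) g = r * inner f g"
    by (simp add: inner_ell2_def ell2_fun_scaleR mult.assoc infsum_cmult_right' )
  show "0 \<le> inner f f" by (simp add: inner_ell2_def infsum_nonneg)
  show "inner f f = 0 \<longleftrightarrow> f = 0"
  proof
    assume 0: "inner f f = 0"
    show "f = 0"
    proof (rule ell2_eqI)
      fix x
      have "ell2_fun f x * ell2_fun f x = 0"
        using 0 ell2_prod_summable[of f f]
        by (intro nonneg_infsum_le_0D[where A = UNIV and f = "\<lambda>x. ell2_fun f x * ell2_fun f x"]) (auto simp: inner_ell2_def)
      then show "ell2_fun f x = ell2_fun 0 x" by (simp add: ell2_fun_zero)
    qed
  qed (simp add: inner_ell2_def ell2_fun_zero)
qed (auto intro!: ell2_eqI simp: ell2_fun_add ell2_fun_zero ell2_fun_minus ell2_fun_diff ell2_fun_scaleR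
    algebra_simps norm_ell2_def dist_ell2_def sgn_ell2_def uniformity_ell2_def open_ell2_def)

end

lemma ell2_norm_square: "(norm f)\<^sup>2 = (\<Sum>\<^sub>\<infinity>x. (ell2_fun f x)\<^sup>2)"
proof -
  have "(norm f)\<^sup>2 = inner f f" by (simp add: power2_norm_eq_inner)
  then show ?thesis by (simp add: inner_ell2_def power2_eq_square)
qed

lemma ell2_finite_sum_le: "finite F \<Longrightarrow> (\<Sum>x\<in>F. (ell2_fun f x)\<^sup>2) \<le> (norm f)\<^sup>2"
  unfolding ell2_norm_square by (rule finite_sum_le_infsum) (auto simp: ell2_summable)

lemma ell2_component_le: "\<bar>ell2_fun f x\<bar> \<le> norm f"
  using ell2_finite_sum_le[of "{x}" f] abs_le_square_iff[of "ell2_fun f x" "norm f"] by simp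

lemma ell2_Abs_bounded:
  assumes "\<And>F. finite F \<Longrightarrow> (\<Sum>x\<in>F. (h x)\<^sup>2) \<le> r\<^sup>2" and "0 \<le> r"
  shows "ell2_fun (Abs_ell2 h) = h" "norm (Abs_ell2 h) \<le> r"
proof -
  have s: "(\<lambda>x. (h x)\<^sup>2) summable_on UNIV"
    by (rule nonneg_bdd_above_summable_on) (use assms(1) in \<open>auto intro!: bdd_aboveI2\<close>)
  then show e: "ell2_fun (Abs_ell2 h) = h" by (simp add: Abs_ell2_inverse)
  have "(norm (Abs_ell2 h))\<^sup>2 \<le> r\<^sup>2"
    unfolding ell2_norm_square e by (rule infsum_le_finite_sums[OF s]) (use assms(1) in auto)
  then show "norm (Abs_ell2 h) \<le> r" using assms(2) by (rule power2_le_imp_le)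
qed

instance ell2 :: (type) banach
proof
  fix \<sigma> :: "nat \<Rightarrow> 'a ell2"
  assume C: "Cauchy \<sigma>"
  have "Cauchy (\<lambda>n. ell2_fun (\<sigma> n) x)" for x
  proof (rule CauchyI)
    fix e :: real assume "0 < e"
    then obtain N where N: "\<And>m n. N \<le> m \<Longrightarrow> N \<le> n \<Longrightarrow> norm (\<sigma> m - \<sigma> n) < e"
      using CauchyD[OF C] by blast
    have "norm (ell2_fun (\<sigma> m) x - ell2_fun (\<sigma> n) x) < e" if "N \<le> m" "N \<le> n" for m n
      using N[OF that] ell2_component_le[of "\<sigma> m - \<sigma> n" x] by (simp add: ell2_fun_diff)
    then show "\<exists>N. \<forall>m\<ge>N. \<forall>n\<ge>N. norm (ell2_fun (\<sigma> m) x - ell2_fun (\<sigma> n) x) < e" by blast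
  qed
  then have "\<exists>l. (\<lambda>n. ell2_fun (\<sigma> n) x) \<longlonglongrightarrow> l" for x
    using Cauchy_convergent_iff convergent_def by blast
  then obtain h where h: "\<And>x. (\<lambda>n. ell2_fun (\<sigma> n) x) \<longlonglongrightarrow> h x" by metis
  have near: "ell2_fun (Abs_ell2 (\<lambda>x. h x - ell2_fun (\<sigma> n) x)) = (\<lambda>x. h x - ell2_fun (\<sigma> n) x)
      \<and> norm (Abs_ell2 (\<lambda>x. h x - ell2_fun (\<sigma> n) x)) \<le> e"
    if N: "\<And>m. N \<le> m \<Longrightarrow> norm (\<sigma> m - \<sigma> n) < e" and e: "0 < e" for n N e
  proof -
    have "(\<Sum>x\<in>F. (h x - ell2_fun (\<sigma> n) x)\<^sup>2) \<le> e\<^sup>2" if F: "finite F" for F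
    proof (rule LIMSEQ_le_const2)
      show "(\<lambda>m. \<Sum>x\<in>F. (ell2_fun (\<sigma> m) x - ell2_fun (\<sigma> n) x)\<^sup>2) \<longlonglongrightarrow> (\<Sum>x\<in>F. (h x - ell2_fun (\<sigma> n) x)\<^sup>2)"
        by (intro tendsto_intros h)
      have "(\<Sum>x\<in>F. (ell2_fun (\<sigma> m) x - ell2_fun (\<sigma> n) x)\<^sup>2) \<le> e\<^sup>2" if "N \<le> m" for m
      proof -
        have "(\<Sum>x\<in>F. (ell2_fun (\<sigma> m) x - ell2_fun (\<sigma> n) x)\<^sup>2) \<le> (norm (\<sigma> m - \<sigma> n))\<^sup>2"
          using ell2_finite_sum_le[OF F, of "\<sigma> m - \<sigma> n"] by (simp add: ell2_fun_diff)
        also have "\<dots> \<le> e\<^sup>2" using N[OF that] by (intro power_mono) auto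
        finally show ?thesis .
      qed
      then show "\<exists>N. \<forall>m\<ge>N. (\<Sum>x\<in>F. (ell2_fun (\<sigma> m) x - ell2_fun (\<sigma> n) x)\<^sup>2) \<le> e\<^sup>2" by blast
    qed
    then show ?thesis using ell2_Abs_bounded[of "\<lambda>x. h x - ell2_fun (\<sigma> n) x" e] e by simp
  qed
  obtain N0 where N0: "\<And>m n. N0 \<le> m \<Longrightarrow> N0 \<le> n \<Longrightarrow> norm (\<sigma> m - \<sigma> n) < 1"
    using CauchyD[OF C, of 1] by auto
  define l where "l = Abs_ell2 (\<lambda>x. h x - ell2_fun (\<sigma> N0) x) + \<sigma> N0"
  have l: "ell2_fun l x = h x" for x
    using near[of N0 N0 1] N0 by (simp add: l_def ell2_fun_add)
  have diff: "Abs_ell2 (\<lambda>x. h x - ell2_fun (\<sigma> n) x) = l - \<sigma> n" for n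
    by (simp add: minus_ell2_def l)
  have "\<sigma> \<longlonglongrightarrow> l"
  proof (rule LIMSEQ_I)
    fix e :: real assume e: "0 < e"
    then obtain N where N: "\<And>m n. N \<le> m \<Longrightarrow> N \<le> n \<Longrightarrow> norm (\<sigma> m - \<sigma> n) < e/2"
      using CauchyD[OF C, of "e/2"] by auto
    have "norm (\<sigma> n - l) < e" if "N \<le> n" for n
      using near[of N n "e/2"] N[OF _ that] e by (simp add: diff norm_minus_commute)
    then show "\<exists>N. \<forall>n\<ge>N. norm (\<sigma> n - l) < e" by blast
  qed
  then show "convergent \<sigma>" by (auto simp: convergent_def)
qed

section \<open>Operators on a real Hilbert space with a complex structure\<close>

text \<open>A real Hilbert space with an orthogonal complex structure \<open>J\<close> is a complex Hilbert space; its
  operators are the \<open>J\<close>-linear ones, and adjoints can be taken with respect to the real inner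
  product.\<close>

definition adjoint_of :: "('h::real_inner \<Rightarrow>\<^sub>L 'h) \<Rightarrow> ('h \<Rightarrow>\<^sub>L 'h) \<Rightarrow> bool" where
  "adjoint_of T S \<longleftrightarrow> (\<forall>u v. inner (blinfun_apply T u) v = inner u (blinfun_apply S v))"

lemma adjoint_of_unique: "adjoint_of T S \<Longrightarrow> adjoint_of T S' \<Longrightarrow> S = S'"
proof (rule blinfun_eqI)
  fix v assume "adjoint_of T S" "adjoint_of T S'"
  then have "inner u (blinfun_apply S v - blinfun_apply S' v) = 0" for u
    by (metis adjoint_of_def inner_diff_right right_minus_eq)
  then show "blinfun_apply S v = blinfun_apply S' v"
    using inner_eq_zero_iff right_minus_eq by blast
qed

lemma adjoint_of_sym: "adjoint_of T S \<Longrightarrow> adjoint_of S T"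
  by (simp add: adjoint_of_def inner_commute)

lemma norm_adjoint_le: assumes "adjoint_of T S" shows "norm S \<le> norm T"
proof (rule norm_blinfun_bound)
  fix v
  have "norm (blinfun_apply S v) * norm (blinfun_apply S v) = inner (blinfun_apply T (blinfun_apply S v)) v"
    using assms by (simp add: adjoint_of_def flip: power2_norm_eq_inner power2_eq_square)
  also have "\<dots> \<le> norm (blinfun_apply T (blinfun_apply S v)) * norm v"
    by (rule norm_cauchy_schwarz)
  also have "\<dots> \<le> (norm T * norm (blinfun_apply S v)) * norm v"
    by (intro mult_right_mono norm_blinfun) auto
  finally show "norm (blinfun_apply S v) \<le> norm T * norm v"
    by (cases "norm (blinfun_apply S v) = 0") (auto simp: mult_ac)
qed simp

lemma norm_adjoint_mult: assumes "adjoint_of T S" shows "norm (S o\<^sub>L T) = (norm T)\<^sup>2"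
proof (rule antisym)
  have "norm (S o\<^sub>L T) \<le> norm S * norm T" by (rule norm_blinfun_compose)
  also have "\<dots> \<le> norm T * norm T" by (intro mult_right_mono norm_adjoint_le assms) simp
  finally show "norm (S o\<^sub>L T) \<le> (norm T)\<^sup>2" by (simp add: power2_eq_square)
  have "norm T \<le> sqrt (norm (S o\<^sub>L T))"
  proof (rule norm_blinfun_bound)
    fix u
    have "(norm (blinfun_apply T u))\<^sup>2 = inner u (blinfun_apply (S o\<^sub>L T) u)"
      using assms by (simp add: adjoint_of_def power2_norm_eq_inner)
    also have "\<dots> \<le> norm u * (norm (S o\<^sub>L T) * norm u)"
      by (rule order_trans[OF norm_cauchy_schwarz]) (intro mult_left_mono norm_blinfun norm_ge_zero)
    also have "\<dots> = (sqrt (norm (S o\<^sub>L T)) * norm u)\<^sup>2"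
      by (simp add: power_mult_distrib power2_eq_square)
    finally show "norm (blinfun_apply T u) \<le> sqrt (norm (S o\<^sub>L T)) * norm u"
      by (rule power2_le_imp_le) simp
  qed simp
  then show "(norm T)\<^sup>2 \<le> norm (S o\<^sub>L T)"
    by (metis norm_ge_zero power2_eq_square real_sqrt_ge_zero real_sqrt_pow2 power_mono)
qed

definition adjointable_operators :: "('h::{real_inner,banach} \<Rightarrow>\<^sub>L 'h) \<Rightarrow> ('h \<Rightarrow>\<^sub>L 'h) star_alg" where
  "adjointable_operators J = \<lparr>carrier = {T. T o\<^sub>L J = J o\<^sub>L T \<and> (\<exists>S. adjoint_of T S)},
     mult = (o\<^sub>L), one = undefined, zero = 0, add = (+),
     smult = (\<lambda>c T. Re c *\<^sub>R T + Im c *\<^sub>R (J o\<^sub>L T)), adj = (\<lambda>T. THE S. adjoint_of T S), nrm = norm\<rparr>"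

lemma adj_adjointable: "adjoint_of T S \<Longrightarrow> adj (adjointable_operators J) T = S"
  by (auto simp: adjointable_operators_def intro: adjoint_of_unique)

lemma blinfun_compose_assoc': "(A o\<^sub>L B) o\<^sub>L C = A o\<^sub>L (B o\<^sub>L C)"
  by (rule blinfun_eqI) simp

lemma blinfun_compose_distrib:
  "(A + B) o\<^sub>L C = (A o\<^sub>L C) + (B o\<^sub>L C)" "C o\<^sub>L (A + B) = (C o\<^sub>L A) + (C o\<^sub>L B)"
  "(r *\<^sub>R A) o\<^sub>L C = r *\<^sub>R (A o\<^sub>L C)" "C o\<^sub>L (r *\<^sub>R A) = r *\<^sub>R (C o\<^sub>L A)"
  "(- A) o\<^sub>L C = - (A o\<^sub>L C)" "C o\<^sub>L (- A) = - (C o\<^sub>L A)"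
  by (rule blinfun_eqI; simp add: blinfun.bilinear_simps)+

lemma adjoint_of_add: "adjoint_of T S \<Longrightarrow> adjoint_of T' S' \<Longrightarrow> adjoint_of (T + T') (S + S')"
  and adjoint_of_scaleR: "adjoint_of T S \<Longrightarrow> adjoint_of (r *\<^sub>R T) (r *\<^sub>R S)"
  and adjoint_of_compose: "adjoint_of T S \<Longrightarrow> adjoint_of T' S' \<Longrightarrow> adjoint_of (T o\<^sub>L T') (S' o\<^sub>L S)"
  and adjoint_of_zero: "adjoint_of 0 0"
  by (simp_all add: adjoint_of_def blinfun.bilinear_simps inner_add_left inner_add_right)

text \<open>The C*-identity is \<open>\<parallel>T u\<parallel>\<^sup>2 = \<langle>u, T\<^sup>* T u\<rangle>\<close> with the Cauchy-Schwarz inequality. It makes the adjoint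
  isometric, so the adjoints of a Cauchy sequence converge to an adjoint of its limit.\<close>

lemma cstar_alg_adjointable_operators:
  fixes J :: "'h::{real_inner,banach} \<Rightarrow>\<^sub>L 'h"
  assumes JJ: "J o\<^sub>L J = - id_blinfun" and Jadj: "adjoint_of J (- J)"
  shows "cstar_alg (adjointable_operators J)"
proof -
  let ?D = "adjointable_operators J"
  have D [simp]: "\<zero>\<^bsub>?D\<^esub> = 0" "\<And>x y. x \<otimes>\<^bsub>?D\<^esub> y = x o\<^sub>L y" "\<And>x y. x \<oplus>\<^bsub>?D\<^esub> y = x + y"
    "\<And>c x. c \<odot>\<^bsub>?D\<^esub> x = Re c *\<^sub>R x + Im c *\<^sub>R (J o\<^sub>L x)" "\<And>x. nrm ?D x = norm x"
    by (simp_all add: adjointable_operators_def)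
  have carrier: "T \<in> carrier ?D \<longleftrightarrow> T o\<^sub>L J = J o\<^sub>L T \<and> (\<exists>S. adjoint_of T S)" for T
    by (simp add: adjointable_operators_def)
  have "blinfun_apply J (blinfun_apply J u) = - u" for u
    using arg_cong[OF JJ, of "\<lambda>A. blinfun_apply A u"] by (simp add: blinfun.minus_left)
  then have JJT: "J o\<^sub>L (J o\<^sub>L T) = - T" for T
    by (intro blinfun_eqI) (simp add: blinfun.minus_left)
  have adjJ: "S o\<^sub>L J = J o\<^sub>L S" if "T o\<^sub>L J = J o\<^sub>L T" "adjoint_of T S" for T S
  proof -
    have "adjoint_of (T o\<^sub>L J) (- J o\<^sub>L S)" "adjoint_of (J o\<^sub>L T) (S o\<^sub>L - J)"
      by (intro adjoint_of_compose that Jadj)+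
    then have "- J o\<^sub>L S = S o\<^sub>L - J" using that(1) adjoint_of_unique by metis
    then show ?thesis by (simp add: blinfun_compose_distrib)
  qed
  have adj: "adj ?D T = S" if "adjoint_of T S" for T S using that by (rule adj_adjointable)
  have zero: "0 \<in> carrier ?D"
    unfolding carrier using adjoint_of_zero by (auto simp: blinfun.bilinear_simps intro!: blinfun_eqI)
  have add: "S + T \<in> carrier ?D" if "S \<in> carrier ?D" "T \<in> carrier ?D" for S T
    using that unfolding carrier by (auto simp: blinfun_compose_distrib intro: adjoint_of_add)
  have Rscale: "r *\<^sub>R T \<in> carrier ?D" if "T \<in> carrier ?D" for r T
    using that unfolding carrier by (auto simp: blinfun_compose_distrib intro: adjoint_of_scaleR)
  have comp: "S o\<^sub>L T \<in> carrier ?D" if "S \<in> carrier ?D" "T \<in> carrier ?D" for S T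
    using that unfolding carrier
    by (auto simp: blinfun_compose_assoc' intro: adjoint_of_compose) (simp flip: blinfun_compose_assoc')
  have J: "J \<in> carrier ?D" unfolding carrier using Jadj by auto
  have scale: "Re c *\<^sub>R T + Im c *\<^sub>R (J o\<^sub>L T) \<in> carrier ?D" if "T \<in> carrier ?D" for c T
    by (intro add Rscale comp J that)
  interpret abelian_group ?D
  proof (rule abelian_groupI)
    show "\<exists>y\<in>carrier ?D. y \<oplus>\<^bsub>?D\<^esub> x = \<zero>\<^bsub>?D\<^esub>" if "x \<in> carrier ?D" for x
      using Rscale[OF that, of "-1"] by (intro bexI[of _ "- x"]) auto
  qed (auto intro: add zero simp: algebra_simps)
  have neg: "\<ominus>\<^bsub>?D\<^esub> y = - y" if "y \<in> carrier ?D" for y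
    using Rscale[OF that, of "-1"] that by (intro minus_equality) auto
  have minus: "x \<ominus>\<^bsub>?D\<^esub> y = x - y" if "y \<in> carrier ?D" for x y
    using neg[OF that] by (simp add: a_minus_def)
  have adjE: "\<exists>S. adjoint_of T S \<and> adj ?D T = S \<and> T o\<^sub>L J = J o\<^sub>L T \<and> S \<in> carrier ?D"
    if "T \<in> carrier ?D" for T
    using that adjJ adj adjoint_of_sym unfolding carrier by blast
  have adjoint_scale: "adjoint_of (Re c *\<^sub>R T + Im c *\<^sub>R (J o\<^sub>L T)) (Re c *\<^sub>R S - Im c *\<^sub>R (J o\<^sub>L S))"
    if "adjoint_of T S" "S o\<^sub>L J = J o\<^sub>L S" for c T S
    using adjoint_of_add[OF adjoint_of_scaleR[OF that(1), of "Re c"]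
        adjoint_of_scaleR[OF adjoint_of_compose[OF Jadj that(1)], of "Im c"]] that(2)
    by (simp add: blinfun_compose_distrib)
  show ?thesis
  proof
    fix x y assume xy: "x \<in> carrier ?D" "y \<in> carrier ?D"
    obtain S where S: "adjoint_of x S" "adj ?D x = S" using adjE[OF xy(1)] by blast
    obtain S' where S': "adjoint_of y S'" "adj ?D y = S'" using adjE[OF xy(2)] by blast
    show "adj ?D (x \<oplus>\<^bsub>?D\<^esub> y) = adj ?D x \<oplus>\<^bsub>?D\<^esub> adj ?D y"
      using S S' by (simp add: adj adjoint_of_add)
    show "adj ?D (x \<otimes>\<^bsub>?D\<^esub> y) = adj ?D y \<otimes>\<^bsub>?D\<^esub> adj ?D x"
      using S S' by (simp add: adj adjoint_of_compose)
  next
    fix x c assume x: "x \<in> carrier ?D"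
    then obtain S where S: "adjoint_of x S" "adj ?D x = S" "x o\<^sub>L J = J o\<^sub>L x" "S \<in> carrier ?D"
      using adjE by blast
    have SJ: "S o\<^sub>L J = J o\<^sub>L S" using S(4) by (simp add: carrier)
    show "adj ?D x \<in> carrier ?D" using S by simp
    show "adj ?D (adj ?D x) = x" using S adj adjoint_of_sym by metis
    show "nrm ?D (adj ?D x \<otimes>\<^bsub>?D\<^esub> x) = (nrm ?D x)\<^sup>2" using S by (simp add: norm_adjoint_mult)
    show "adj ?D (c \<odot>\<^bsub>?D\<^esub> x) = cnj c \<odot>\<^bsub>?D\<^esub> adj ?D x"
      using adj[OF adjoint_scale[OF S(1) SJ, of c]] S(2) by simp
    show "nrm ?D (c \<odot>\<^bsub>?D\<^esub> x) = cmod c * nrm ?D x"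
    proof -
      let ?c = "Re c *\<^sub>R x + Im c *\<^sub>R (J o\<^sub>L x)"
      have "(norm ?c)\<^sup>2 = norm ((Re c *\<^sub>R S - Im c *\<^sub>R (J o\<^sub>L S)) o\<^sub>L ?c)"
        using norm_adjoint_mult[OF adjoint_scale[OF S(1) SJ, of c]] by simp
      also have "(Re c *\<^sub>R S - Im c *\<^sub>R (J o\<^sub>L S)) o\<^sub>L ?c = (cmod c)\<^sup>2 *\<^sub>R (S o\<^sub>L x)"
      proof -
        have "S o\<^sub>L (J o\<^sub>L x) = J o\<^sub>L (S o\<^sub>L x)" using SJ by (metis blinfun_compose_assoc')
        moreover have "(J o\<^sub>L S) o\<^sub>L x = J o\<^sub>L (S o\<^sub>L x)" "(J o\<^sub>L S) o\<^sub>L (J o\<^sub>L x) = - (S o\<^sub>L x)"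
          using SJ by (metis blinfun_compose_assoc' JJT)+
        moreover have "(cmod c)\<^sup>2 *\<^sub>R (S o\<^sub>L x) = (Re c * Re c) *\<^sub>R (S o\<^sub>L x) + (Im c * Im c) *\<^sub>R (S o\<^sub>L x)"
          by (simp add: cmod_power2 scaleR_add_left flip: power2_eq_square)
        ultimately show ?thesis
          by (simp add: blinfun_compose_distrib diff_conv_add_uminus algebra_simps
              del: add_uminus_conv_diff)
      qed
      also have "norm ((cmod c)\<^sup>2 *\<^sub>R (S o\<^sub>L x)) = (cmod c * norm x)\<^sup>2"
        by (simp add: norm_adjoint_mult[OF S(1)] power_mult_distrib)
      finally show ?thesis by (simp add: power2_eq_iff_nonneg)
    qed
  next
    fix \<sigma> :: "nat \<Rightarrow> 'h \<Rightarrow>\<^sub>L 'h" assume s: "\<And>n. \<sigma> n \<in> carrier ?D"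
      and cau: "\<And>e. 0 < e \<Longrightarrow> \<exists>N. \<forall>m\<ge>N. \<forall>n\<ge>N. nrm ?D (\<sigma> m \<ominus>\<^bsub>?D\<^esub> \<sigma> n) < e"
    have C: "\<exists>N. \<forall>m\<ge>N. \<forall>n\<ge>N. norm (\<sigma> m - \<sigma> n) < e" if "0 < e" for e
      using cau[OF that] s by (simp add: minus)
    have Csig: "Cauchy \<sigma>" using C by (simp add: Cauchy_iff)
    obtain \<tau> where \<tau>: "\<And>n. adjoint_of (\<sigma> n) (\<tau> n)" using s unfolding carrier by metis
    have le: "norm (\<tau> m - \<tau> n) \<le> norm (\<sigma> m - \<sigma> n)" for m n
      using adjoint_of_add[OF \<tau>[of m] adjoint_of_scaleR[OF \<tau>[of n], of "-1"]]
      by (intro norm_adjoint_le) simp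
    have "Cauchy \<tau>" unfolding Cauchy_iff using C le by (meson le_less_trans)
    then obtain x y where x: "\<sigma> \<longlonglongrightarrow> x" and y: "\<tau> \<longlonglongrightarrow> y"
      using Csig Cauchy_convergent_iff convergent_def by metis
    have "adjoint_of x y"
      unfolding adjoint_of_def
    proof (intro allI)
      fix u v
      have "(\<lambda>n. inner (blinfun_apply (\<sigma> n) u) v) \<longlonglongrightarrow> inner (blinfun_apply x u) v"
        "(\<lambda>n. inner u (blinfun_apply (\<tau> n) v)) \<longlonglongrightarrow> inner u (blinfun_apply y v)"
        using x y by (auto intro!: tendsto_intros)
      then show "inner (blinfun_apply x u) v = inner u (blinfun_apply y v)"
        using \<tau> by (simp add: adjoint_of_def LIMSEQ_unique)
    qed
    moreover have "x o\<^sub>L J = J o\<^sub>L x"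
    proof (rule blinfun_eqI)
      fix u
      have "(\<lambda>n. blinfun_apply (\<sigma> n) (blinfun_apply J u)) \<longlonglongrightarrow> blinfun_apply x (blinfun_apply J u)"
        "(\<lambda>n. blinfun_apply J (blinfun_apply (\<sigma> n) u)) \<longlonglongrightarrow> blinfun_apply J (blinfun_apply x u)"
        using x by (auto intro!: tendsto_intros)
      moreover have "blinfun_apply (\<sigma> n) (blinfun_apply J u) = blinfun_apply J (blinfun_apply (\<sigma> n) u)" for n
        using s[of n] unfolding carrier by (metis blinfun_apply_blinfun_compose)
      ultimately show "blinfun_apply (x o\<^sub>L J) u = blinfun_apply (J o\<^sub>L x) u" by (simp add: LIMSEQ_unique)
    qed
    ultimately have xD: "x \<in> carrier ?D" unfolding carrier by blast
    moreover have "(\<lambda>n. norm (\<sigma> n - x)) \<longlonglongrightarrow> 0" using x by (simp add: LIM_zero_iff tendsto_norm_zero)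
    ultimately show "\<exists>x\<in>carrier ?D. (\<lambda>n. nrm ?D (\<sigma> n \<ominus>\<^bsub>?D\<^esub> x)) \<longlonglongrightarrow> 0"
      by (intro bexI[of _ x]) (simp_all add: minus[OF xD])
  next
    fix x y c assume "x \<in> carrier ?D" "y \<in> carrier ?D"
    then show "x \<otimes>\<^bsub>?D\<^esub> (c \<odot>\<^bsub>?D\<^esub> y) = c \<odot>\<^bsub>?D\<^esub> (x \<otimes>\<^bsub>?D\<^esub> y)"
      by (simp add: carrier blinfun_compose_distrib flip: blinfun_compose_assoc')
  next
    fix x a b
    show "(a * b) \<odot>\<^bsub>?D\<^esub> x = a \<odot>\<^bsub>?D\<^esub> (b \<odot>\<^bsub>?D\<^esub> x)"
      by (simp add: blinfun_compose_distrib JJT scaleR_add_left scaleR_diff_left scaleR_add_right scaleR_diff_right)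
  qed (simp_all add: blinfun_compose_assoc' blinfun_compose_distrib comp scale norm_triangle_ineq norm_blinfun_compose
      scaleR_add_left scaleR_add_right)
qed

section \<open>Operators of partial bijections\<close>

definition partial_bijection :: "('x \<times> 'x) set \<Rightarrow> bool" where
  "partial_bijection R \<longleftrightarrow> single_valued R \<and> single_valued (R\<inverse>)"

lemma partial_bijection_converse: "partial_bijection R \<Longrightarrow> partial_bijection (R\<inverse>)"
  by (simp add: partial_bijection_def)

lemma partial_bijection_relcomp: "partial_bijection R \<Longrightarrow> partial_bijection R' \<Longrightarrow> partial_bijection (R O R')"
  by (simp add: partial_bijection_def single_valued_relcomp converse_relcomp)

lemma partial_bijection_Id_on: "partial_bijection (Id_on E)"
  by (auto simp: partial_bijection_def single_valued_def)

text \<open>The operator of \<open>R\<close> carries the value at \<open>y\<close> to \<open>x\<close> for \<open>(x, y) \<in> R\<close>. Composition of operators is then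
  composition of relations, and the adjoint belongs to the converse relation.\<close>

definition pull :: "('x \<times> 'x) set \<Rightarrow> ('x \<Rightarrow> real) \<Rightarrow> 'x \<Rightarrow> real" where
  "pull R f x = (if x \<in> Domain R then f (THE y. (x, y) \<in> R) else 0)"

lemma pull_eq: "partial_bijection R \<Longrightarrow> (x, y) \<in> R \<Longrightarrow> pull R f x = f y"
  by (auto simp: pull_def partial_bijection_def single_valued_def intro!: arg_cong[of _ _ f])

lemma pull_eq_0: "x \<notin> Domain R \<Longrightarrow> pull R f x = 0"
  by (simp add: pull_def)

lemma pull_Id_on: "pull (Id_on E) f x = (if x \<in> E then f x else 0)"
  using pull_eq[OF partial_bijection_Id_on, of x x E f] by (auto simp: pull_eq_0)

lemma pull_relcomp:
  assumes R: "partial_bijection R" and R': "partial_bijection R'"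
  shows "pull R (pull R' f) x = pull (R O R') f x"
proof (cases "x \<in> Domain R")
  case True
  then obtain y where y: "(x, y) \<in> R" by blast
  show ?thesis
  proof (cases "y \<in> Domain R'")
    case True
    then obtain z where z: "(y, z) \<in> R'" by blast
    then have "(x, z) \<in> R O R'" using y by blast
    then show ?thesis using y z by (simp add: pull_eq R R' partial_bijection_relcomp)
  next
    case False
    then have "x \<notin> Domain (R O R')" using y R by (auto simp: partial_bijection_def dest: single_valuedD)
    then show ?thesis using y False by (simp add: pull_eq R pull_eq_0)
  qed
next
  case False
  then have "x \<notin> Domain (R O R')" by blast
  then show ?thesis using False by (simp add: pull_eq_0)
qed

definition shift :: "('x \<times> 'x) set \<Rightarrow> 'x ell2 \<Rightarrow> 'x ell2" where
  "shift R f = Abs_ell2 (pull R (ell2_fun f))"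

lemma shift:
  assumes R: "partial_bijection R"
  shows ell2_fun_shift: "ell2_fun (shift R f) = pull R (ell2_fun f)" and norm_shift_le: "norm (shift R f) \<le> norm f"
proof -
  have le: "(\<Sum>x\<in>F. (pull R (ell2_fun f) x)\<^sup>2) \<le> (norm f)\<^sup>2" if F: "finite F" for F
  proof -
    define r where "r x = (THE y. (x, y) \<in> R)" for x
    have r: "(x, r x) \<in> R" if "x \<in> Domain R" for x
      using that R unfolding r_def partial_bijection_def single_valued_def by (metis Domain.cases theI)
    have inj: "inj_on r (F \<inter> Domain R)"
      using r R by (intro inj_onI) (metis IntD2 converse_iff partial_bijection_def single_valuedD)
    have "(\<Sum>x\<in>F. (pull R (ell2_fun f) x)\<^sup>2) = (\<Sum>x\<in>F \<inter> Domain R. (pull R (ell2_fun f) x)\<^sup>2)"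
      by (rule sum.mono_neutral_right) (use F in \<open>auto simp: pull_eq_0\<close>)
    also have "\<dots> = (\<Sum>x\<in>F \<inter> Domain R. (ell2_fun f (r x))\<^sup>2)"
      by (rule sum.cong) (auto simp: pull_eq[OF R r])
    also have "\<dots> = (\<Sum>y\<in>r ` (F \<inter> Domain R). (ell2_fun f y)\<^sup>2)"
      by (simp add: sum.reindex inj)
    also have "\<dots> \<le> (norm f)\<^sup>2" using F by (intro ell2_finite_sum_le) simp
    finally show ?thesis .
  qed
  show "ell2_fun (shift R f) = pull R (ell2_fun f)" "norm (shift R f) \<le> norm f"
    unfolding shift_def using ell2_Abs_bounded[OF le] by auto
qed

lemma bounded_linear_shift: assumes R: "partial_bijection R" shows "bounded_linear (shift R)"
proof (rule bounded_linear_intro[of _ 1])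
  show "shift R (f + g) = shift R f + shift R g" for f g
    by (rule ell2_eqI) (simp add: ell2_fun_add ell2_fun_shift R pull_def)
  show "shift R (r *\<^sub>R f) = r *\<^sub>R shift R f" for r f
    by (rule ell2_eqI) (simp add: ell2_fun_scaleR ell2_fun_shift R pull_def)
qed (simp add: norm_shift_le R)

lemma inner_shift:
  assumes R: "partial_bijection R"
  shows "inner (shift R f) g = inner f (shift (R\<inverse>) g)"
proof -
  note R' = partial_bijection_converse[OF R]
  define r where "r x = (THE y. (x, y) \<in> R)" for x
  have r: "(x, r x) \<in> R" if "x \<in> Domain R" for x
    using that R unfolding r_def partial_bijection_def single_valued_def by (metis Domain.cases theI)
  have bij: "bij_betw r (Domain R) (Range R)"
  proof (rule bij_betw_imageI)
    show "inj_on r (Domain R)"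
      using r R by (intro inj_onI) (metis converse_iff partial_bijection_def single_valuedD)
    show "r ` Domain R = Range R"
    proof (intro subset_antisym subsetI)
      fix y assume "y \<in> Range R"
      then obtain x where x: "(x, y) \<in> R" by blast
      then have "y = r x" using r[of x] R by (auto simp: partial_bijection_def dest: single_valuedD)
      then show "y \<in> r ` Domain R" using x by blast
    qed (use r in blast)
  qed
  let ?h = "\<lambda>y. ell2_fun f y * ell2_fun (shift (R\<inverse>) g) y"
  have "inner (shift R f) g = (\<Sum>\<^sub>\<infinity>x\<in>Domain R. ell2_fun (shift R f) x * ell2_fun g x)"
    unfolding inner_ell2_def
    by (rule infsum_cong_neutral) (auto simp: ell2_fun_shift R pull_eq_0)
  also have "\<dots> = (\<Sum>\<^sub>\<infinity>x\<in>Domain R. ?h (r x))"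
  proof (rule infsum_cong)
    fix x assume x: "x \<in> Domain R"
    show "ell2_fun (shift R f) x * ell2_fun g x = ?h (r x)"
      using pull_eq[OF R r[OF x]] pull_eq[OF R', of "r x" x] r[OF x] by (simp add: ell2_fun_shift R R')
  qed
  also have "\<dots> = (\<Sum>\<^sub>\<infinity>y\<in>Range R. ?h y)" by (rule infsum_reindex_bij_betw[OF bij])
  also have "\<dots> = inner f (shift (R\<inverse>) g)"
    unfolding inner_ell2_def
    by (rule infsum_cong_neutral) (auto simp: ell2_fun_shift R' pull_eq_0)
  finally show ?thesis .
qed

text \<open>Two copies of the real space \<open>\<ell>\<^sup>2\<close> form the complex one; \<open>rotation\<close> is multiplication by the
  imaginary unit.\<close>

definition rotation :: "('x ell2 \<times> 'x ell2) \<Rightarrow>\<^sub>L ('x ell2 \<times> 'x ell2)" where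
  "rotation = Blinfun (\<lambda>w. (- snd w, fst w))"

definition shift_operator :: "('x \<times> 'x) set \<Rightarrow> ('x ell2 \<times> 'x ell2) \<Rightarrow>\<^sub>L ('x ell2 \<times> 'x ell2)" where
  "shift_operator R = Blinfun (\<lambda>w. (shift R (fst w), shift R (snd w)))"

lemma rotation_apply: "blinfun_apply rotation w = (- snd w, fst w)"
  unfolding rotation_def
  by (subst bounded_linear_Blinfun_apply)
    (auto intro!: bounded_linear_Pair bounded_linear_minus bounded_linear_fst bounded_linear_snd)

lemma shift_operator_apply:
  assumes "partial_bijection R"
  shows "blinfun_apply (shift_operator R) w = (shift R (fst w), shift R (snd w))"
  unfolding shift_operator_def
  by (subst bounded_linear_Blinfun_apply)
    (auto intro!: bounded_linear_Pair bounded_linear_compose[OF bounded_linear_shift[OF assms]]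
      bounded_linear_fst bounded_linear_snd)

abbreviation "ell2_alg \<equiv> adjointable_operators rotation"

lemma cstar_alg_ell2_alg: "cstar_alg (ell2_alg :: (('x ell2 \<times> 'x ell2) \<Rightarrow>\<^sub>L ('x ell2 \<times> 'x ell2)) star_alg)"
proof (rule cstar_alg_adjointable_operators)
  show "rotation o\<^sub>L rotation = - (id_blinfun :: ('x ell2 \<times> 'x ell2) \<Rightarrow>\<^sub>L _)"
    by (rule blinfun_eqI) (simp add: rotation_apply blinfun.minus_left prod_eq_iff)
  show "adjoint_of rotation (- rotation :: ('x ell2 \<times> 'x ell2) \<Rightarrow>\<^sub>L _)"
    by (simp add: adjoint_of_def rotation_apply blinfun.minus_left inner_prod_def)
qed

lemma operator_eqI:
  fixes T T' :: "('x ell2 \<times> 'x ell2) \<Rightarrow>\<^sub>L ('x ell2 \<times> 'x ell2)"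
  assumes "\<And>w x. ell2_fun (fst (blinfun_apply T w)) x = ell2_fun (fst (blinfun_apply T' w)) x"
    "\<And>w x. ell2_fun (snd (blinfun_apply T w)) x = ell2_fun (snd (blinfun_apply T' w)) x"
  shows "T = T'"
  by (intro blinfun_eqI prod_eqI ell2_eqI assms)

lemma adjoint_of_shift_operator:
  assumes "partial_bijection R" shows "adjoint_of (shift_operator R) (shift_operator (R\<inverse>))"
  using assms by (simp add: adjoint_of_def shift_operator_apply partial_bijection_converse inner_prod_def inner_shift)

lemma shift_operator_carrier:
  assumes R: "partial_bijection R" shows "shift_operator R \<in> carrier ell2_alg"
proof -
  have "shift R (- f) = - shift R f" for f
    using bounded_linear.linear[OF bounded_linear_shift[OF R]] by (rule linear_neg)
  then have "shift_operator R o\<^sub>L rotation = rotation o\<^sub>L shift_operator R"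
    by (intro blinfun_eqI) (simp add: shift_operator_apply R rotation_apply)
  then show ?thesis using adjoint_of_shift_operator[OF R] by (auto simp: adjointable_operators_def)
qed

lemma ell2_alg_simps:
  "\<zero>\<^bsub>ell2_alg\<^esub> = 0" "x \<otimes>\<^bsub>ell2_alg\<^esub> y = x o\<^sub>L y" "x \<oplus>\<^bsub>ell2_alg\<^esub> y = x + y"
  by (simp_all add: adjointable_operators_def)

lemma ell2_alg_minus:
  assumes "y \<in> carrier ell2_alg" shows "x \<ominus>\<^bsub>ell2_alg\<^esub> y = x - y"
proof -
  interpret cstar_alg ell2_alg by (rule cstar_alg_ell2_alg)
  have "- y = (-1) \<odot>\<^bsub>ell2_alg\<^esub> y" by (simp add: adjointable_operators_def)
  then have "- y \<in> carrier ell2_alg" using assms smult_closed by metis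
  then have "\<ominus>\<^bsub>ell2_alg\<^esub> y = - y" using assms by (intro minus_equality) (auto simp: ell2_alg_simps)
  then show ?thesis by (simp add: a_minus_def ell2_alg_simps)
qed

lemma ell2_alg_finsum:
  assumes "finite F" "\<And>i. i \<in> F \<Longrightarrow> h i \<in> carrier ell2_alg"
  shows "finsum ell2_alg h F = sum h F"
proof -
  interpret cstar_alg ell2_alg by (rule cstar_alg_ell2_alg)
  show ?thesis using assms
  proof (induction F)
    case (insert i F)
    then have "h \<in> F \<rightarrow> carrier ell2_alg" "h i \<in> carrier ell2_alg" by auto
    then show ?case using insert by (simp add: ell2_alg_simps)
  qed (simp add: ell2_alg_simps)
qed

lemma shift_operator_compose:
  "partial_bijection R \<Longrightarrow> partial_bijection R' \<Longrightarrow> shift_operator R o\<^sub>L shift_operator R' = shift_operator (R O R')"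
  by (rule operator_eqI) (simp_all add: shift_operator_apply partial_bijection_relcomp ell2_fun_shift pull_relcomp)

lemma adj_shift_operator: "partial_bijection R \<Longrightarrow> adj ell2_alg (shift_operator R) = shift_operator (R\<inverse>)"
  by (rule adj_adjointable) (rule adjoint_of_shift_operator)

lemma shift_operator_empty: "shift_operator ({} :: ('x \<times> 'x) set) = 0"
proof (rule operator_eqI)
  have "partial_bijection ({} :: ('x \<times> 'x) set)" by (simp add: partial_bijection_def)
  then show "ell2_fun (fst (blinfun_apply (shift_operator {}) w)) x = ell2_fun (fst (blinfun_apply 0 w)) x"
    "ell2_fun (snd (blinfun_apply (shift_operator {}) w)) x = ell2_fun (snd (blinfun_apply 0 w)) x"
    for w :: "'x ell2 \<times> 'x ell2" and x
    by (simp_all add: shift_operator_apply ell2_fun_shift pull_eq_0 ell2_fun_zero)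
qed

lemma shift_operator_Id_on_apply:
  "ell2_fun (fst (blinfun_apply (shift_operator (Id_on E)) w)) x = (if x \<in> E then ell2_fun (fst w) x else 0)"
  "ell2_fun (snd (blinfun_apply (shift_operator (Id_on E)) w)) x = (if x \<in> E then ell2_fun (snd w) x else 0)"
  by (simp_all add: shift_operator_apply partial_bijection_Id_on ell2_fun_shift pull_Id_on)

lemma shift_operator_Id_on_Un:
  "shift_operator (Id_on (E \<union> E')) = shift_operator (Id_on E) + shift_operator (Id_on E') - shift_operator (Id_on (E \<inter> E'))"
  by (rule operator_eqI)
    (simp_all add: shift_operator_Id_on_apply blinfun.add_left blinfun.diff_left ell2_fun_add ell2_fun_diff)

lemma shift_operator_Id_on_UN:
  assumes "finite F" "\<And>i j. i \<in> F \<Longrightarrow> j \<in> F \<Longrightarrow> i \<noteq> j \<Longrightarrow> E i \<inter> E j = {}"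
  shows "shift_operator (Id_on (\<Union>i\<in>F. E i)) = (\<Sum>i\<in>F. shift_operator (Id_on (E i)))"
  using assms
proof (induction F)
  case (insert i F)
  have "E i \<inter> (\<Union>i\<in>F. E i) = {}" using insert.hyps insert.prems by blast
  then show ?case
    using insert.IH insert.prems insert.hyps
    by (simp add: shift_operator_Id_on_Un shift_operator_empty)
qed (simp add: shift_operator_empty)

lemma shift_operator_Id_on_nonzero: assumes "x \<in> E" shows "shift_operator (Id_on E) \<noteq> 0"
proof
  assume 0: "shift_operator (Id_on E) = 0"
  have "ell2_fun (Abs_ell2 (\<lambda>y. if y = x then 1 else 0)) = (\<lambda>y. if y = x then 1 else (0::real))"
  proof (rule ell2_Abs_bounded(1)[of _ 1])
    show "(\<Sum>y\<in>F. (if y = x then 1 else 0::real)\<^sup>2) \<le> 1\<^sup>2" if "finite F" for F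
      using that by (simp add: if_distrib[of "\<lambda>t. t\<^sup>2"] cong: if_cong)
  qed simp
  then show False
    using shift_operator_Id_on_apply(1)[of E "(Abs_ell2 (\<lambda>y. if y = x then 1 else 0), 0)" x] assms
    by (simp add: 0 ell2_fun_zero)
qed

section \<open>Every nonempty set has a nonzero projection\<close>

context generalized_boolean_algebra
begin

lemma inf_bot: "inf x bot = bot" "inf bot x = bot"
  by (simp_all add: inf_absorb1 inf_absorb2)

lemma diff_le: "x - y \<le> x"
  using sup_diff_inf[of x y] by (metis sup_ge1)

lemma diff_eq_bot_imp_le: "x - y = bot \<Longrightarrow> x \<le> y"
  using sup_diff_inf[of x y] inf_le2[of x y] by (simp add: sup_absorb2)

end

text \<open>The nonempty prime filters are the ultrafilters. The empty set is admitted because the preimage of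
  an ultrafilter under an action can be empty.\<close>

definition prime_filter :: "'b::generalized_boolean_algebra set \<Rightarrow> bool" where
  "prime_filter U \<longleftrightarrow> bot \<notin> U \<and> (\<forall>A B. inf A B \<in> U \<longleftrightarrow> A \<in> U \<and> B \<in> U) \<and>
     (\<forall>A B. sup A B \<in> U \<longleftrightarrow> A \<in> U \<or> B \<in> U)"

text \<open>A maximal superset of \<open>G\<close> that is closed under \<open>inf\<close> and does not contain \<open>bot\<close> is a prime filter.\<close>

lemma prime_filter_extension:
  fixes G :: "'b::generalized_boolean_algebra set"
  assumes G: "\<And>A B. A \<in> G \<Longrightarrow> B \<in> G \<Longrightarrow> inf A B \<in> G" and bot: "bot \<notin> G"
  obtains U where "prime_filter U" "G \<subseteq> U"
proof (cases "G = {}")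
  case True
  then show ?thesis using that[of "{}"] by (simp add: prime_filter_def)
next
  case False
  define \<F> where "\<F> = {F. G \<subseteq> F \<and> bot \<notin> F \<and> (\<forall>A\<in>F. \<forall>B\<in>F. inf A B \<in> F)}"
  have "\<exists>U\<in>\<F>. \<forall>F\<in>\<F>. U \<subseteq> F \<longrightarrow> F = U"
  proof (rule subset_Zorn)
    fix C assume C: "subset.chain \<F> C"
    show "\<exists>U\<in>\<F>. \<forall>F\<in>C. F \<subseteq> U"
    proof (cases "C = {}")
      case True
      then show ?thesis using G bot by (intro bexI[of _ G]) (auto simp: \<F>_def)
    next
      case False
      have "inf A B \<in> \<Union>C" if AB: "A \<in> \<Union>C" "B \<in> \<Union>C" for A B
      proof -
        obtain F F' where F: "F \<in> C" "F' \<in> C" "A \<in> F" "B \<in> F'" using AB by blast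
        then have "F \<subseteq> F' \<or> F' \<subseteq> F" using C by (auto simp: subset_chain_def)
        moreover have "F \<in> \<F>" "F' \<in> \<F>" using C F by (auto simp: subset_chain_def)
        ultimately have "inf A B \<in> F \<or> inf A B \<in> F'" using F by (auto simp: \<F>_def)
        then show ?thesis using F by blast
      qed
      then have "\<Union>C \<in> \<F>" using C False by (fastforce simp: \<F>_def subset_chain_def)
      then show ?thesis by blast
    qed
  qed
  then obtain U where U: "U \<in> \<F>" and max: "\<And>F. F \<in> \<F> \<Longrightarrow> U \<subseteq> F \<Longrightarrow> F = U" by blast
  have GU: "G \<subseteq> U" and Ubot: "bot \<notin> U" and Uinf: "\<And>A B. A \<in> U \<Longrightarrow> B \<in> U \<Longrightarrow> inf A B \<in> U"
    using U by (auto simp: \<F>_def)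
  \<comment> \<open>A set that meets every member of the maximal filter belongs to it.\<close>
  have meets: "D \<in> U" if D: "\<And>A. A \<in> U \<Longrightarrow> inf A D \<noteq> bot" for D
  proof -
    have "U \<union> {B. \<exists>A\<in>U. inf A D \<le> B} \<in> \<F>"
      unfolding \<F>_def
    proof (intro CollectI conjI ballI)
      fix A B assume "A \<in> U \<union> {B. \<exists>A\<in>U. inf A D \<le> B}" "B \<in> U \<union> {B. \<exists>A\<in>U. inf A D \<le> B}"
      then obtain A' B' where A': "A' \<in> U" "inf A' D \<le> A" and B': "B' \<in> U" "inf B' D \<le> B"
        using inf_le1 by blast
      have "inf (inf A' B') D \<le> inf A' D" "inf (inf A' B') D \<le> inf B' D"
        by (intro inf_mono; simp)+
      then have "inf (inf A' B') D \<le> inf A B" using A' B' by (intro le_infI) (rule order_trans, assumption+)+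
      then show "inf A B \<in> U \<union> {B. \<exists>A\<in>U. inf A D \<le> B}" using Uinf A' B' by blast
    qed (use GU Ubot D in \<open>auto simp: bot_unique\<close>)
    then have "U \<union> {B. \<exists>A\<in>U. inf A D \<le> B} = U" by (rule max) blast
    moreover obtain A where "A \<in> U" using False GU by blast
    ultimately show ?thesis using inf_le2[of A D] by blast
  qed
  have up: "B \<in> U" if "A \<in> U" "A \<le> B" for A B
  proof (rule meets)
    fix A' assume "A' \<in> U"
    then have "inf A' A \<in> U" using that Uinf by blast
    moreover have "inf A' A \<le> inf A' B" using that by (intro inf_mono) auto
    ultimately show "inf A' B \<noteq> bot" using Ubot by (metis bot_unique)
  qed
  have "A \<in> U \<or> B \<in> U" if AB: "sup A B \<in> U" for A B
  proof (rule ccontr)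
    assume "\<not> (A \<in> U \<or> B \<in> U)"
    then obtain A' B' where A': "A' \<in> U" "inf A' A = bot" and B': "B' \<in> U" "inf B' B = bot"
      using meets by metis
    have "inf (inf A' B') (sup A B) = sup (inf B' (inf A' A)) (inf A' (inf B' B))"
      by (simp add: inf_sup_distrib1 inf_assoc inf_commute inf_left_commute)
    then have "inf (inf A' B') (sup A B) = bot" using A' B' by (simp add: inf_bot)
    then show False using Uinf[OF Uinf[OF A'(1) B'(1)] AB] Ubot by simp
  qed
  then have "prime_filter U"
    unfolding prime_filter_def using Ubot Uinf up by (meson inf_le1 inf_le2 sup_ge1 sup_ge2)
  then show ?thesis using that GU by blast
qed

text \<open>A point is a finite or infinite path of letters that starts at a prime filter; it may only stop
  at a prime filter without regular elements. Its entry at \<open>n\<close> records the next letter and the prime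
  filter reached after \<open>n\<close> steps; entries after a stop are arbitrary, as is the letter at the stop.\<close>

type_synonym ('l, 'b) point = "nat \<Rightarrow> 'l \<times> 'b set"

definition start :: "('l, 'b) point \<Rightarrow> 'b set" where
  "start x = snd (x 0)"

definition prepend :: "('l \<Rightarrow> 'b \<Rightarrow> 'b) \<Rightarrow> 'l \<Rightarrow> ('l, 'b) point \<Rightarrow> ('l, 'b) point" where
  "prepend \<theta> \<alpha> x = case_nat (\<alpha>, \<theta> \<alpha> -` start x) x"

lemma start_prepend: "start (prepend \<theta> \<alpha> x) = \<theta> \<alpha> -` start x"
  by (simp add: start_def prepend_def)

lemma prepend_eq_iff: "prepend \<theta> \<alpha> x = prepend \<theta> \<beta> y \<longleftrightarrow> \<alpha> = \<beta> \<and> x = y"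
proof
  assume eq: "prepend \<theta> \<alpha> x = prepend \<theta> \<beta> y"
  have "x n = y n" for n using fun_cong[OF eq, of "Suc n"] by (simp add: prepend_def)
  then show "\<alpha> = \<beta> \<and> x = y" using fun_cong[OF eq, of 0] by (auto simp: prepend_def)
qed simp

coinductive_set points ::
    "'l set \<Rightarrow> ('l \<Rightarrow> 'b::generalized_boolean_algebra \<Rightarrow> 'b) \<Rightarrow> ('l \<Rightarrow> 'b set) \<Rightarrow> ('l, 'b) point set"
  for L \<theta> \<I> where
  stop: "prime_filter (start x) \<Longrightarrow> start x \<inter> regular_elements L \<theta> = {} \<Longrightarrow> x \<in> points L \<theta> \<I>"
| step: "prime_filter (start x) \<Longrightarrow> \<alpha> \<in> L \<Longrightarrow> start x \<inter> \<I> \<alpha> \<noteq> {} \<Longrightarrow> x \<in> points L \<theta> \<I> \<Longrightarrow> prepend \<theta> \<alpha> x \<in> points L \<theta> \<I>"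

locale gbds =
  fixes L :: "'l set" and \<theta> :: "'l \<Rightarrow> 'b::generalized_boolean_algebra \<Rightarrow> 'b" and \<I> :: "'l \<Rightarrow> 'b set"
  assumes sys: "generalized_boolean_dynamical_system L \<theta> \<I>"
begin

lemma action:
  assumes "\<alpha> \<in> L"
  shows \<theta>_inf: "\<theta> \<alpha> (inf A B) = inf (\<theta> \<alpha> A) (\<theta> \<alpha> B)" and \<theta>_sup: "\<theta> \<alpha> (sup A B) = sup (\<theta> \<alpha> A) (\<theta> \<alpha> B)"
    and \<theta>_diff: "\<theta> \<alpha> (A - B) = \<theta> \<alpha> A - \<theta> \<alpha> B" and \<theta>_bot: "\<theta> \<alpha> bot = bot"
  using sys assms
  by (auto simp: generalized_boolean_dynamical_system_def boolean_dynamical_system_def boolean_action_def)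

lemma \<theta>_ideal: "\<alpha> \<in> L \<Longrightarrow> \<theta> \<alpha> A \<in> \<I> \<alpha>"
  using sys by (auto simp: generalized_boolean_dynamical_system_def)

lemma ideal:
  assumes "\<alpha> \<in> L" "A \<in> \<I> \<alpha>"
  shows ideal_down: "B \<le> A \<Longrightarrow> B \<in> \<I> \<alpha>" and ideal_sup: "B \<in> \<I> \<alpha> \<Longrightarrow> sup A B \<in> \<I> \<alpha>"
  using sys assms unfolding generalized_boolean_dynamical_system_def boolean_ideal_def by blast+

lemma prime_filter_preimage: "\<alpha> \<in> L \<Longrightarrow> prime_filter U \<Longrightarrow> prime_filter (\<theta> \<alpha> -` U)"
  by (simp add: prime_filter_def \<theta>_inf \<theta>_sup \<theta>_bot)

text \<open>Compactness: were every letter to kill some member of \<open>U\<close>, then finitely many members would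
  meet in a nonempty regular set without successors.\<close>

lemma prime_filter_lift:
  assumes U: "prime_filter U" and A: "A \<in> U" "A \<in> regular_elements L \<theta>"
  shows "\<exists>\<alpha> V. \<alpha> \<in> L \<and> prime_filter V \<and> V \<inter> \<I> \<alpha> \<noteq> {} \<and> \<theta> \<alpha> -` V = U"
proof -
  have "\<exists>\<alpha>\<in>Delta L \<theta> A. \<forall>C\<in>U. \<theta> \<alpha> C \<noteq> bot"
  proof (rule ccontr)
    assume "\<not> (\<exists>\<alpha>\<in>Delta L \<theta> A. \<forall>C\<in>U. \<theta> \<alpha> C \<noteq> bot)"
    then have kill: "\<exists>C\<in>U. \<theta> \<alpha> C = bot" if "\<alpha> \<in> Delta L \<theta> A" for \<alpha> using that by blast
    have "A \<noteq> bot" using U A by (auto simp: prime_filter_def)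
    then have "finite (Delta L \<theta> A)" using A by (auto simp: regular_elements_def)
    have "\<exists>C\<in>U. C \<le> A \<and> (\<forall>\<alpha>\<in>F. \<theta> \<alpha> C = bot)" if "F \<subseteq> Delta L \<theta> A" for F
      using finite_subset[OF that \<open>finite (Delta L \<theta> A)\<close>] that
    proof (induction F rule: finite_induct)
      case empty
      then show ?case using A by blast
    next
      case (insert \<alpha> F)
      then obtain C where C: "C \<in> U" "C \<le> A" "\<forall>\<alpha>\<in>F. \<theta> \<alpha> C = bot" by auto
      obtain C' where C': "C' \<in> U" "\<theta> \<alpha> C' = bot" using kill insert.prems by auto
      have "inf C C' \<in> U" using C C' U by (simp add: prime_filter_def)
      moreover have "\<theta> \<beta> (inf C C') = bot" if "\<beta> \<in> insert \<alpha> F" for \<beta>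
      proof -
        have "\<beta> \<in> L" using that insert.prems by (auto simp: Delta_def)
        then show ?thesis using that C C' by (auto simp: \<theta>_inf inf_bot)
      qed
      ultimately show ?case using C by (intro bexI[of _ "inf C C'"]) (auto intro: le_infI1)
    qed
    then obtain C where C: "C \<in> U" "C \<le> A" "\<forall>\<alpha>\<in>Delta L \<theta> A. \<theta> \<alpha> C = bot" by blast
    have "Delta L \<theta> C \<subseteq> Delta L \<theta> A"
    proof
      fix \<alpha> assume "\<alpha> \<in> Delta L \<theta> C"
      then have \<alpha>: "\<alpha> \<in> L" "\<theta> \<alpha> C \<noteq> bot" by (auto simp: Delta_def)
      have "\<theta> \<alpha> C \<le> \<theta> \<alpha> A" using C(2) \<theta>_inf[OF \<alpha>(1), of C A] by (simp add: inf_absorb1 inf.orderI)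
      then show "\<alpha> \<in> Delta L \<theta> A" using \<alpha> by (auto simp: Delta_def bot_unique)
    qed
    then have "Delta L \<theta> C = {}" using C(3) by (auto simp: Delta_def)
    moreover have "C \<noteq> bot" using C(1) U by (auto simp: prime_filter_def)
    ultimately show False using A C(2) by (auto simp: regular_elements_def)
  qed
  then obtain \<alpha> where \<alpha>: "\<alpha> \<in> L" "\<And>C. C \<in> U \<Longrightarrow> \<theta> \<alpha> C \<noteq> bot" by (auto simp: Delta_def)
  obtain V where V: "prime_filter V" "\<theta> \<alpha> ` U \<subseteq> V"
  proof (rule prime_filter_extension[of "\<theta> \<alpha> ` U"])
    fix B B' assume "B \<in> \<theta> \<alpha> ` U" "B' \<in> \<theta> \<alpha> ` U"
    then show "inf B B' \<in> \<theta> \<alpha> ` U" using U by (auto simp: prime_filter_def simp flip: \<theta>_inf[OF \<alpha>(1)])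
  next
    show "bot \<notin> \<theta> \<alpha> ` U" using \<alpha>(2) by force
  qed blast
  have "\<theta> \<alpha> -` V \<subseteq> U"
  proof
    fix D assume D: "D \<in> \<theta> \<alpha> -` V"
    show "D \<in> U"
    proof (rule ccontr)
      assume "D \<notin> U"
      then have "A - D \<in> U" using U A(1) sup_diff_inf[of A D] unfolding prime_filter_def by metis
      then have "inf (\<theta> \<alpha> (A - D)) (\<theta> \<alpha> D) \<in> V" using V D by (auto simp: prime_filter_def)
      then show False using V(1) by (simp add: inf_diff_bot \<theta>_bot prime_filter_def \<alpha>(1) flip: \<theta>_inf)
    qed
  qed
  moreover have "\<theta> \<alpha> A \<in> V \<inter> \<I> \<alpha>" using V A \<alpha> \<theta>_ideal by blast
  ultimately show ?thesis using V \<alpha> by blast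
qed

text \<open>Lifting the prime filter again and again, as long as it contains a regular element, yields a path.\<close>

lemma point_with_start:
  assumes U: "prime_filter U" obtains x where "x \<in> points L \<theta> \<I>" "start x = U"
proof -
  define good where "good U \<alpha> V \<longleftrightarrow> \<alpha> \<in> L \<and> prime_filter V \<and> V \<inter> \<I> \<alpha> \<noteq> {} \<and> \<theta> \<alpha> -` V = U" for U \<alpha> V
  have "\<exists>w. prime_filter U \<longrightarrow> U \<inter> regular_elements L \<theta> \<noteq> {} \<longrightarrow> good U (fst w) (snd w)" for U
  proof (cases "prime_filter U \<and> U \<inter> regular_elements L \<theta> \<noteq> {}")
    case True
    then obtain A where A: "prime_filter U" "A \<in> U" "A \<in> regular_elements L \<theta>" by blast
    obtain \<alpha> V where "good U \<alpha> V" using prime_filter_lift[OF A] unfolding good_def by (elim exE)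
    then show ?thesis by (intro exI[of _ "(\<alpha>, V)"]) simp
  qed blast
  then obtain w where w: "\<And>U. prime_filter U \<Longrightarrow> U \<inter> regular_elements L \<theta> \<noteq> {} \<Longrightarrow> good U (fst (w U)) (snd (w U))"
    by metis
  define a where "a U = fst (w U)" for U
  define v where "v U = snd (w U)" for U
  have av: "good U (a U) (v U)" if "prime_filter U" "U \<inter> regular_elements L \<theta> \<noteq> {}" for U
    using w[OF that] by (simp add: a_def v_def)
  define path where "path U n = (a ((v ^^ n) U), (v ^^ n) U)" for U n
  have start: "start (path U) = U" for U by (simp add: start_def path_def)
  have "path U \<in> points L \<theta> \<I>"
  proof (rule points.coinduct[of "\<lambda>x. \<exists>U. prime_filter U \<and> x = path U"])
    fix x assume "\<exists>U. prime_filter U \<and> x = path U"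
    then obtain U where U: "prime_filter U" "x = path U" by blast
    show "(\<exists>y. x = y \<and> prime_filter (start y) \<and> start y \<inter> regular_elements L \<theta> = {}) \<or>
         (\<exists>y \<alpha>. x = prepend \<theta> \<alpha> y \<and> prime_filter (start y) \<and> \<alpha> \<in> L \<and> start y \<inter> \<I> \<alpha> \<noteq> {} \<and>
             ((\<exists>U. prime_filter U \<and> y = path U) \<or> y \<in> points L \<theta> \<I>))"
    proof (cases "U \<inter> regular_elements L \<theta> = {}")
      case False
      note g = av[OF U(1) False, unfolded good_def]
      have "path U = prepend \<theta> (a U) (path (v U))"
      proof
        show "path U n = prepend \<theta> (a U) (path (v U)) n" for n
          using g by (cases n) (auto simp: path_def prepend_def start funpow_swap1)
      qed
      then show ?thesis using g U(2) start by metis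
    qed (use U start in auto)
  qed (use U in auto)
  then show ?thesis using that start by blast
qed

lemma points_prime: "x \<in> points L \<theta> \<I> \<Longrightarrow> prime_filter (start x)"
  by (erule points.cases) (auto simp: start_prepend prime_filter_preimage)

definition point_proj :: "'b \<Rightarrow> (('l, 'b) point ell2 \<times> ('l, 'b) point ell2) \<Rightarrow>\<^sub>L (('l, 'b) point ell2 \<times> ('l, 'b) point ell2)" where
  "point_proj A = shift_operator (Id_on {x \<in> points L \<theta> \<I>. A \<in> start x})"

definition point_rel :: "'l \<Rightarrow> 'b \<Rightarrow> (('l, 'b) point \<times> ('l, 'b) point) set" where
  "point_rel \<alpha> B = {(prepend \<theta> \<alpha> x, x) |x. x \<in> points L \<theta> \<I> \<and> B \<in> start x}"

lemma partial_bijection_point_rel: "partial_bijection (point_rel \<alpha> B)"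
  by (auto simp: partial_bijection_def single_valued_def point_rel_def prepend_eq_iff)

text \<open>\<open>P A\<close> projects onto the points that start in \<open>A\<close>, and \<open>S \<alpha> B\<close> prepends \<open>\<alpha>\<close> to those that start in \<open>B\<close>.
  The Cuntz-Krieger relation (the last one) holds because a point that starts in a regular set cannot
  be a stop: it has a first letter.\<close>

lemma point_representation:
  "gbds_representation L \<theta> \<I> ell2_alg point_proj (\<lambda>\<alpha> B. shift_operator (point_rel \<alpha> B))"
proof -
  note pb = partial_bijection_point_rel partial_bijection_Id_on partial_bijection_converse partial_bijection_relcomp
  note [simp] = pb shift_operator_carrier adj_shift_operator shift_operator_compose ell2_alg_simps
  have Id_Id: "Id_on E O Id_on E' = Id_on (E \<inter> E')" for E E' :: "('l, 'b) point set" by auto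
  have pf: "prime_filter (start x)" if "x \<in> points L \<theta> \<I>" for x using that by (rule points_prime)
  show ?thesis
    unfolding gbds_representation_def
  proof (intro conjI allI ballI, goal_cases)
    case (2 A) show ?case by (simp add: point_proj_def Id_Id)
  next
    case (5 \<alpha> B)
    have "point_rel \<alpha> B O (point_rel \<alpha> B)\<inverse> O point_rel \<alpha> B = point_rel \<alpha> B"
      by (auto simp: point_rel_def prepend_eq_iff)
    then show ?case by (simp add: O_assoc)
  next
    case 6
    have "{x \<in> points L \<theta> \<I>. bot \<in> start x} = {}" using pf by (auto simp: prime_filter_def)
    then show ?case by (simp only: point_proj_def shift_operator_empty Id_on_empty ell2_alg_simps)
  next
    case (7 A A')
    have "{x \<in> points L \<theta> \<I>. inf A A' \<in> start x} = {x \<in> points L \<theta> \<I>. A \<in> start x} \<inter> {x \<in> points L \<theta> \<I>. A' \<in> start x}"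
      using pf by (auto simp: prime_filter_def)
    then show ?case by (simp add: point_proj_def Id_Id)
  next
    case (8 A A')
    have "{x \<in> points L \<theta> \<I>. inf A A' \<in> start x} = {x \<in> points L \<theta> \<I>. A \<in> start x} \<inter> {x \<in> points L \<theta> \<I>. A' \<in> start x}"
      "{x \<in> points L \<theta> \<I>. sup A A' \<in> start x} = {x \<in> points L \<theta> \<I>. A \<in> start x} \<union> {x \<in> points L \<theta> \<I>. A' \<in> start x}"
      using pf by (auto simp: prime_filter_def)
    then show ?case by (simp add: point_proj_def shift_operator_Id_on_Un ell2_alg_minus)
  next
    case (9 A \<alpha> B)
    have "x \<in> points L \<theta> \<I> \<Longrightarrow> B \<in> start x \<Longrightarrow> prepend \<theta> \<alpha> x \<in> points L \<theta> \<I>" for x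
      using 9 pf by (intro points.step) auto
    then have "Id_on {x \<in> points L \<theta> \<I>. A \<in> start x} O point_rel \<alpha> B
        = point_rel \<alpha> B O Id_on {x \<in> points L \<theta> \<I>. \<theta> \<alpha> A \<in> start x}"
      by (fastforce simp: point_rel_def start_prepend)
    then show ?case by (simp add: point_proj_def)
  next
    case (10 \<alpha> B \<alpha>' B')
    have "(point_rel \<alpha> B)\<inverse> O point_rel \<alpha>' B' = (if \<alpha> = \<alpha>' then Id_on {x \<in> points L \<theta> \<I>. inf B B' \<in> start x} else {})"
      using pf by (auto simp: point_rel_def prepend_eq_iff prime_filter_def)
    then show ?case by (simp add: point_proj_def shift_operator_empty)
  next
    case (11 A)
    have fin: "finite (Delta L \<theta> A)"
    proof (cases "A = bot")
      case True
      then have "Delta L \<theta> A = {}" by (auto simp: Delta_def \<theta>_bot)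
      then show ?thesis by simp
    qed (use 11 in \<open>auto simp: regular_elements_def\<close>)
    define E where "E \<alpha> = prepend \<theta> \<alpha> ` {x \<in> points L \<theta> \<I>. \<theta> \<alpha> A \<in> start x}" for \<alpha>
    have "point_rel \<alpha> (\<theta> \<alpha> A) O (point_rel \<alpha> (\<theta> \<alpha> A))\<inverse> = Id_on (E \<alpha>)" for \<alpha>
      by (auto simp: point_rel_def E_def)
    then have "(\<Oplus>\<^bsub>ell2_alg\<^esub>\<alpha>\<in>Delta L \<theta> A. shift_operator (point_rel \<alpha> (\<theta> \<alpha> A)) \<otimes>\<^bsub>ell2_alg\<^esub>
        adj ell2_alg (shift_operator (point_rel \<alpha> (\<theta> \<alpha> A)))) = (\<Sum>\<alpha>\<in>Delta L \<theta> A. shift_operator (Id_on (E \<alpha>)))"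
      by (simp add: ell2_alg_finsum fin)
    also have "\<dots> = shift_operator (Id_on (\<Union>\<alpha>\<in>Delta L \<theta> A. E \<alpha>))"
      by (rule shift_operator_Id_on_UN[symmetric]) (auto simp: fin E_def prepend_eq_iff)
    also have "(\<Union>\<alpha>\<in>Delta L \<theta> A. E \<alpha>) = {x \<in> points L \<theta> \<I>. A \<in> start x}"
    proof (intro subset_antisym subsetI)
      fix z assume "z \<in> (\<Union>\<alpha>\<in>Delta L \<theta> A. E \<alpha>)"
      then obtain \<alpha> x where z: "\<alpha> \<in> L" "z = prepend \<theta> \<alpha> x" "x \<in> points L \<theta> \<I>" "\<theta> \<alpha> A \<in> start x"
        by (auto simp: E_def Delta_def)
      then have "start x \<inter> \<I> \<alpha> \<noteq> {}" using \<theta>_ideal by blast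
      then show "z \<in> {x \<in> points L \<theta> \<I>. A \<in> start x}"
        using z pf by (auto simp: start_prepend intro!: points.step)
    next
      fix z assume z: "z \<in> {x \<in> points L \<theta> \<I>. A \<in> start x}"
      then have "z \<in> points L \<theta> \<I>" by simp
      then show "z \<in> (\<Union>\<alpha>\<in>Delta L \<theta> A. E \<alpha>)"
      proof (cases rule: points.cases)
        case stop
        then show ?thesis using z 11 by auto
      next
        case (step x \<alpha>)
        then have "\<theta> \<alpha> A \<in> start x" using z by (simp add: start_prepend)
        moreover then have "\<theta> \<alpha> A \<noteq> bot" using step by (auto simp: prime_filter_def)
        ultimately show ?thesis using step by (auto simp: E_def Delta_def)
      qed
    qed
    finally show ?case by (simp add: point_proj_def)
  qed (simp_all add: point_proj_def)
qed

lemma point_proj_nonzero: assumes "A \<noteq> bot" shows "point_proj A \<noteq> 0"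
proof -
  obtain U where U: "prime_filter U" "{A} \<subseteq> U"
    using assms by (rule_tac prime_filter_extension[of "{A}"]) auto
  obtain x where "x \<in> points L \<theta> \<I>" "start x = U" by (rule point_with_start[OF U(1)])
  then have "x \<in> {x \<in> points L \<theta> \<I>. A \<in> start x}" using U by simp
  then show ?thesis unfolding point_proj_def by (rule shift_operator_Id_on_nonzero)
qed

lemma universal_projection_nonzero:
  assumes "universal_representation L \<theta> \<I> p s" and A: "A \<noteq> bot"
  shows "p A \<noteq> (0 :: 'a::cstar_algebra)"
proof
  assume 0: "p A = 0"
  obtain \<phi> where \<phi>: "star_hom full_alg ell2_alg \<phi>" "\<phi> (p A) = point_proj A"
    using universal_representation_hom[OF sys assms(1) cstar_alg_ell2_alg point_representation] by blast
  have "\<phi> (x + y) = \<phi> x + \<phi> y" for x y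
    using \<phi>(1) by (simp add: star_hom_def full_alg_def ell2_alg_simps)
  from this[of 0 0] have "\<phi> 0 = 0" by simp
  then show False using \<phi>(2) 0 point_proj_nonzero[OF A] by simp
qed

end

section \<open>Calculus of words\<close>

lemma full_alg_simps:
  "carrier full_alg = UNIV" "\<zero>\<^bsub>full_alg\<^esub> = 0" "x \<otimes>\<^bsub>full_alg\<^esub> y = x * y" "x \<oplus>\<^bsub>full_alg\<^esub> y = x + y"
  "c \<odot>\<^bsub>full_alg\<^esub> x = c *\<^sub>C x" "adj full_alg x = star x"
  by (simp_all add: full_alg_def)

lemma full_alg_minus: "x \<ominus>\<^bsub>full_alg\<^esub> y = x - (y::'a::cstar_algebra)"
proof -
  interpret cstar_alg "full_alg :: 'a star_alg" by (rule cstar_alg_full_alg)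
  have "\<ominus>\<^bsub>full_alg\<^esub> y = - y" by (rule minus_equality) (simp_all add: full_alg_simps)
  then show ?thesis by (simp add: a_minus_def full_alg_simps)
qed

lemma full_alg_finsum: "finite F \<Longrightarrow> finsum full_alg h F = (\<Sum>i\<in>F. h i :: 'a::cstar_algebra)"
proof -
  interpret cstar_alg "full_alg :: 'a star_alg" by (rule cstar_alg_full_alg)
  show "finite F \<Longrightarrow> ?thesis"
    by (induction F rule: finite_induct) (simp_all add: full_alg_simps)
qed

lemma list_comparison:
  "(\<exists>w. v = u @ w) \<or> (\<exists>w. u = v @ w) \<or> (\<exists>i<length u. i < length v \<and> u ! i \<noteq> v ! i)"
proof (induction u arbitrary: v)
  case (Cons a u)
  show ?case
  proof (cases v)
    case (Cons b v')
    show ?thesis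
    proof (cases "a = b")
      case True
      from Cons.IH[of v'] show ?thesis
      proof (elim disjE exE conjE)
        fix i assume "i < length u" "i < length v'" "u ! i \<noteq> v' ! i"
        then show ?thesis using Cons by (intro disjI2 exI[of _ "Suc i"]) simp
      qed (use Cons True in auto)
    next
      case False
      then show ?thesis using Cons by (intro disjI2 exI[of _ 0]) simp
    qed
  qed simp
qed simp

(* Its right-hand side chooses an index; S_Cons below allows every admissible one. *)
declare s_word.simps(2) [simp del]

context gbds
begin

lemma fold_action:
  assumes "w \<in> lists L"
  shows fold_inf: "fold \<theta> w (inf A B) = inf (fold \<theta> w A) (fold \<theta> w B)"
    and fold_diff: "fold \<theta> w (A - B) = fold \<theta> w A - fold \<theta> w B"
    and fold_bot: "fold \<theta> w bot = bot"
  using assms by (induction w arbitrary: A B) (simp_all add: \<theta>_inf \<theta>_diff \<theta>_bot)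

lemma fold_mono: "w \<in> lists L \<Longrightarrow> A \<le> B \<Longrightarrow> fold \<theta> w A \<le> fold \<theta> w B"
  using fold_inf[of w A B] by (simp add: inf_absorb1 inf.orderI)

lemma \<theta>_mono: "\<alpha> \<in> L \<Longrightarrow> A \<le> B \<Longrightarrow> \<theta> \<alpha> A \<le> \<theta> \<alpha> B"
  using fold_mono[of "[\<alpha>]"] by simp

abbreviation "IW \<equiv> word_ideal \<theta> \<I>"

lemma IW_down: "A \<in> IW w \<Longrightarrow> B \<le> A \<Longrightarrow> B \<in> IW w"
  by (cases w) (auto intro: order_trans)

lemma IW_tail: "\<alpha> \<in> L \<Longrightarrow> w \<in> lists L \<Longrightarrow> A \<in> IW (\<alpha> # w) \<Longrightarrow> A \<in> IW w"
  by (cases w) (auto intro: \<theta>_ideal)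

lemma IW_fold: "w \<in> lists L \<Longrightarrow> A \<le> fold \<theta> w B \<Longrightarrow> A \<in> IW w"
  by (cases w) (auto intro: \<theta>_ideal)

lemma IW_append: "v \<in> lists L \<Longrightarrow> w \<in> lists L \<Longrightarrow> A \<in> IW v \<Longrightarrow> B \<le> fold \<theta> w A \<Longrightarrow> B \<in> IW (v @ w)"
proof (cases v)
  case (Cons \<alpha> v')
  assume "v \<in> lists L" "w \<in> lists L" "A \<in> IW v" "B \<le> fold \<theta> w A"
  then obtain C where "C \<in> \<I> \<alpha>" "A \<le> fold \<theta> v' C" "B \<le> fold \<theta> w A" using Cons by auto
  then have "B \<le> fold \<theta> w (fold \<theta> v' C)" using fold_mono[OF \<open>w \<in> lists L\<close>] order_trans by blast
  then show ?thesis using Cons \<open>C \<in> \<I> \<alpha>\<close> by auto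
qed (simp add: IW_fold)

lemma Delta_mono: assumes "A \<le> B" shows "Delta L \<theta> A \<subseteq> Delta L \<theta> B"
proof
  fix \<alpha> assume "\<alpha> \<in> Delta L \<theta> A"
  then have \<alpha>: "\<alpha> \<in> L" "\<theta> \<alpha> A \<noteq> bot" by (auto simp: Delta_def)
  then have "\<theta> \<alpha> B \<noteq> bot" using \<theta>_mono[OF \<alpha>(1) assms] by (metis bot_unique)
  then show "\<alpha> \<in> Delta L \<theta> B" using \<alpha> by (simp add: Delta_def)
qed

lemma obtain_admissible:
  assumes "\<alpha> \<in> L" "w \<in> lists L" "w' \<in> lists L" "A \<in> IW (\<alpha> # w)" "A' \<in> IW (\<alpha> # w')" "D \<in> \<I> \<alpha>"
  obtains B where "B \<in> \<I> \<alpha>" "A \<le> fold \<theta> w B" "A' \<le> fold \<theta> w' B" "D \<le> B"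
proof -
  obtain B1 B2 where B: "B1 \<in> \<I> \<alpha>" "A \<le> fold \<theta> w B1" "B2 \<in> \<I> \<alpha>" "A' \<le> fold \<theta> w' B2"
    using assms by auto
  let ?B = "sup (sup B1 B2) D"
  have le: "B1 \<le> ?B" "B2 \<le> ?B" by (simp_all add: le_supI1)
  have "?B \<in> \<I> \<alpha>" using B assms by (intro ideal_sup) auto
  moreover have "A \<le> fold \<theta> w ?B" by (rule order_trans[OF B(2) fold_mono[OF assms(2) le(1)]])
  moreover have "A' \<le> fold \<theta> w' ?B" by (rule order_trans[OF B(4) fold_mono[OF assms(3) le(2)]])
  ultimately show ?thesis by (intro that[of ?B]) auto
qed

end

locale gbds_relations = gbds L \<theta> \<I>
  for L :: "'l set" and \<theta> :: "'l \<Rightarrow> 'b::generalized_boolean_algebra \<Rightarrow> 'b" and \<I> +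
  fixes p :: "'b \<Rightarrow> 'a::cstar_algebra" and s :: "'l \<Rightarrow> 'b \<Rightarrow> 'a"
  assumes rep: "gbds_representation L \<theta> \<I> full_alg p s"
begin

lemma p_projection: "projection (p A)"
  and p_bot: "p bot = 0"
  and p_inf: "p (inf A B) = p A * p B"
  and p_sup: "p (sup A B) = p A + p B - p (inf A B)"
  and p_s: "\<alpha> \<in> L \<Longrightarrow> B \<in> \<I> \<alpha> \<Longrightarrow> p A * s \<alpha> B = s \<alpha> B * p (\<theta> \<alpha> A)"
  and star_s_s: "\<alpha> \<in> L \<Longrightarrow> B \<in> \<I> \<alpha> \<Longrightarrow> \<beta> \<in> L \<Longrightarrow> B' \<in> \<I> \<beta> \<Longrightarrow>
    star (s \<alpha> B) * s \<beta> B' = (if \<alpha> = \<beta> then p (inf B B') else 0)"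
  using rep by (simp_all add: gbds_representation_def full_alg_simps full_alg_minus projection_def)

lemma p_regular:
  assumes "A \<in> regular_elements L \<theta>" "finite (Delta L \<theta> A)"
  shows "p A = (\<Sum>\<alpha>\<in>Delta L \<theta> A. s \<alpha> (\<theta> \<alpha> A) * star (s \<alpha> (\<theta> \<alpha> A)))"
  using rep assms by (simp add: gbds_representation_def full_alg_simps full_alg_finsum)

lemmas p_star = projection_star[OF p_projection]

lemma p_mult_le: "A \<le> B \<Longrightarrow> p A * p B = p A"
  by (simp add: inf_absorb1 flip: p_inf)

text \<open>For \<open>x = s \<alpha> B p C - s \<alpha> (B \<inter> C)\<close> the relations give \<open>x\<^sup>* x = 0\<close>.\<close>

lemma s_p: assumes a: "\<alpha> \<in> L" "B \<in> \<I> \<alpha>" shows "s \<alpha> B * p C = s \<alpha> (inf B C)"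
proof (rule eq_if_star_mult_diff_eq_0)
  have B': "inf B C \<in> \<I> \<alpha>" using a by (rule ideal_down) simp
  have pC: "star (s \<alpha> B) * (s \<alpha> B' * x) = p (inf B B') * x" if "B' \<in> \<I> \<alpha>" for B' x
    using a that by (simp add: star_s_s flip: mult.assoc)
  have pC': "star (s \<alpha> (inf B C)) * (s \<alpha> B' * x) = p (inf (inf B C) B') * x" if "B' \<in> \<I> \<alpha>" for B' x
    using a B' that by (simp add: star_s_s flip: mult.assoc)
  show "star (s \<alpha> B * p C - s \<alpha> (inf B C)) * (s \<alpha> B * p C - s \<alpha> (inf B C)) = 0"
    using a B'
    by (simp add: star_diff star_mult p_star left_diff_distrib right_diff_distrib mult.assoc star_s_s pC pC'
        flip: p_inf) (simp add: inf_commute inf_left_commute)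
qed

lemma p_s_inf: "\<alpha> \<in> L \<Longrightarrow> B \<in> \<I> \<alpha> \<Longrightarrow> p A * s \<alpha> B = s \<alpha> (inf B (\<theta> \<alpha> A))"
  by (simp add: p_s s_p)

abbreviation "S \<equiv> s_word \<theta> \<I> p s"

lemma p_word_chain:
  assumes "\<alpha> \<in> L" "w \<in> lists L" "B \<in> \<I> \<alpha>" "B \<le> \<theta> \<alpha> C" "A \<le> fold \<theta> w B"
  shows "p C * word_chain \<theta> s B \<alpha> w A = word_chain \<theta> s B \<alpha> w A"
proof (cases w)
  case Nil
  then have A: "A \<le> B" using assms by simp
  then have "A \<in> \<I> \<alpha>" "inf A (\<theta> \<alpha> C) = A" using assms ideal_down by (auto simp: inf_absorb1)
  then show ?thesis using Nil assms(1) by (simp add: p_s_inf)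
next
  case (Cons b w')
  have "inf B (\<theta> \<alpha> C) = B" using assms by (simp add: inf_absorb1)
  then show ?thesis using Cons assms(1,3) by (simp add: p_s_inf flip: mult.assoc)
qed

text \<open>Shrinking \<open>B\<close> inserts a projection \<open>p B\<close> after the first factor, and the remaining product absorbs it.\<close>

lemma word_chain_mono:
  assumes "\<alpha> \<in> L" "w \<in> lists L" "B' \<in> \<I> \<alpha>" "B \<le> B'" "A \<le> fold \<theta> w B"
  shows "word_chain \<theta> s B \<alpha> w A = word_chain \<theta> s B' \<alpha> w A"
  using assms
proof (induction w arbitrary: \<alpha> B B')
  case (Cons b w)
  have b: "b \<in> L" "w \<in> lists L" using Cons.prems by auto
  let ?X = "word_chain \<theta> s (\<theta> b B) b w A"
  have "?X = word_chain \<theta> s (\<theta> b B') b w A"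
    using Cons.prems b by (intro Cons.IH \<theta>_ideal \<theta>_mono) auto
  moreover have "s \<alpha> B = s \<alpha> B' * p B"
    using Cons.prems by (simp add: s_p inf_absorb2)
  moreover have "p B * ?X = ?X"
    using Cons.prems b by (intro p_word_chain \<theta>_ideal) auto
  ultimately show ?case by (simp add: mult.assoc)
qed simp

lemma word_chain_indep:
  assumes "\<alpha> \<in> L" "w \<in> lists L" "B \<in> \<I> \<alpha>" "B' \<in> \<I> \<alpha>" "A \<le> fold \<theta> w B" "A \<le> fold \<theta> w B'"
  shows "word_chain \<theta> s B \<alpha> w A = word_chain \<theta> s B' \<alpha> w A"
proof -
  have "A \<le> fold \<theta> w (inf B B')" using assms by (simp add: fold_inf)
  then show ?thesis using assms word_chain_mono[of \<alpha> w B "inf B B'" A] word_chain_mono[of \<alpha> w B' "inf B B'" A] by simp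
qed

text \<open>This recursion, valid for every admissible \<open>B\<close>, replaces the definition with its choice of \<open>B\<close>.\<close>

lemma S_Cons:
  assumes "\<alpha> \<in> L" "w \<in> lists L" "B \<in> \<I> \<alpha>" "A \<le> fold \<theta> w B"
  shows "S (\<alpha> # w) A = s \<alpha> B * S w A"
proof -
  have choice: "word_chain \<theta> s (SOME B. B \<in> \<I> \<alpha> \<and> A \<le> fold \<theta> w B) \<alpha> w A = word_chain \<theta> s B \<alpha> w A"
    if "\<alpha> \<in> L" "w \<in> lists L" "B \<in> \<I> \<alpha>" "A \<le> fold \<theta> w B" for \<alpha> w B
    using someI[of "\<lambda>B. B \<in> \<I> \<alpha> \<and> A \<le> fold \<theta> w B" B] that by (intro word_chain_indep) auto
  show ?thesis
  proof (cases w)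
    case Nil
    then show ?thesis using choice[OF assms] assms by (simp add: s_word.simps(2) s_p inf_absorb2)
  next
    case (Cons b w')
    then have "b \<in> L" "w' \<in> lists L" "A \<le> fold \<theta> w' (\<theta> b B)" using assms by auto
    then show ?thesis
      using choice[OF assms] choice[of b w' "\<theta> b B"] Cons by (simp add: s_word.simps(2) \<theta>_ideal)
  qed
qed

lemma S_admissible:
  assumes "\<alpha> \<in> L" "w \<in> lists L" "A \<in> IW (\<alpha> # w)"
  shows "\<exists>B\<in>\<I> \<alpha>. A \<le> fold \<theta> w B \<and> (\<forall>A'\<le>A. S (\<alpha> # w) A' = s \<alpha> B * S w A')"
proof -
  obtain B where B: "B \<in> \<I> \<alpha>" "A \<le> fold \<theta> w B" using assms by auto
  have "S (\<alpha> # w) A' = s \<alpha> B * S w A'" if "A' \<le> A" for A'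
    using S_Cons[OF assms(1,2) B(1) order_trans[OF that B(2)]] .
  then show ?thesis using B by blast
qed

lemma S_p: "w \<in> lists L \<Longrightarrow> A \<in> IW w \<Longrightarrow> S w A * p C = S w (inf A C)"
proof (induction w)
  case (Cons \<alpha> w)
  have \<alpha>: "\<alpha> \<in> L" "w \<in> lists L" using Cons.prems by auto
  obtain B where B: "B \<in> \<I> \<alpha>" "A \<le> fold \<theta> w B" "\<And>A'. A' \<le> A \<Longrightarrow> S (\<alpha> # w) A' = s \<alpha> B * S w A'"
    using S_admissible[OF \<alpha> Cons.prems(2)] by blast
  have "S w A * p C = S w (inf A C)" using Cons.IH IW_tail[OF \<alpha> Cons.prems(2)] \<alpha> by simp
  then show ?case using B by (simp add: mult.assoc)
qed (simp add: p_inf)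

lemma p_S: "w \<in> lists L \<Longrightarrow> A \<in> IW w \<Longrightarrow> p C * S w A = S w (inf A (fold \<theta> w C))"
proof (induction w arbitrary: C)
  case (Cons \<alpha> w)
  have \<alpha>: "\<alpha> \<in> L" "w \<in> lists L" using Cons.prems by auto
  obtain B where B: "B \<in> \<I> \<alpha>" "A \<le> fold \<theta> w B" "\<And>A'. A' \<le> A \<Longrightarrow> S (\<alpha> # w) A' = s \<alpha> B * S w A'"
    using S_admissible[OF \<alpha> Cons.prems(2)] by blast
  have "A \<in> IW w" by (rule IW_tail[OF \<alpha> Cons.prems(2)])
  have "p C * S (\<alpha> # w) A = s \<alpha> B * (p (\<theta> \<alpha> C) * S w A)"
    using B \<alpha> by (simp add: p_s mult.assoc[symmetric])
  also have "\<dots> = S (\<alpha> # w) (inf A (fold \<theta> (\<alpha> # w) C))"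
    using Cons.IH[OF \<alpha>(2) \<open>A \<in> IW w\<close>] B by simp
  finally show ?case .
qed (simp add: inf_commute flip: p_inf)

lemma p_S_absorb: "w \<in> lists L \<Longrightarrow> A \<le> fold \<theta> w C \<Longrightarrow> p C * S w A = S w A"
  by (simp add: p_S IW_fold inf_absorb1)

lemma S_bot: "w \<in> lists L \<Longrightarrow> S w bot = 0"
proof -
  assume w: "w \<in> lists L"
  have b: "bot \<in> IW w" using w by (rule IW_fold[of _ _ bot]) simp
  have "S w bot * p bot = S w bot" using S_p[OF w b, of bot] by simp
  then show ?thesis by (simp add: p_bot)
qed

lemma star_S_Cons_mult:
  assumes "\<alpha> \<in> L" "v \<in> lists L" "w \<in> lists L" "A \<in> IW (\<alpha> # v)" "A' \<in> IW (\<alpha> # w)"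
  shows "star (S (\<alpha> # v) A) * S (\<alpha> # w) A' = star (S v A) * S w A'"
proof -
  obtain D where "D \<in> \<I> \<alpha>" using assms(4) by auto
  then obtain B where B: "B \<in> \<I> \<alpha>" "A \<le> fold \<theta> v B" "A' \<le> fold \<theta> w B" "D \<le> B"
    by (rule obtain_admissible[OF assms])
  have "star (S (\<alpha> # v) A) * S (\<alpha> # w) A' = star (S v A) * (star (s \<alpha> B) * s \<alpha> B) * S w A'"
    using B assms by (simp add: S_Cons star_mult mult.assoc)
  also have "\<dots> = star (S v A) * (p B * S w A')"
    using B assms by (simp add: star_s_s mult.assoc)
  also have "\<dots> = star (S v A) * S w A'" using B assms by (simp add: p_S_absorb)
  finally show ?thesis .
qed

lemma star_S_S_prefix:
  "v \<in> lists L \<Longrightarrow> w \<in> lists L \<Longrightarrow> A \<in> IW v \<Longrightarrow> B \<in> IW (v @ w) \<Longrightarrow>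
    star (S v A) * S (v @ w) B = S w (inf B (fold \<theta> w A))"
proof (induction v)
  case (Cons \<alpha> v)
  then have "star (S (\<alpha> # v) A) * S (\<alpha> # (v @ w)) B = star (S v A) * S (v @ w) B"
    by (intro star_S_Cons_mult) auto
  moreover have "A \<in> IW v" "B \<in> IW (v @ w)" using Cons.prems IW_tail[of \<alpha> v A] IW_tail[of \<alpha> "v @ w" B] by simp_all
  ultimately show ?case using Cons by simp
qed (simp add: p_star p_S)

lemma star_S_S: "w \<in> lists L \<Longrightarrow> A \<in> IW w \<Longrightarrow> B \<in> IW w \<Longrightarrow> star (S w A) * S w B = p (inf A B)"
  using star_S_S_prefix[of w "[]" A B] by (simp add: inf_commute)

lemma star_S_S_incomparable:
  "v \<in> lists L \<Longrightarrow> w \<in> lists L \<Longrightarrow> A \<in> IW v \<Longrightarrow> B \<in> IW w \<Longrightarrow> i < length v \<Longrightarrow> i < length w \<Longrightarrow>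
    v ! i \<noteq> w ! i \<Longrightarrow> star (S v A) * S w B = 0"
proof (induction v arbitrary: w i)
  case (Cons \<alpha> v)
  obtain \<beta> w' where w: "w = \<beta> # w'" using Cons.prems by (cases w) auto
  have L: "\<alpha> \<in> L" "\<beta> \<in> L" "v \<in> lists L" "w' \<in> lists L" using Cons.prems w by auto
  show ?case
  proof (cases "\<alpha> = \<beta>")
    case True
    then obtain j where "i = Suc j" using Cons.prems w by (cases i) auto
    then have "star (S v A) * S w' B = 0"
      using Cons.prems w L True IW_tail[OF L(1,3)] IW_tail[OF L(2,4)] by (intro Cons.IH[of w' j]) auto
    then show ?thesis using star_S_Cons_mult[of \<alpha> v w' A B] Cons.prems w L True by simp
  next
    case False
    obtain C where C: "C \<in> \<I> \<alpha>" "A \<le> fold \<theta> v C" using Cons.prems by auto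
    obtain C' where C': "C' \<in> \<I> \<beta>" "B \<le> fold \<theta> w' C'" using Cons.prems w by auto
    have "star (S (\<alpha> # v) A) * S w B = star (S v A) * (star (s \<alpha> C) * s \<beta> C') * S w' B"
      using C C' L w by (simp add: S_Cons star_mult mult.assoc)
    then show ?thesis using False C C' L by (simp add: star_s_s)
  qed
qed simp

lemma star_S_S_same_length:
  assumes "v \<in> lists L" "w \<in> lists L" "A \<in> IW v" "B \<in> IW w" "length v = length w" "v \<noteq> w"
  shows "star (S v A) * S w B = 0"
proof -
  obtain i where "i < length v" "v ! i \<noteq> w ! i" using assms(5,6) nth_equalityI by blast
  then show ?thesis using assms by (intro star_S_S_incomparable[of v w A B i]) auto
qed

lemma S_append:
  "v \<in> lists L \<Longrightarrow> w \<in> lists L \<Longrightarrow> A \<in> IW v \<Longrightarrow> B \<in> IW w \<Longrightarrow>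
    S v A * S w B = S (v @ w) (inf B (fold \<theta> w A))"
proof (induction v)
  case (Cons \<alpha> v)
  have \<alpha>: "\<alpha> \<in> L" "v \<in> lists L" using Cons.prems by auto
  obtain C where C: "C \<in> \<I> \<alpha>" "A \<le> fold \<theta> v C" using Cons.prems by auto
  have "inf B (fold \<theta> w A) \<le> fold \<theta> (v @ w) C"
    using fold_mono[OF Cons.prems(2) C(2)] by (auto intro: le_infI2)
  then have "S ((\<alpha> # v) @ w) (inf B (fold \<theta> w A)) = s \<alpha> C * S (v @ w) (inf B (fold \<theta> w A))"
    using \<alpha> C Cons.prems by (simp add: S_Cons)
  also have "S (v @ w) (inf B (fold \<theta> w A)) = S v A * S w B"
    using Cons.IH Cons.prems IW_tail[OF \<alpha>] \<alpha> by simp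
  finally show ?case using C \<alpha> by (simp add: S_Cons mult.assoc)
qed (simp add: p_S)

lemma S_star_S:
  assumes "v \<in> lists L" "w \<in> lists L" "A \<in> IW v" "B \<in> IW w"
  shows "S v A * star (S w B) = S v (inf A B) * star (S w (inf A B))"
proof -
  have "S v (inf A B) * star (S w (inf A B)) = S v A * p (inf A B) * star (S w B * p (inf A B))"
    using assms by (simp add: S_p inf_left_commute)
  also have "\<dots> = S v A * (p (inf A B) * p (inf A B)) * star (S w B)"
    by (simp only: star_mult p_star mult.assoc)
  also have "\<dots> = (S v A * p A) * star (S w B * p B)"
    by (simp add: projection_idem p_projection) (simp add: p_inf star_mult p_star mult.assoc)
  finally show ?thesis using assms by (simp add: S_p)
qed

definition e :: "'l list \<Rightarrow> 'b \<Rightarrow> 'a" where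
  "e w A = S w A * star (S w A)"

text \<open>Only for these pairs is \<open>S w A\<close> the product that the notation suggests.\<close>

definition ranges :: "('l list \<times> 'b) set" where
  "ranges = {(w, A). w \<in> lists L \<and> A \<in> IW w}"

lemma e_Nil: "e [] A = p A"
  using projection_idem[OF p_projection] by (simp add: e_def p_star)

lemma e_S: "w \<in> lists L \<Longrightarrow> A \<in> IW w \<Longrightarrow> e w A * S w A = S w A"
  by (simp add: e_def mult.assoc star_S_S S_p)

lemma e_projection: assumes "w \<in> lists L" "A \<in> IW w" shows "projection (e w A)"
proof -
  have "e w A * e w A = e w A * S w A * star (S w A)" by (simp add: e_def mult.assoc)
  then show ?thesis using e_S[OF assms] by (simp add: projection_def) (simp add: e_def star_mult star_star)
qed

lemma e_bot: "w \<in> lists L \<Longrightarrow> e w bot = 0"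
  by (simp add: e_def S_bot)

lemma p_e: assumes "w \<in> lists L" "A \<in> IW w" shows "p C * e w A = e w (inf A (fold \<theta> w C))"
proof -
  let ?A = "inf A (fold \<theta> w C)"
  have "p C * e w A = S w ?A * star (S w A)" using assms by (simp add: e_def p_S flip: mult.assoc)
  also have "\<dots> = e w (inf ?A A)" using S_star_S[of w w ?A A] assms IW_down[of A w ?A] by (simp add: e_def)
  finally show ?thesis by (simp add: inf_commute inf_left_commute)
qed

lemma e_p: assumes "w \<in> lists L" "A \<in> IW w" shows "e w A * p C = e w (inf A (fold \<theta> w C))"
  using arg_cong[OF p_e[OF assms, of C], of star] assms
  by (simp add: star_mult p_star projection_star e_projection IW_down[of A])

lemma e_e_prefix:
  assumes "v \<in> lists L" "w \<in> lists L" "A \<in> IW v" "B \<in> IW (v @ w)"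
  shows "e v A * e (v @ w) B = e (v @ w) (inf B (fold \<theta> w A))"
proof -
  let ?B = "inf B (fold \<theta> w A)"
  have B: "?B \<in> IW w" using assms by (intro IW_fold[of _ _ A]) auto
  have B': "?B \<in> IW (v @ w)" using assms by (intro IW_append[of _ _ A]) auto
  have "e v A * e (v @ w) B = S v A * (star (S v A) * S (v @ w) B) * star (S (v @ w) B)"
    by (simp add: e_def mult.assoc)
  also have "\<dots> = S v A * S w ?B * star (S (v @ w) B)" using assms by (simp add: star_S_S_prefix)
  also have "S v A * S w ?B = S (v @ w) ?B" using assms B by (simp add: S_append inf_assoc)
  also have "S (v @ w) ?B * star (S (v @ w) B) = e (v @ w) (inf ?B B)"
    using S_star_S[of "v @ w" "v @ w" ?B B] assms B' by (simp add: e_def)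
  finally show ?thesis by (simp add: inf_commute inf_left_commute)
qed

lemma e_e_prefix':
  assumes "v \<in> lists L" "w \<in> lists L" "A \<in> IW v" "B \<in> IW (v @ w)"
  shows "e (v @ w) B * e v A = e (v @ w) (inf B (fold \<theta> w A))"
  using arg_cong[OF e_e_prefix[OF assms], of star] assms
  by (simp add: star_mult projection_star e_projection IW_down[of B])

lemma e_e_incomparable:
  assumes "v \<in> lists L" "w \<in> lists L" "A \<in> IW v" "B \<in> IW w" "i < length v" "i < length w" "v ! i \<noteq> w ! i"
  shows "e v A * e w B = 0"
proof -
  have "e v A * e w B = S v A * (star (S v A) * S w B) * star (S w B)" by (simp add: e_def mult.assoc)
  then show ?thesis using star_S_S_incomparable[OF assms] by simp
qed

lemma e_commute:
  assumes "(v, A) \<in> ranges" "(w, B) \<in> ranges" shows "e v A * e w B = e w B * e v A"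
proof -
  consider u where "w = v @ u" | u where "v = w @ u" | i where "i < length v" "i < length w" "v ! i \<noteq> w ! i"
    using list_comparison[of w v] by blast
  then show ?thesis
  proof cases
    case 1 then show ?thesis using assms by (simp add: ranges_def e_e_prefix e_e_prefix')
  next
    case 2 then show ?thesis using assms by (simp add: ranges_def e_e_prefix e_e_prefix')
  next
    case 3 then show ?thesis
      using assms e_e_incomparable[of v w A B i] e_e_incomparable[of w v B A i] by (simp add: ranges_def)
  qed
qed

definition refines :: "'l list \<Rightarrow> 'b \<Rightarrow> 'l list \<Rightarrow> 'b \<Rightarrow> bool" where
  "refines w A v B \<longleftrightarrow> (\<exists>u\<in>lists L. w = v @ u \<and> A \<le> fold \<theta> u B)"

lemma refines_trans: "refines w A v B \<Longrightarrow> refines v B u C \<Longrightarrow> refines w A u C"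
  unfolding refines_def
proof (elim bexE conjE)
  fix x y assume "x \<in> lists L" "y \<in> lists L" "w = v @ x" "A \<le> fold \<theta> x B" "v = u @ y" "B \<le> fold \<theta> y C"
  then show "\<exists>z\<in>lists L. w = u @ z \<and> A \<le> fold \<theta> z C"
    using fold_mono[of x B "fold \<theta> y C"] by (intro bexI[of _ "y @ x"]) auto
qed

lemma refines_range: "(v, B) \<in> ranges \<Longrightarrow> refines w A v B \<Longrightarrow> (w, A) \<in> ranges"
  by (auto simp: refines_def ranges_def intro: IW_append)

lemma e_refines:
  assumes "(v, B) \<in> ranges" "refines w A v B" shows "e w A * e v B = e w A" "e v B * e w A = e w A"
proof -
  obtain u where u: "u \<in> lists L" "w = v @ u" "A \<le> fold \<theta> u B" using assms(2) by (auto simp: refines_def)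
  have "(w, A) \<in> ranges" by (rule refines_range[OF assms])
  then show "e w A * e v B = e w A" "e v B * e w A = e w A"
    using assms(1) u by (simp_all add: ranges_def e_e_prefix e_e_prefix' inf_absorb1)
qed

lemma e_Cons:
  assumes "\<alpha> \<in> L" "w \<in> lists L" "B \<in> \<I> \<alpha>" "A \<le> fold \<theta> w B"
  shows "e (\<alpha> # w) A = s \<alpha> B * e w A * star (s \<alpha> B)"
  using assms by (simp add: e_def S_Cons star_mult mult.assoc)

section \<open>Avoiding off-diagonal elements\<close>

definition avoidable :: "'a \<Rightarrow> 'l list \<Rightarrow> 'b \<Rightarrow> bool" where
  "avoidable v \<mu> B \<longleftrightarrow> (\<exists>\<nu> C. refines \<nu> C \<mu> B \<and> C \<noteq> bot \<and> e \<nu> C * v * e \<nu> C = 0)"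

lemma avoidable_star: assumes B: "(\<mu>, B) \<in> ranges" and v: "avoidable (star v) \<mu> B" shows "avoidable v \<mu> B"
proof -
  obtain \<nu> C where C: "refines \<nu> C \<mu> B" "C \<noteq> bot" "e \<nu> C * star v * e \<nu> C = 0"
    using v by (auto simp: avoidable_def)
  have "projection (e \<nu> C)" using refines_range[OF B C(1)] by (simp add: ranges_def e_projection)
  then have "e \<nu> C * v * e \<nu> C = star (e \<nu> C * star v * e \<nu> C)"
    by (simp add: star_mult star_star projection_star mult.assoc)
  then show ?thesis using C by (auto simp: avoidable_def)
qed

lemma avoidable_refines: "refines \<nu> C \<mu> B \<Longrightarrow> avoidable v \<nu> C \<Longrightarrow> avoidable v \<mu> B"
  using refines_trans by (fastforce simp: avoidable_def)

lemma avoidable_0: "B \<noteq> bot \<Longrightarrow> e \<mu> B * v * e \<mu> B = 0 \<Longrightarrow> avoidable v \<mu> B"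
  unfolding avoidable_def refines_def by (intro exI[of _ \<mu>] exI[of _ B]) auto

lemma avoid_S:
  assumes "\<delta> \<in> lists L" "\<rho> \<in> lists L" "A \<in> IW \<delta>" "C \<in> IW \<rho>"
    and "star (S \<rho> C) * S (\<delta> @ \<rho>) (inf C (fold \<theta> \<rho> A)) = 0"
  shows "e \<rho> C * S \<delta> A * e \<rho> C = 0"
proof -
  have "e \<rho> C * S \<delta> A * e \<rho> C = S \<rho> C * (star (S \<rho> C) * (S \<delta> A * S \<rho> C)) * star (S \<rho> C)"
    by (simp add: e_def mult.assoc)
  then show ?thesis using assms by (simp add: S_append)
qed

text \<open>Here Condition (L) produces small projections. Either some \<open>C \<le> B\<close> is moved by \<open>\<delta>\<close>, and then
  \<open>C - \<theta>\<^sub>\<delta> C\<close> or the range of \<open>S \<delta> (\<theta>\<^sub>\<delta> C - C)\<close> is disjoint from its image; or \<open>(\<delta>, B)\<close> is a cycle, and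
  the range of a path that follows \<open>\<delta>\<close> to an exit and leaves \<open>\<delta>\<close> or ends there is disjoint from its
  image.\<close>

lemma avoidable_word_at_vertex:
  assumes L: "condition_L L \<theta>" and \<delta>: "\<delta> \<in> lists L" "\<delta> \<noteq> []" and A: "A \<in> IW \<delta>" and B: "B \<noteq> bot"
  shows "avoidable (S \<delta> A) [] B"
proof (cases "\<forall>C\<le>B. fold \<theta> \<delta> C = C")
  case False
  then obtain C where C: "C \<le> B" "fold \<theta> \<delta> C \<noteq> C" by blast
  let ?D = "fold \<theta> \<delta> C"
  consider "C - ?D \<noteq> bot" | "?D - C \<noteq> bot"
    using C(2) antisym[OF diff_eq_bot_imp_le[of C ?D] diff_eq_bot_imp_le[of ?D C]] by metis
  then show ?thesis
  proof cases
    case 1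
    have D: "inf (C - ?D) (fold \<theta> \<delta> (C - ?D)) = bot"
    proof -
      have "fold \<theta> \<delta> (C - ?D) \<le> ?D" using \<delta> by (intro fold_mono diff_le)
      then have "inf (C - ?D) (fold \<theta> \<delta> (C - ?D)) \<le> inf (C - ?D) ?D" by (intro inf_mono) auto
      then show ?thesis by (simp add: inf_diff_bot bot_unique)
    qed
    have "e [] (C - ?D) * S \<delta> A * e [] (C - ?D) = 0"
      using D \<delta> A by (intro avoid_S)
        (simp_all add: p_star p_S IW_down[of A] S_bot inf_assoc inf_left_commute inf_bot)
    moreover have "refines [] (C - ?D) [] B"
      using C(1) order_trans[OF diff_le] by (simp add: refines_def)
    ultimately show ?thesis using 1 by (auto simp: avoidable_def)
  next
    case 2
    let ?E = "?D - C"
    have E: "?E \<in> IW \<delta>" using \<delta> diff_le by (intro IW_fold[of _ _ C])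
    have D: "inf ?E (fold \<theta> \<delta> ?E) = bot"
    proof -
      have "inf ?E (fold \<theta> \<delta> ?E) \<le> inf ?D (fold \<theta> \<delta> ?D - ?D)"
        using \<delta> by (intro inf_mono) (simp_all add: diff_le fold_diff)
      also have "\<dots> = bot" using inf_diff_bot[of "fold \<theta> \<delta> ?D" ?D] by (simp only: inf_commute)
      finally show ?thesis by (simp only: bot_unique)
    qed
    have "e \<delta> ?E * S \<delta> A * e \<delta> ?E = 0"
    proof (rule avoid_S)
      let ?X = "inf ?E (fold \<theta> \<delta> A)"
      have "?X \<in> IW (\<delta> @ \<delta>)" using \<delta> A by (intro IW_append[of _ _ A]) auto
      moreover have "inf ?X (fold \<theta> \<delta> ?E) = inf (inf ?E (fold \<theta> \<delta> ?E)) (fold \<theta> \<delta> A)"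
        by (simp add: inf_assoc inf_commute inf_left_commute)
      ultimately show "star (S \<delta> ?E) * S (\<delta> @ \<delta>) ?X = 0"
        using \<delta> E D by (simp add: star_S_S_prefix S_bot inf_bot)
    qed (use \<delta> A E in auto)
    moreover have "refines \<delta> ?E [] B"
      using \<delta> C(1) order_trans[OF diff_le fold_mono] by (auto simp: refines_def)
    ultimately show ?thesis using 2 by (auto simp: avoidable_def)
  qed
next
  case True
  let ?n = "length \<delta>"
  have "cycle L \<theta> \<delta> B" using True \<delta> B by (simp add: cycle_def)
  moreover have "\<not> cycle_no_exits L \<theta> \<delta> B" using L by (auto simp: condition_L_def)
  ultimately have "\<exists>t\<in>{1..?n}. \<exists>C. C \<noteq> bot \<and> C \<le> fold \<theta> (take t \<delta>) B \<and>
      \<not> (C \<in> regular_elements L \<theta> \<and> Delta L \<theta> C = {\<delta> ! (t mod ?n)})"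
    unfolding cycle_no_exits_def by blast
  then obtain t C where t: "1 \<le> t" "t \<le> ?n" and C: "C \<noteq> bot" "C \<le> fold \<theta> (take t \<delta>) B"
    and bad: "\<not> (C \<in> regular_elements L \<theta> \<and> Delta L \<theta> C = {\<delta> ! (t mod ?n)})"
    by (elim bexE exE conjE) (simp only: atLeastAtMost_iff, elim conjE, rule that)
  let ?c = "\<delta> ! (t mod ?n)"
  obtain C' where C': "C' \<noteq> bot" "C' \<le> C" "Delta L \<theta> C' \<noteq> {?c}"
  proof (cases "C \<in> regular_elements L \<theta>")
    case True
    then show ?thesis using bad C that[of C] by auto
  next
    case False
    then obtain C' where "C' \<noteq> bot" "C' \<le> C" "\<not> (finite (Delta L \<theta> C') \<and> Delta L \<theta> C' \<noteq> {})"
      by (auto simp: regular_elements_def)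
    then show ?thesis using that[of C'] by (metis finite.emptyI finite_insert insert_not_empty)
  qed
  define \<rho> where "\<rho> = take t \<delta>"
  have \<rho>: "\<rho> \<in> lists L" "length \<rho> = t" using \<delta> t by (auto simp: \<rho>_def dest: in_set_takeD)
  have C'B: "C' \<le> fold \<theta> \<rho> B" using C' C by (auto simp: \<rho>_def)
  have "?c \<in> L" using \<delta> t by (metis in_lists_conv_set length_greater_0_conv mod_less_divisor nth_mem)
  consider a where "a \<in> Delta L \<theta> C'" "a \<noteq> ?c" | "?c \<notin> Delta L \<theta> C'" using C'(3) by blast
  then show ?thesis
  proof cases
    case 1
    let ?\<rho> = "\<rho> @ [a]"
    have a: "a \<in> L" "\<theta> a C' \<noteq> bot" using 1 by (auto simp: Delta_def)
    have r: "refines ?\<rho> (\<theta> a C') [] B"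
      using \<rho> a \<theta>_mono[OF a(1) C'B] by (auto simp: refines_def)
    then have R: "\<theta> a C' \<in> IW ?\<rho>" using refines_range[of "[]" B] by (auto simp: ranges_def)
    have nth: "(\<delta> @ ?\<rho>) ! t = ?c"
    proof (cases "t = ?n")
      case True
      then show ?thesis using \<delta> t by (simp add: nth_append \<rho>_def)
    next
      case False
      then show ?thesis using t by (simp add: nth_append)
    qed
    have "e ?\<rho> (\<theta> a C') * S \<delta> A * e ?\<rho> (\<theta> a C') = 0"
    proof (rule avoid_S)
      show "star (S ?\<rho> (\<theta> a C')) * S (\<delta> @ ?\<rho>) (inf (\<theta> a C') (fold \<theta> ?\<rho> A)) = 0"
      proof (rule star_S_S_incomparable[of _ _ _ _ t])
        show "inf (\<theta> a C') (fold \<theta> ?\<rho> A) \<in> IW (\<delta> @ ?\<rho>)"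
          using \<delta> \<rho> a A by (intro IW_append[of _ _ A]) auto
        show "?\<rho> ! t \<noteq> (\<delta> @ ?\<rho>) ! t" unfolding nth using 1(2) \<rho>(2) by (simp add: nth_append)
      qed (use \<delta> \<rho> a R t in auto)
    qed (use \<delta> \<rho> a A R in auto)
    then show ?thesis using r a by (auto simp: avoidable_def)
  next
    case 2
    let ?\<tau> = "drop t \<delta> @ take t \<delta>"
    have comm: "\<delta> @ \<rho> = \<rho> @ ?\<tau>" by (simp add: \<rho>_def)
    have \<tau>: "?\<tau> \<in> lists L" using \<delta> by (auto dest: in_set_takeD in_set_dropD)
    obtain \<tau>' where \<tau>': "?\<tau> = ?c # \<tau>'"
    proof (cases "t = ?n")
      case True
      then show ?thesis using \<delta> that by (cases \<delta>) auto
    next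
      case False
      then have "drop t \<delta> = \<delta> ! t # drop (Suc t) \<delta>" using t by (simp add: Cons_nth_drop_Suc)
      then show ?thesis using False t that by simp
    qed
    have r: "refines \<rho> C' [] B" using \<rho> C'B by (auto simp: refines_def)
    then have R: "C' \<in> IW \<rho>" using refines_range[of "[]" B] by (auto simp: ranges_def)
    have "fold \<theta> ?\<tau> C' = fold \<theta> \<tau>' (\<theta> ?c C')" unfolding \<tau>' by simp
    also have "\<theta> ?c C' = bot" using 2 \<open>?c \<in> L\<close> by (simp add: Delta_def)
    finally have kill: "fold \<theta> ?\<tau> C' = bot" using \<tau> unfolding \<tau>' by (simp add: fold_bot)
    have "e \<rho> C' * S \<delta> A * e \<rho> C' = 0"
    proof (rule avoid_S)
      let ?X = "inf C' (fold \<theta> \<rho> A)"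
      have "?X \<in> IW (\<rho> @ ?\<tau>)"
        unfolding comm[symmetric] using \<delta> \<rho> A by (intro IW_append[of _ _ A]) auto
      then have "star (S \<rho> C') * S (\<rho> @ ?\<tau>) ?X = S ?\<tau> (inf ?X (fold \<theta> ?\<tau> C'))"
        by (rule star_S_S_prefix[OF \<rho>(1) \<tau> R])
      also have "\<dots> = 0" unfolding kill using \<tau> by (simp add: inf_bot S_bot)
      finally show "star (S \<rho> C') * S (\<delta> @ \<rho>) ?X = 0" unfolding comm .
    qed (use \<delta> \<rho> A R in auto)
    then show ?thesis using r C' by (auto simp: avoidable_def)
  qed
qed

end

context gbds_relations
begin

lemma S_singleton: "\<alpha> \<in> L \<Longrightarrow> B \<in> \<I> \<alpha> \<Longrightarrow> S [\<alpha>] B = s \<alpha> B"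
  using S_Cons[of \<alpha> "[]" B B] by (simp add: s_p)

lemma s_star_s: "\<alpha> \<in> L \<Longrightarrow> B \<in> \<I> \<alpha> \<Longrightarrow> star (s \<alpha> B) * s \<alpha> B = p B"
  by (simp add: star_s_s)

lemma refines_Cons: "\<alpha> \<in> L \<Longrightarrow> refines \<nu> C \<mu> B \<Longrightarrow> refines (\<alpha> # \<nu>) C (\<alpha> # \<mu>) B"
  by (auto simp: refines_def)

lemma refines_le_fold: "refines \<nu> C \<mu> B \<Longrightarrow> \<mu> \<in> lists L \<Longrightarrow> B \<le> fold \<theta> \<mu> D \<Longrightarrow> \<nu> \<in> lists L \<and> C \<le> fold \<theta> \<nu> D"
proof -
  assume "refines \<nu> C \<mu> B" "\<mu> \<in> lists L" "B \<le> fold \<theta> \<mu> D"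
  then obtain u where u: "u \<in> lists L" "\<nu> = \<mu> @ u" "C \<le> fold \<theta> u B" by (auto simp: refines_def)
  have "fold \<theta> u B \<le> fold \<theta> u (fold \<theta> \<mu> D)" by (rule fold_mono[OF u(1)]) fact
  then show ?thesis using u \<open>\<mu> \<in> lists L\<close> order_trans by auto
qed

text \<open>If \<open>\<mu>\<close> and \<open>\<delta>\<close> start with the same letter \<open>c\<close>, compression by \<open>s c D\<close> strips it from \<open>\<mu>\<close> and rotates
  \<open>\<delta>\<close>, so induction on \<open>\<mu>\<close> reduces to the empty word.\<close>

lemma avoidable_word:
  assumes L: "condition_L L \<theta>"
  shows "\<mu> \<in> lists L \<Longrightarrow> B \<in> IW \<mu> \<Longrightarrow> B \<noteq> bot \<Longrightarrow> \<delta> \<in> lists L \<Longrightarrow> \<delta> \<noteq> [] \<Longrightarrow> A \<in> IW \<delta> \<Longrightarrow>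
    avoidable (S \<delta> A) \<mu> B"
proof (induction \<mu> arbitrary: \<delta> A B)
  case Nil
  then show ?case using avoidable_word_at_vertex[OF L] by simp
next
  case (Cons m \<mu>)
  obtain c \<delta>' where \<delta>: "\<delta> = c # \<delta>'" using Cons.prems by (cases \<delta>) auto
  have mem: "m \<in> L" "\<mu> \<in> lists L" "c \<in> L" "\<delta>' \<in> lists L" using Cons.prems \<delta> by auto
  show ?case
  proof (cases "m = c")
    case False
    have "star (S (m # \<mu>) B) * S \<delta> A = 0"
      using Cons.prems False \<delta> by (intro star_S_S_incomparable[of _ _ _ _ 0]) auto
    then have "e (m # \<mu>) B * S \<delta> A = 0" by (simp add: e_def mult.assoc)
    then show ?thesis using Cons.prems by (intro avoidable_0) auto
  next
    case True
    have B: "B \<in> IW (c # \<mu>)" and A: "A \<in> IW (c # \<delta>')" using Cons.prems True \<delta> by auto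
    obtain D where D: "D \<in> \<I> c" "B \<le> fold \<theta> \<mu> D" "A \<le> fold \<theta> \<delta>' D" "\<theta> c B \<le> D"
      by (rule obtain_admissible[OF mem(3,2,4) B A \<theta>_ideal[OF mem(3)]])
    let ?\<delta> = "\<delta>' @ [c]" and ?A = "inf D (\<theta> c A)"
    have A': "A \<in> IW \<delta>'" by (rule IW_tail[OF mem(3,4) A])
    have "avoidable (S ?\<delta> ?A) \<mu> B"
    proof (rule Cons.IH)
      show "?A \<in> IW ?\<delta>" using mem A' by (intro IW_append[of _ _ A]) auto
      show "B \<in> IW \<mu>" by (rule IW_tail[OF mem(3,2) B])
    qed (use mem Cons.prems in auto)
    then obtain \<nu> C where C: "refines \<nu> C \<mu> B" "C \<noteq> bot" "e \<nu> C * S ?\<delta> ?A * e \<nu> C = 0"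
      by (auto simp: avoidable_def)
    have \<nu>: "\<nu> \<in> lists L" "C \<le> fold \<theta> \<nu> D" using refines_le_fold[OF C(1) mem(2) D(2)] by auto
    have "S \<delta>' A * s c D = S ?\<delta> ?A"
      using S_append[of \<delta>' "[c]" A D] A' mem D bexI[of "\<lambda>B. D \<le> B" D "\<I> c"] by (simp add: S_singleton)
    moreover have "e (c # \<nu>) C * S \<delta> A * e (c # \<nu>) C
        = s c D * e \<nu> C * ((star (s c D) * s c D) * S \<delta>' A) * s c D * e \<nu> C * star (s c D)"
      using mem \<nu> D \<delta> by (simp add: e_Cons S_Cons mult.assoc)
    ultimately have "e (c # \<nu>) C * S \<delta> A * e (c # \<nu>) C = s c D * (e \<nu> C * S ?\<delta> ?A * e \<nu> C) * star (s c D)"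
      using mem D by (simp add: s_star_s p_S_absorb mult.assoc)
    then have "e (c # \<nu>) C * S \<delta> A * e (c # \<nu>) C = 0" using C(3) by simp
    then show ?thesis using refines_Cons[OF mem(3) C(1)] C(2) True by (auto simp: avoidable_def)
  qed
qed

text \<open>A first letter common to \<open>\<alpha>\<close>, \<open>\<beta>\<close> and \<open>\<mu>\<close> can be stripped; when \<open>\<alpha>\<close> or \<open>\<beta>\<close> is used up, what remains is
  \<open>S \<delta> A\<close> or its adjoint for a nonempty word \<open>\<delta>\<close>, because the lengths differ.\<close>

lemma avoidable_monomial:
  assumes L: "condition_L L \<theta>"
  shows "\<alpha> \<in> lists L \<Longrightarrow> \<beta> \<in> lists L \<Longrightarrow> A \<in> IW \<alpha> \<Longrightarrow> A \<in> IW \<beta> \<Longrightarrow> length \<alpha> \<noteq> length \<beta> \<Longrightarrow>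
    (\<mu>, B) \<in> ranges \<Longrightarrow> B \<noteq> bot \<Longrightarrow> avoidable (S \<alpha> A * star (S \<beta> A)) \<mu> B"
proof (induction \<alpha> arbitrary: \<beta> \<mu> B)
  case Nil
  have eq: "S [] A * star (S \<beta> A) = star (S \<beta> A)"
    using Nil.prems arg_cong[OF S_p[of \<beta> A A], of star] by (simp add: star_mult p_star)
  have "avoidable (S \<beta> A) \<mu> B"
    by (rule avoidable_word[OF L]) (use Nil.prems in \<open>auto simp: ranges_def\<close>)
  then have "avoidable (star (star (S \<beta> A))) \<mu> B" by (simp only: star_star)
  then show ?case unfolding eq by (rule avoidable_star[OF Nil.prems(6)])
next
  case (Cons a \<alpha>)
  have a: "a \<in> L" "\<alpha> \<in> lists L" using Cons.prems by auto
  show ?case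
  proof (cases \<beta>)
    case Nil
    have "S (a # \<alpha>) A * star (S \<beta> A) = S (a # \<alpha>) A" using Nil
      using S_p[OF Cons.prems(1,3), of A] by (simp add: p_star)
    moreover have "avoidable (S (a # \<alpha>) A) \<mu> B"
      by (rule avoidable_word[OF L]) (use Cons.prems in \<open>auto simp: ranges_def\<close>)
    ultimately show ?thesis by (simp only:)
  next
    case \<beta>: (Cons b \<beta>')
    let ?v = "S (a # \<alpha>) A * star (S \<beta> A)"
    have b: "b \<in> L" "\<beta>' \<in> lists L" using Cons.prems \<beta> by auto
    have nonempty: "avoidable ?v (m # \<mu>) B" if \<mu>: "(m # \<mu>, B) \<in> ranges" "B \<noteq> bot" for m \<mu> B
    proof -
      have m: "m \<in> L" "\<mu> \<in> lists L" "B \<in> IW (m # \<mu>)" using \<mu> by (auto simp: ranges_def)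
      consider "m \<noteq> a" | "m \<noteq> b" | "m = a" "m = b" by blast
      then show ?thesis
      proof cases
        case 1
        have "star (S (m # \<mu>) B) * S (a # \<alpha>) A = 0"
          using m a Cons.prems 1 by (intro star_S_S_incomparable[of _ _ _ _ 0]) auto
        then have "e (m # \<mu>) B * ?v = 0" by (simp add: e_def mult.assoc) (simp flip: mult.assoc)
        then show ?thesis using \<mu> by (intro avoidable_0) auto
      next
        case 2
        have "star (S \<beta> A) * S (m # \<mu>) B = 0"
          using m b Cons.prems \<beta> 2 by (intro star_S_S_incomparable[of _ _ _ _ 0]) auto
        then have "?v * e (m # \<mu>) B = 0" by (simp add: e_def mult.assoc) (simp flip: mult.assoc)
        then show ?thesis using \<mu> by (intro avoidable_0) (simp_all add: mult.assoc)
      next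
        case 3
        obtain D' where D': "D' \<in> \<I> a" "B \<le> fold \<theta> \<mu> D'" using m 3 by auto
        have A: "A \<in> IW (a # \<alpha>)" "A \<in> IW (a # \<beta>')" using Cons.prems \<beta> 3 by auto
        have b': "\<beta>' \<in> lists L" by (rule b)
        obtain D where D: "D \<in> \<I> a" "A \<le> fold \<theta> \<alpha> D" "A \<le> fold \<theta> \<beta>' D" "D' \<le> D"
          by (rule obtain_admissible[OF a b' A D'(1)])
        have BD: "B \<le> fold \<theta> \<mu> D" using D'(2) fold_mono[OF m(2) D(4)] by (rule order_trans)
        have "avoidable (S \<alpha> A * star (S \<beta>' A)) \<mu> B"
        proof (rule Cons.IH)
          show "A \<in> IW \<alpha>" "A \<in> IW \<beta>'" using IW_tail[OF a A(1)] IW_tail[OF a(1) b' A(2)] .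
          show "(\<mu>, B) \<in> ranges" using m IW_tail[OF m] by (simp add: ranges_def)
        qed (use a b' Cons.prems \<beta> \<mu> in auto)
        then obtain \<nu> C where C: "refines \<nu> C \<mu> B" "C \<noteq> bot" "e \<nu> C * (S \<alpha> A * star (S \<beta>' A)) * e \<nu> C = 0"
          by (auto simp: avoidable_def)
        have \<nu>: "\<nu> \<in> lists L" "C \<le> fold \<theta> \<nu> D" using refines_le_fold[OF C(1) m(2) BD] by auto
        have p1: "(star (s a D) * s a D) * S \<alpha> A = S \<alpha> A" using a D by (simp add: s_star_s p_S_absorb)
        have "star ((star (s a D) * s a D) * S \<beta>' A) = star (S \<beta>' A)"
          using a(1) b' D by (simp add: s_star_s p_S_absorb)
        then have p2: "star (S \<beta>' A) * (star (s a D) * s a D) = star (S \<beta>' A)" by (simp add: star_mult star_star)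
        have "e (a # \<nu>) C * ?v * e (a # \<nu>) C
          = s a D * e \<nu> C * ((star (s a D) * s a D) * S \<alpha> A) * (star (S \<beta>' A) * (star (s a D) * s a D)) * e \<nu> C * star (s a D)"
          using a b b' \<nu> D \<beta> 3 by (simp add: e_Cons S_Cons star_mult mult.assoc)
        also have "\<dots> = s a D * (e \<nu> C * (S \<alpha> A * star (S \<beta>' A)) * e \<nu> C) * star (s a D)"
          unfolding p1 p2 by (simp add: mult.assoc)
        finally have "e (a # \<nu>) C * ?v * e (a # \<nu>) C = 0" using C(3) by simp
        then show ?thesis using refines_Cons[OF a(1) C(1)] C(2) 3 by (auto simp: avoidable_def)
      qed
    qed
    show ?thesis
    proof (cases \<mu>)
      case (Cons m \<mu>')
      then show ?thesis using nonempty Cons.prems by simp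
    next
      case Nil
      show ?thesis
      proof (cases "\<theta> a B = bot")
        case True
        have "p B * S (a # \<alpha>) A = 0"
          using Cons.prems a True by (simp add: p_S fold_bot inf_bot S_bot)
        then have "e \<mu> B * ?v = 0" using Nil by (simp add: e_Nil flip: mult.assoc)
        then show ?thesis using Cons.prems by (intro avoidable_0) auto
      next
        case False
        have r: "refines [a] (\<theta> a B) \<mu> B" using a Nil by (simp add: refines_def)
        then have "avoidable ?v [a] (\<theta> a B)"
          using Cons.prems False by (intro nonempty refines_range[OF _ r]) auto
        then show ?thesis by (rule avoidable_refines[OF r])
      qed
    qed
  qed
qed

section \<open>Atoms of finite families of range projections\<close>

text \<open>Each projection indexed by \<open>J\<close> acts on \<open>r\<close> as 1 or as 0. A nonzero such \<open>r\<close> marks an atom of the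
  Boolean algebra that these projections generate, and \<open>same_atom\<close> says that \<open>q\<close> lies below this atom.\<close>

definition separates :: "('l list \<times> 'b) set \<Rightarrow> 'a \<Rightarrow> bool" where
  "separates J r \<longleftrightarrow> J \<subseteq> ranges \<and> (\<forall>(\<nu>, A)\<in>J. e \<nu> A * r = r \<or> e \<nu> A * r = 0)"

definition same_atom :: "('l list \<times> 'b) set \<Rightarrow> 'a \<Rightarrow> 'a \<Rightarrow> bool" where
  "same_atom J r q \<longleftrightarrow> (\<forall>(\<nu>, A)\<in>J. (e \<nu> A * r = r \<longrightarrow> q * e \<nu> A = q) \<and> (e \<nu> A * r = 0 \<longrightarrow> q * e \<nu> A = 0))"

lemma star_s_e:
  assumes "\<alpha> \<in> L" "w \<in> lists L" "A \<in> IW (\<alpha> # w)" "D \<in> \<I> \<alpha>"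
  shows "star (s \<alpha> D) * e (\<alpha> # w) A = e w A * star (s \<alpha> D)"
proof -
  obtain B where B: "B \<in> \<I> \<alpha>" "A \<le> fold \<theta> w B" "A \<le> fold \<theta> w B" "D \<le> B"
    by (rule obtain_admissible[OF assms(1,2,2,3,3,4)])
  have A: "A \<in> IW w" by (rule IW_tail[OF assms(1-3)])
  have "star (s \<alpha> D) * e (\<alpha> # w) A = (star (s \<alpha> D) * s \<alpha> B) * e w A * star (s \<alpha> B)"
    using assms B by (simp add: e_Cons mult.assoc)
  also have "star (s \<alpha> D) * s \<alpha> B = p D" using assms B by (simp add: star_s_s inf_absorb1)
  also have "p D * e w A = e w A * p D" using assms(2) A by (simp add: p_e e_p)
  also have "e w A * p D * star (s \<alpha> B) = e w A * star (s \<alpha> B * p D)"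
    by (simp add: star_mult p_star mult.assoc)
  also have "s \<alpha> B * p D = s \<alpha> D" using assms B by (simp add: s_p inf_absorb2)
  finally show ?thesis .
qed

lemma star_s_p: "\<alpha> \<in> L \<Longrightarrow> D \<in> \<I> \<alpha> \<Longrightarrow> star (s \<alpha> D) * p A = p (\<theta> \<alpha> A) * star (s \<alpha> D)"
  using arg_cong[OF p_s[of \<alpha> D A], of star] by (simp add: star_mult p_star)

text \<open>What becomes of the projections indexed by \<open>J\<close> after compression by \<open>s \<alpha> D\<close>: words that start with \<open>\<alpha>\<close>
  lose this letter, sets are moved by \<open>\<theta>\<^sub>\<alpha>\<close>, and all other words disappear.\<close>

definition descend :: "'l \<Rightarrow> ('l list \<times> 'b) set \<Rightarrow> ('l list \<times> 'b) set" where
  "descend \<alpha> J = {(w, A). (\<alpha> # w, A) \<in> J} \<union> (\<lambda>A. ([], \<theta> \<alpha> A)) ` {A. ([], A) \<in> J}"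

lemma finite_descend: assumes "finite J" shows "finite (descend \<alpha> J)"
proof -
  have "{(w, A). (\<alpha> # w, A) \<in> J} \<subseteq> (\<lambda>(w, A). (tl w, A)) ` J" by force
  then have "finite {(w, A). (\<alpha> # w, A) \<in> J}" by (rule finite_subset) (simp add: assms)
  moreover have "{A. ([], A) \<in> J} \<subseteq> snd ` J" by force
  then have "finite {A. ([], A) \<in> J}" by (rule finite_subset) (simp add: assms)
  ultimately show ?thesis unfolding descend_def by simp
qed

lemma separates_descend:
  assumes J: "separates J r" and \<alpha>: "\<alpha> \<in> L" "D \<in> \<I> \<alpha>"
  shows "separates (descend \<alpha> J) (star (s \<alpha> D) * r)"
proof -
  have "(w, A) \<in> ranges \<and> (e w A * (star (s \<alpha> D) * r) = star (s \<alpha> D) * r \<or> e w A * (star (s \<alpha> D) * r) = 0)"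
    if "(\<alpha> # w, A) \<in> J" for w A
  proof -
    have r: "(\<alpha> # w, A) \<in> ranges" "e (\<alpha> # w) A * r = r \<or> e (\<alpha> # w) A * r = 0"
      using J that by (auto simp: separates_def)
    then have w: "w \<in> lists L" "A \<in> IW (\<alpha> # w)" by (auto simp: ranges_def)
    have "e w A * (star (s \<alpha> D) * r) = star (s \<alpha> D) * (e (\<alpha> # w) A * r)"
      using star_s_e[OF \<alpha>(1) w \<alpha>(2)] by (simp flip: mult.assoc)
    then show ?thesis using r(2) w IW_tail[OF \<alpha>(1) w] by (auto simp: ranges_def)
  qed
  moreover have "p (\<theta> \<alpha> A) * (star (s \<alpha> D) * r) = star (s \<alpha> D) * (p A * r)" for A
    using star_s_p[OF \<alpha>] by (simp flip: mult.assoc)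
  moreover have "p A * r = r \<or> p A * r = 0" if "([], A) \<in> J" for A
    using J that by (auto simp: separates_def e_Nil)
  ultimately show ?thesis by (fastforce simp: separates_def descend_def e_Nil ranges_def)
qed

lemma same_atom_ascend:
  assumes J: "separates J r" and \<alpha>: "\<alpha> \<in> L" "D \<in> \<I> \<alpha>"
    and nz: "star (s \<alpha> D) * r \<noteq> 0" and \<kappa>: "\<kappa> \<in> lists L" "B \<le> fold \<theta> \<kappa> D"
    and atom: "same_atom (descend \<alpha> J) (star (s \<alpha> D) * r) (e \<kappa> B)"
  shows "same_atom J r (e (\<alpha> # \<kappa>) B)"
proof -
  have B: "B \<in> IW (\<alpha> # \<kappa>)" "B \<in> IW \<kappa>" using \<kappa> \<alpha> by (auto intro: IW_fold)
  have B': "\<alpha> # \<kappa> \<in> lists L" using \<kappa> \<alpha> by simp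
  have *: "(e \<nu> A * r = r \<longrightarrow> e (\<alpha> # \<kappa>) B * e \<nu> A = e (\<alpha> # \<kappa>) B) \<and> (e \<nu> A * r = 0 \<longrightarrow> e (\<alpha> # \<kappa>) B * e \<nu> A = 0)"
    if "(\<nu>, A) \<in> J" for \<nu> A
  proof (cases \<nu>)
    case Nil
    then have "([], \<theta> \<alpha> A) \<in> descend \<alpha> J" using that by (auto simp: descend_def)
    then have at: "p (\<theta> \<alpha> A) * (star (s \<alpha> D) * r) = star (s \<alpha> D) * r \<longrightarrow> e \<kappa> B * p (\<theta> \<alpha> A) = e \<kappa> B"
      "p (\<theta> \<alpha> A) * (star (s \<alpha> D) * r) = 0 \<longrightarrow> e \<kappa> B * p (\<theta> \<alpha> A) = 0"
      using atom by (auto simp: same_atom_def e_Nil)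
    have "p (\<theta> \<alpha> A) * (star (s \<alpha> D) * r) = star (s \<alpha> D) * (p A * r)"
      using star_s_p[OF \<alpha>] by (simp flip: mult.assoc)
    moreover have "e (\<alpha> # \<kappa>) B * p A = s \<alpha> D * (e \<kappa> B * p (\<theta> \<alpha> A)) * star (s \<alpha> D)"
      using \<alpha> \<kappa> by (simp add: e_Cons star_s_p mult.assoc)
    ultimately show ?thesis using at Nil \<alpha> \<kappa> by (auto simp: e_Nil e_Cons)
  next
    case (Cons \<beta> w)
    have \<nu>: "\<beta> \<in> L" "w \<in> lists L" "A \<in> IW (\<beta> # w)" "e \<nu> A * r = r \<or> e \<nu> A * r = 0"
      using J that Cons by (auto simp: separates_def ranges_def)
    show ?thesis
    proof (cases "\<beta> = \<alpha>")
      case True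
      note [simp] = True
      have "(w, A) \<in> descend \<alpha> J" using that Cons by (auto simp: descend_def)
      then have at: "e w A * (star (s \<alpha> D) * r) = star (s \<alpha> D) * r \<longrightarrow> e \<kappa> B * e w A = e \<kappa> B"
        "e w A * (star (s \<alpha> D) * r) = 0 \<longrightarrow> e \<kappa> B * e w A = 0"
        using atom by (auto simp: same_atom_def)
      have ss: "star (s \<alpha> D) * e \<nu> A = e w A * star (s \<alpha> D)" using star_s_e[of \<alpha> w A D] \<nu> \<alpha> Cons by simp
      have "e w A * (star (s \<alpha> D) * r) = star (s \<alpha> D) * (e \<nu> A * r)"
        using ss by (simp flip: mult.assoc)
      moreover have "e (\<alpha> # \<kappa>) B * e \<nu> A = s \<alpha> D * (e \<kappa> B * e w A) * star (s \<alpha> D)"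
        using \<alpha> \<kappa> ss by (simp add: e_Cons mult.assoc)
      ultimately show ?thesis using at \<alpha> \<kappa> by (auto simp: e_Cons)
    next
      case False
      have "star (s \<alpha> D) * S \<nu> A = 0"
      proof -
        obtain C where "C \<in> \<I> \<beta>" "A \<le> fold \<theta> w C" using \<nu> by auto
        then have "star (s \<alpha> D) * S \<nu> A = (star (s \<alpha> D) * s \<beta> C) * S w A"
          using \<nu> Cons by (simp add: S_Cons mult.assoc)
        then show ?thesis using \<open>C \<in> \<I> \<beta>\<close> False \<nu> \<alpha> by (simp add: star_s_s)
      qed
      then have 0: "star (s \<alpha> D) * e \<nu> A = 0" by (simp add: e_def flip: mult.assoc)
      then have "star (s \<alpha> D) * (e \<nu> A * r) = 0" by (simp flip: mult.assoc)
      then have "e \<nu> A * r \<noteq> r" using nz by auto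
      moreover have "e (\<alpha> # \<kappa>) B * e \<nu> A = 0"
        using \<alpha> \<kappa> 0 by (simp add: e_Cons mult.assoc)
      ultimately show ?thesis by simp
    qed
  qed
  then show ?thesis by (auto simp: same_atom_def)
qed

lemma separating_vertex_set:
  assumes "finite K" "\<And>A. A \<in> K \<Longrightarrow> p A * r = r \<or> p A * r = 0" "p C * r = r"
  shows "\<exists>C'\<le>C. p C' * r = r \<and> (\<forall>A\<in>K. (p A * r = r \<longrightarrow> C' \<le> A) \<and> (p A * r = 0 \<longrightarrow> inf C' A = bot))"
  using assms
proof (induction K)
  case (insert A K)
  then obtain C' where C': "C' \<le> C" "p C' * r = r"
    "\<forall>A\<in>K. (p A * r = r \<longrightarrow> C' \<le> A) \<and> (p A * r = 0 \<longrightarrow> inf C' A = bot)" by auto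
  show ?case
  proof (cases "r = 0")
    case True
    then show ?thesis by (intro exI[of _ bot]) (simp add: inf_bot)
  next
    case False
    have smaller: ?thesis if D: "D \<le> C'" "p D * r = r" "p A * r = r \<longrightarrow> D \<le> A" "p A * r = 0 \<longrightarrow> inf D A = bot" for D
    proof -
      have "inf D A' = bot" if "inf C' A' = bot" for A'
        using that inf_mono[OF D(1) order_refl, of A'] by (simp add: bot_unique)
      then show ?thesis using D C' order_trans[OF D(1)] by (intro exI[of _ D]) auto
    qed
    consider "p A * r = r" | "p A * r = 0" using insert.prems by auto
    then show ?thesis
    proof cases
      case 1
      show ?thesis
        using 1 False C' by (intro smaller[of "inf C' A"]) (auto simp: p_inf mult.assoc)
    next
      case 2
      have "p C' = p (C' - A) + p (inf C' A)"
        using p_sup[of "C' - A" "inf C' A"] sup_diff_inf[of C' A] inf_diff_bot[of C' A]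
        by (simp add: inf_left_commute inf_bot p_bot)
      from arg_cong[OF this, of "\<lambda>x. x * r"] have "p (C' - A) * r = r"
        using C'(2) 2 by (simp add: p_inf distrib_right mult.assoc)
      then show ?thesis
        using 2 False by (intro smaller[of "C' - A"]) (auto simp: diff_le inf_diff_bot)
    qed
  qed
qed (auto intro: exI[of _ C])

lemma separating_vertex_set_of:
  assumes "finite J" "separates J r" "p C * r = r"
  shows "\<exists>C'\<le>C. p C' * r = r \<and>
    (\<forall>A. ([], A) \<in> J \<longrightarrow> (p A * r = r \<longrightarrow> C' \<le> A) \<and> (p A * r = 0 \<longrightarrow> inf C' A = bot))"
proof -
  have "finite {A. ([], A) \<in> J}" by (rule finite_subset[of _ "snd ` J"]) (use assms(1) in force)+
  moreover have "p A * r = r \<or> p A * r = 0" if "A \<in> {A. ([], A) \<in> J}" for A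
    using assms(2) that by (auto simp: separates_def e_Nil)
  ultimately show ?thesis using separating_vertex_set[of "{A. ([], A) \<in> J}" r C] assms(3) by simp
qed

text \<open>Shrink \<open>C\<close> until the empty words in \<open>J\<close> impose no condition. If \<open>r\<close> survives compression by some
  first letter of \<open>J\<close>, descend along it. Otherwise the atom avoids all nonempty words of \<open>J\<close>, and a
  range projection that does so comes from a letter not in \<open>J\<close> or from a nonempty subset of \<open>C\<close> that no
  letter leaves. If there is neither, \<open>C\<close> is regular, and the Cuntz-Krieger relation writes \<open>r\<close> as a sum of
  terms that all vanish.\<close>

lemma atom_contains_range_at_vertex:
  assumes "finite J" "separates J r" "r \<noteq> 0" "p C * r = r" "\<And>\<nu> A. (\<nu>, A) \<in> J \<Longrightarrow> length \<nu> \<le> n"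
  shows "\<exists>\<kappa> B. \<kappa> \<in> lists L \<and> B \<noteq> bot \<and> B \<le> fold \<theta> \<kappa> C \<and> same_atom J r (e \<kappa> B)"
  using assms
proof (induction n arbitrary: J r C)
  case 0
  obtain C' where C': "C' \<le> C" "p C' * r = r"
    "\<And>A. ([], A) \<in> J \<Longrightarrow> (p A * r = r \<longrightarrow> C' \<le> A) \<and> (p A * r = 0 \<longrightarrow> inf C' A = bot)"
    using separating_vertex_set_of[OF 0(1,2,4)] by blast
  have "same_atom J r (e [] C')"
    unfolding same_atom_def
  proof (clarify, intro conjI impI)
    fix \<nu> A assume \<nu>: "(\<nu>, A) \<in> J"
    then have [simp]: "\<nu> = []" using 0(5) by simp
    show "e [] C' * e \<nu> A = e [] C'" if "e \<nu> A * r = r"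
      using that C'(3)[of A] \<nu> by (simp add: e_Nil p_mult_le)
    show "e [] C' * e \<nu> A = 0" if "e \<nu> A * r = 0"
      using that C'(3)[of A] \<nu> by (simp add: e_Nil p_bot flip: p_inf)
  qed
  moreover have "C' \<noteq> bot" using C'(2) 0(3) by (auto simp: p_bot)
  ultimately show ?case using C'(1) by (intro exI[of _ "[]"] exI[of _ C']) simp
next
  case (Suc n)
  obtain C' where C': "C' \<le> C" "p C' * r = r"
    "\<And>A. ([], A) \<in> J \<Longrightarrow> (p A * r = r \<longrightarrow> C' \<le> A) \<and> (p A * r = 0 \<longrightarrow> inf C' A = bot)"
    using separating_vertex_set_of[OF Suc(2,3,5)] by blast
  have J: "(\<nu>, A) \<in> ranges" "e \<nu> A * r = r \<or> e \<nu> A * r = 0" if "(\<nu>, A) \<in> J" for \<nu> A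
    using Suc(3) that by (auto simp: separates_def)
  show ?case
  proof (cases "\<exists>a w A. (a # w, A) \<in> J \<and> star (s a (\<theta> a C')) * r \<noteq> 0")
    case True
    then obtain a w A where a: "(a # w, A) \<in> J" "star (s a (\<theta> a C')) * r \<noteq> 0" by blast
    have aL: "a \<in> L" using J(1)[OF a(1)] by (simp add: ranges_def)
    let ?D = "\<theta> a C'"
    have D: "?D \<in> \<I> a" using aL by (rule \<theta>_ideal)
    have "p ?D * (star (s a ?D) * r) = star (s a ?D * p ?D) * r"
      by (simp add: star_mult p_star mult.assoc)
    then have "p ?D * (star (s a ?D) * r) = star (s a ?D) * r" using aL D by (simp add: s_p)
    moreover have "length \<nu> \<le> n" if "(\<nu>, A) \<in> descend a J" for \<nu> A
      using that Suc(6) by (fastforce simp: descend_def)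
    ultimately obtain \<kappa> B where \<kappa>: "\<kappa> \<in> lists L" "B \<noteq> bot" "B \<le> fold \<theta> \<kappa> ?D"
      "same_atom (descend a J) (star (s a ?D) * r) (e \<kappa> B)"
      using Suc.IH[OF finite_descend[OF Suc(2)] separates_descend[OF Suc(3) aL D] a(2)] by blast
    have "same_atom J r (e (a # \<kappa>) B)"
      by (rule same_atom_ascend[OF Suc(3) aL D a(2) \<kappa>(1,3,4)])
    moreover have "fold \<theta> (a # \<kappa>) C' \<le> fold \<theta> (a # \<kappa>) C"
      using aL \<kappa>(1) C'(1) by (intro fold_mono) auto
    then have "B \<le> fold \<theta> (a # \<kappa>) C" using \<kappa>(3) by simp
    ultimately show ?thesis using \<kappa> aL by (intro exI[of _ "a # \<kappa>"] exI[of _ B]) simp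
  next
    case False
    have outside: "e (a # w) A * r \<noteq> r" if w: "(a # w, A) \<in> J" for a w A
    proof
      assume r: "e (a # w) A * r = r"
      have a: "a \<in> L" "w \<in> lists L" "A \<in> IW (a # w)" using J(1)[OF w] by (auto simp: ranges_def)
      obtain B where B: "B \<in> \<I> a" "A \<le> fold \<theta> w B" "A \<le> fold \<theta> w B" "\<theta> a C' \<le> B"
        by (rule obtain_admissible[OF a(1,2,2,3,3) \<theta>_ideal[OF a(1)]])
      have "star (s a B) * p C' = star (s a B * p (\<theta> a C'))"
        using a B by (simp add: star_s_p star_mult p_star)
      also have "\<dots> = star (s a (\<theta> a C'))" using a B by (simp add: s_p inf_absorb2)
      finally have "star (s a B) * (p C' * r) = star (s a (\<theta> a C')) * r" by (simp flip: mult.assoc)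
      also have "\<dots> = 0" using False w by blast
      finally have "e (a # w) A * (p C' * r) = 0" using a B by (simp add: e_Cons mult.assoc)
      then show False using r C'(2) Suc(4) by simp
    qed
    have suffices: ?thesis if \<kappa>: "\<kappa> \<in> lists L" "B \<noteq> bot" "B \<le> fold \<theta> \<kappa> C'"
      and orth: "\<And>a w A. (a # w, A) \<in> J \<Longrightarrow> e \<kappa> B * e (a # w) A = 0" for \<kappa> B
    proof -
      have B: "B \<in> IW \<kappa>" using \<kappa> by (intro IW_fold[of _ _ C'])
      have "(e \<nu> A * r = r \<longrightarrow> e \<kappa> B * e \<nu> A = e \<kappa> B) \<and> (e \<nu> A * r = 0 \<longrightarrow> e \<kappa> B * e \<nu> A = 0)"
        if \<nu>: "(\<nu>, A) \<in> J" for \<nu> A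
      proof (cases \<nu>)
        case Nil
        have "inf B (fold \<theta> \<kappa> A) = B" if "C' \<le> A"
          using order_trans[OF \<kappa>(3) fold_mono[OF \<kappa>(1) that]] by (simp add: inf_absorb1)
        moreover have "inf B (fold \<theta> \<kappa> A) = bot" if "inf C' A = bot"
        proof -
          have "inf B (fold \<theta> \<kappa> A) \<le> fold \<theta> \<kappa> (inf C' A)" using \<kappa> by (simp add: fold_inf le_infI1)
          then show ?thesis using that \<kappa>(1) by (simp add: fold_bot bot_unique)
        qed
        ultimately show ?thesis using C'(3)[of A] \<nu> Nil \<kappa>(1) B by (auto simp: e_Nil e_p e_bot)
      next
        case (Cons a w)
        then show ?thesis using orth \<nu> outside by auto
      qed
      then have "same_atom J r (e \<kappa> B)" by (auto simp: same_atom_def)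
      moreover have "B \<le> fold \<theta> \<kappa> C" by (rule order_trans[OF \<kappa>(3) fold_mono[OF \<kappa>(1) C'(1)]])
      ultimately show ?thesis using \<kappa> by blast
    qed
    define F where "F = (\<lambda>x. hd (fst x)) ` {x \<in> J. fst x \<noteq> []}"
    have F: "finite F" using Suc(2) by (simp add: F_def)
    have inF: "a \<in> F" if "(a # w, A) \<in> J" for a w A using that by (force simp: F_def)
    have C'0: "C' \<noteq> bot" using C'(2) Suc(4) by (auto simp: p_bot)
    consider a where "a \<in> Delta L \<theta> C'" "a \<notin> F" | B where "B \<le> C'" "B \<noteq> bot" "Delta L \<theta> B = {}"
      | "Delta L \<theta> C' \<subseteq> F" "\<And>B. B \<le> C' \<Longrightarrow> B \<noteq> bot \<Longrightarrow> Delta L \<theta> B \<noteq> {}" by blast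
    then show ?thesis
    proof cases
      case 1
      then have a: "a \<in> L" "\<theta> a C' \<noteq> bot" by (auto simp: Delta_def)
      show ?thesis
      proof (rule suffices[of "[a]" "\<theta> a C'"])
        fix b w A assume w: "(b # w, A) \<in> J"
        then have "a \<noteq> b" using 1 inF by auto
        then show "e [a] (\<theta> a C') * e (b # w) A = 0"
          using J(1)[OF w] a IW_fold[of "[a]" "\<theta> a C'" C']
          by (intro e_e_incomparable[of _ _ _ _ 0]) (auto simp: ranges_def)
      qed (use a in auto)
    next
      case 2
      show ?thesis
      proof (rule suffices[of "[]" B])
        fix a w A assume w: "(a # w, A) \<in> J"
        then have a: "a \<in> L" "w \<in> lists L" "A \<in> IW (a # w)" using J(1)[OF w] by (auto simp: ranges_def)
        have "\<theta> a B = bot" using 2 a by (auto simp: Delta_def)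
        then show "e [] B * e (a # w) A = 0"
          using p_e[of "a # w" A B] a by (simp add: e_Nil fold_bot inf_bot e_bot)
      qed (use 2 in auto)
    next
      case 3
      have fin: "finite (Delta L \<theta> B)" if "B \<le> C'" for B
        using F by (rule rev_finite_subset) (rule subset_trans[OF Delta_mono[OF that] 3(1)])
      then have "C' \<in> regular_elements L \<theta>" using 3(2) unfolding regular_elements_def by simp
      then have "p C' = (\<Sum>a\<in>Delta L \<theta> C'. s a (\<theta> a C') * star (s a (\<theta> a C')))"
        using fin by (intro p_regular) auto
      then have "r = (\<Sum>a\<in>Delta L \<theta> C'. s a (\<theta> a C') * (star (s a (\<theta> a C')) * r))"
        using C'(2) by (simp add: sum_distrib_right mult.assoc)
      also have "\<dots> = 0"
      proof (rule sum.neutral, rule ballI)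
        fix a assume "a \<in> Delta L \<theta> C'"
        then have "a \<in> F" using 3 by blast
        then obtain \<nu> A where \<nu>: "(\<nu>, A) \<in> J" "\<nu> \<noteq> []" "a = hd \<nu>" by (auto simp: F_def)
        then have "(a # tl \<nu>, A) \<in> J" by simp
        then have "star (s a (\<theta> a C')) * r = 0" using False by blast
        then show "s a (\<theta> a C') * (star (s a (\<theta> a C')) * r) = 0" by simp
      qed
      finally show ?thesis using Suc(4) by simp
    qed
  qed
qed

lemma atom_contains_range:
  assumes J: "finite J" "separates J g" and g: "g \<noteq> 0"
    and \<nu>: "(\<nu>, A) \<in> J" "e \<nu> A * g = g"
  shows "\<exists>\<kappa> B. (\<kappa>, B) \<in> ranges \<and> B \<noteq> bot \<and> same_atom J g (e \<kappa> B)"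
proof -
  define n where "n = Max ((length \<circ> fst) ` J)"
  have n: "length \<mu> \<le> n" if "(\<mu>, C) \<in> J" for \<mu> C
    using J(1) that unfolding n_def by (intro Max_ge) force+
  have \<nu>r: "\<nu> \<in> lists L" "A \<in> IW \<nu>" using J(2) \<nu>(1) by (auto simp: separates_def ranges_def)
  show ?thesis
  proof (cases \<nu>)
    case Nil
    then have "p A * g = g" using \<nu> by (simp add: e_Nil)
    then obtain \<kappa> B where "\<kappa> \<in> lists L" "B \<noteq> bot" "B \<le> fold \<theta> \<kappa> A" "same_atom J g (e \<kappa> B)"
      using atom_contains_range_at_vertex[OF J g, of A n] n by blast
    moreover then have "(\<kappa>, B) \<in> ranges" using IW_fold[of \<kappa> B A] by (simp add: ranges_def)
    ultimately show ?thesis by blast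
  next
    case (Cons a w)
    have a: "a \<in> L" "w \<in> lists L" "A \<in> IW (a # w)" using \<nu>r Cons by auto
    then obtain D where D: "D \<in> \<I> a" "A \<le> fold \<theta> w D" by auto
    have nz: "star (s a D) * g \<noteq> 0"
    proof
      assume "star (s a D) * g = 0"
      then have "e \<nu> A * g = 0" using a D Cons by (simp add: e_Cons mult.assoc)
      then show False using \<nu> g by simp
    qed
    have "p D * (star (s a D) * g) = star (s a D * p D) * g"
      by (simp add: star_mult p_star mult.assoc)
    then have pD: "p D * (star (s a D) * g) = star (s a D) * g" using a D by (simp add: s_p)
    have "length \<mu> \<le> n" if "(\<mu>, C) \<in> descend a J" for \<mu> C
      using that n by (fastforce simp: descend_def)
    then obtain \<kappa> B where \<kappa>: "\<kappa> \<in> lists L" "B \<noteq> bot" "B \<le> fold \<theta> \<kappa> D"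
      "same_atom (descend a J) (star (s a D) * g) (e \<kappa> B)"
      using atom_contains_range_at_vertex[OF finite_descend[OF J(1)] separates_descend[OF J(2) a(1) D(1)] nz pD, of n]
      by blast
    then have "same_atom J g (e (a # \<kappa>) B)"
      using same_atom_ascend[OF J(2) a(1) D(1) nz \<kappa>(1,3,4)] by simp
    moreover have "(a # \<kappa>, B) \<in> ranges" using \<kappa> a D by (auto simp: ranges_def)
    ultimately show ?thesis using \<kappa>(2) by blast
  qed
qed

end

section \<open>Spans of monomials\<close>

lemma span_closed_linear:
  fixes f :: "'a::real_vector \<Rightarrow> 'b::real_vector"
  assumes "linear f" "\<And>x. x \<in> M \<Longrightarrow> f x \<in> span N" "x \<in> span M"
  shows "f x \<in> span N"
proof -
  have "span M \<subseteq> f -` span N"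
    using assms(1,2) by (intro span_minimal linear_subspace_vimage subspace_span) auto
  then show ?thesis using assms(3) by blast
qed

lemma closure_span_closed_linear:
  fixes f :: "'a::real_normed_vector \<Rightarrow> 'b::real_normed_vector"
  assumes f: "bounded_linear f" "\<And>x. x \<in> M \<Longrightarrow> f x \<in> span N" and x: "x \<in> closure (span M)"
  shows "f x \<in> closure (span N)"
proof -
  have "f ` closure (span M) \<subseteq> closure (f ` span M)"
    by (rule closure_bounded_linear_image_subset[OF f(1)])
  also have "\<dots> \<subseteq> closure (span N)"
    using span_closed_linear[OF bounded_linear.linear[OF f(1)] f(2)] by (intro closure_mono) blast
  finally show ?thesis using x by blast
qed

lemma closure_span_subset: "subspace N \<Longrightarrow> closed N \<Longrightarrow> M \<subseteq> N \<Longrightarrow> closure (span M) \<subseteq> N"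
  by (intro closure_minimal span_minimal)

lemma subspace_closure:
  fixes S :: "'a::real_normed_vector set"
  assumes S: "subspace S" shows "subspace (closure S)"
proof (rule subspaceI)
  show "0 \<in> closure S" using subspace_0[OF S] closure_subset by blast
next
  fix x y assume "x \<in> closure S" "y \<in> closure S"
  then obtain f g where "\<forall>n. f n \<in> S" "f \<longlonglongrightarrow> x" "\<forall>n. g n \<in> S" "g \<longlonglongrightarrow> y"
    unfolding closure_sequential by blast
  then have "\<forall>n. f n + g n \<in> S" "(\<lambda>n. f n + g n) \<longlonglongrightarrow> x + y"
    using subspace_add[OF S] by (auto intro: tendsto_add)
  then show "x + y \<in> closure S"
    unfolding closure_sequential by (intro exI[of _ "\<lambda>n. f n + g n"] conjI)
next
  fix r x assume "x \<in> closure S"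
  then obtain f where "\<forall>n. f n \<in> S" "f \<longlonglongrightarrow> x" unfolding closure_sequential by blast
  then have "\<forall>n. r *\<^sub>R f n \<in> S" "(\<lambda>n. r *\<^sub>R f n) \<longlonglongrightarrow> r *\<^sub>R x"
    using subspace_scale[OF S] by (auto intro: tendsto_intros)
  then show "r *\<^sub>R x \<in> closure S"
    unfolding closure_sequential by (intro exI[of _ "\<lambda>n. r *\<^sub>R f n"] conjI)
qed

lemma cstar_subalgebra_subspace: "cstar_subalgebra N \<Longrightarrow> subspace N"
  by (auto simp: cstar_subalgebra_def subspace_def scaleR_eq_scaleC)

context gbds_relations
begin

definition monomials :: "int \<Rightarrow> 'a set" where
  "monomials k = {c *\<^sub>C (S \<alpha> A * star (S \<beta> A)) |c \<alpha> \<beta> A. (\<alpha>, A) \<in> ranges \<and> (\<beta>, A) \<in> ranges \<and>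
     int (length \<alpha>) - int (length \<beta>) = k}"

definition diagonal_monomials :: "'a set" where
  "diagonal_monomials = {c *\<^sub>C e w A |c w A. (w, A) \<in> ranges}"

lemma ranges_down: "(w, A) \<in> ranges \<Longrightarrow> B \<le> A \<Longrightarrow> (w, B) \<in> ranges"
  using IW_down by (auto simp: ranges_def)

lemma S_star_S_monomial:
  assumes "(\<alpha>, A) \<in> ranges" "(\<beta>, B) \<in> ranges"
  shows "c *\<^sub>C (S \<alpha> A * star (S \<beta> B)) \<in> monomials (int (length \<alpha>) - int (length \<beta>))"
proof -
  have "(\<alpha>, inf A B) \<in> ranges" "(\<beta>, inf A B) \<in> ranges"
    using assms by (auto intro: ranges_down)
  moreover have "S \<alpha> A * star (S \<beta> B) = S \<alpha> (inf A B) * star (S \<beta> (inf A B))"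
    using assms by (intro S_star_S) (auto simp: ranges_def)
  ultimately show ?thesis
    unfolding monomials_def
    by (intro CollectI exI[of _ c] exI[of _ \<alpha>] exI[of _ \<beta>] exI[of _ "inf A B"]) simp
qed

lemma scaleC_monomial: "x \<in> monomials k \<Longrightarrow> c *\<^sub>C x \<in> monomials k"
proof -
  assume "x \<in> monomials k"
  then obtain c' \<alpha> \<beta> A where "x = c' *\<^sub>C (S \<alpha> A * star (S \<beta> A))" "(\<alpha>, A) \<in> ranges" "(\<beta>, A) \<in> ranges"
    "int (length \<alpha>) - int (length \<beta>) = k" by (auto simp: monomials_def)
  then show ?thesis using S_star_S_monomial[of \<alpha> A \<beta> A "c * c'"] by (simp add: scaleC_scaleC)
qed

lemma star_monomial: "x \<in> monomials k \<Longrightarrow> star x \<in> monomials (- k)"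
proof -
  assume "x \<in> monomials k"
  then obtain c \<alpha> \<beta> A where "x = c *\<^sub>C (S \<alpha> A * star (S \<beta> A))" "(\<alpha>, A) \<in> ranges" "(\<beta>, A) \<in> ranges"
    "int (length \<alpha>) - int (length \<beta>) = k" by (auto simp: monomials_def)
  moreover from this(4) have "int (length \<beta>) - int (length \<alpha>) = - k" by simp
  ultimately show ?thesis
    using S_star_S_monomial[of \<beta> A \<alpha> A "cnj c"] by (simp only: star_scaleC star_mult star_star)
qed

lemma p_mult_monomial: assumes "x \<in> monomials k" shows "p C * x \<in> monomials k"
proof -
  obtain c \<alpha> \<beta> A where x: "x = c *\<^sub>C (S \<alpha> A * star (S \<beta> A))" "(\<alpha>, A) \<in> ranges" "(\<beta>, A) \<in> ranges"
    "int (length \<alpha>) - int (length \<beta>) = k" using assms by (auto simp: monomials_def)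
  have "p C * x = c *\<^sub>C ((p C * S \<alpha> A) * star (S \<beta> A))" using x by (simp add: mult_scaleC_right mult.assoc)
  also have "p C * S \<alpha> A = S \<alpha> (inf A (fold \<theta> \<alpha> C))" using x by (simp add: p_S ranges_def)
  finally show ?thesis
    using S_star_S_monomial[OF ranges_down[OF x(2), of "inf A (fold \<theta> \<alpha> C)"] x(3), of c] x(4) by simp
qed

lemma s_mult_monomial:
  assumes "x \<in> monomials k" "a \<in> L" "B \<in> \<I> a" shows "s a B * x \<in> monomials (k + 1)"
proof -
  obtain c \<alpha> \<beta> A where x: "x = c *\<^sub>C (S \<alpha> A * star (S \<beta> A))" "(\<alpha>, A) \<in> ranges" "(\<beta>, A) \<in> ranges"
    "int (length \<alpha>) - int (length \<beta>) = k" using assms by (auto simp: monomials_def)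
  have B: "B \<in> IW [a]" using assms by auto
  have "s a B * x = c *\<^sub>C ((S [a] B * S \<alpha> A) * star (S \<beta> A))"
    using x assms by (simp add: mult_scaleC_right mult.assoc S_singleton)
  also have "S [a] B * S \<alpha> A = S (a # \<alpha>) (inf A (fold \<theta> \<alpha> B))"
    using x assms B S_append[of "[a]" \<alpha> B A] by (simp add: ranges_def)
  finally have "s a B * x = c *\<^sub>C (S (a # \<alpha>) (inf A (fold \<theta> \<alpha> B)) * star (S \<beta> A))" .
  moreover have "(a # \<alpha>, inf A (fold \<theta> \<alpha> B)) \<in> ranges"
    using x(2) assms IW_append[of "[a]" \<alpha> B "inf A (fold \<theta> \<alpha> B)"] B by (auto simp: ranges_def)
  moreover have "int (length (a # \<alpha>)) - int (length \<beta>) = k + 1" using x(4) by simp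
  ultimately show ?thesis using S_star_S_monomial[OF _ x(3)] by metis
qed

lemma star_s_mult_monomial:
  assumes "x \<in> monomials k" "a \<in> L" "B \<in> \<I> a" shows "star (s a B) * x \<in> insert 0 (monomials (k - 1))"
proof -
  obtain c \<alpha> \<beta> A where x: "x = c *\<^sub>C (S \<alpha> A * star (S \<beta> A))" "(\<alpha>, A) \<in> ranges" "(\<beta>, A) \<in> ranges"
    "int (length \<alpha>) - int (length \<beta>) = k" using assms by (auto simp: monomials_def)
  have B: "B \<in> IW [a]" using assms by auto
  show ?thesis
  proof (cases \<alpha>)
    case Nil
    let ?B = "inf B (\<theta> a A)"
    have B': "?B \<in> \<I> a" using assms(2,3) by (rule ideal_down) simp
    have "star (s a B) * x = c *\<^sub>C star (S \<beta> A * (p A * s a B))"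
      using x Nil by (simp add: mult_scaleC_right star_mult p_star mult.assoc)
    also have "p A * s a B = S [a] ?B" using assms B' by (simp add: p_s_inf S_singleton)
    also have "S \<beta> A * S [a] ?B = S (\<beta> @ [a]) (inf ?B (\<theta> a A))"
    proof -
      have "?B \<in> IW [a]" using B by (rule IW_down) simp
      then show ?thesis using S_append[of \<beta> "[a]" A ?B] x(3) assms by (auto simp: ranges_def)
    qed
    finally have eq: "star (s a B) * x = c *\<^sub>C star (S (\<beta> @ [a]) (inf ?B (\<theta> a A)))" .
    have r: "(\<beta> @ [a], inf ?B (\<theta> a A)) \<in> ranges"
      using x(3) assms IW_append[of \<beta> "[a]" A "inf ?B (\<theta> a A)"] by (auto simp: ranges_def)
    have "S (\<beta> @ [a]) (inf ?B (\<theta> a A)) * p (inf ?B (\<theta> a A)) = S (\<beta> @ [a]) (inf ?B (\<theta> a A))"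
      using r S_p[of "\<beta> @ [a]" "inf ?B (\<theta> a A)" "inf ?B (\<theta> a A)"] by (auto simp: ranges_def)
    from arg_cong[OF this, of star]
    have "star (s a B) * x = c *\<^sub>C (S [] (inf ?B (\<theta> a A)) * star (S (\<beta> @ [a]) (inf ?B (\<theta> a A))))"
      unfolding eq by (simp add: star_mult p_star)
    moreover have "([], inf ?B (\<theta> a A)) \<in> ranges" by (simp add: ranges_def)
    moreover have "int (length ([] :: 'l list)) - int (length (\<beta> @ [a])) = k - 1" using x(4) Nil by simp
    ultimately show ?thesis using S_star_S_monomial[OF _ r] by (metis insertI2)
  next
    case (Cons b \<alpha>')
    have b: "b \<in> L" "\<alpha>' \<in> lists L" "A \<in> IW (b # \<alpha>')" using x Cons by (auto simp: ranges_def)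
    have eq: "star (s a B) * x = c *\<^sub>C ((star (S [a] B) * S \<alpha> A) * star (S \<beta> A))"
      using x assms by (simp add: mult_scaleC_right mult.assoc S_singleton)
    show ?thesis
    proof (cases "a = b")
      case False
      have "star (S [a] B) * S \<alpha> A = 0"
        unfolding Cons using b assms B False by (intro star_S_S_incomparable[of _ _ _ _ 0]) auto
      then show ?thesis unfolding eq by simp
    next
      case True
      have "star (S [a] B) * S \<alpha> A = S \<alpha>' (inf A (fold \<theta> \<alpha>' B))"
        using star_S_S_prefix[of "[a]" \<alpha>' B A] assms b B Cons True by simp
      moreover have "(\<alpha>', inf A (fold \<theta> \<alpha>' B)) \<in> ranges"
        using b IW_down[OF IW_tail[OF b]] by (simp add: ranges_def)
      moreover have "int (length \<alpha>') - int (length \<beta>) = k - 1" using x(4) Cons by simp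
      ultimately show ?thesis unfolding eq using S_star_S_monomial[OF _ x(3)] by (metis insertI2)
    qed
  qed
qed

lemma e_in_ranges_projection: "(w, A) \<in> ranges \<Longrightarrow> projection (e w A)"
  by (simp add: ranges_def e_projection)

definition range_projections :: "'a set" where
  "range_projections = {e w A |w A. (w, A) \<in> ranges}"

abbreviation "centralizer \<equiv> commutant range_projections"

lemma centralizer_subalgebra: "cstar_subalgebra centralizer"
proof (rule cstar_subalgebra_commutant)
  fix x assume x: "x \<in> range_projections"
  then have "star x = x" by (auto simp: range_projections_def projection_star e_in_ranges_projection)
  then show "star x \<in> range_projections" using x by simp
qed

lemma centralizer:
  "0 \<in> centralizer" "x \<in> centralizer \<Longrightarrow> y \<in> centralizer \<Longrightarrow> x + y \<in> centralizer"
  "x \<in> centralizer \<Longrightarrow> y \<in> centralizer \<Longrightarrow> x * y \<in> centralizer" "x \<in> centralizer \<Longrightarrow> c *\<^sub>C x \<in> centralizer"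
  "x \<in> centralizer \<Longrightarrow> star x \<in> centralizer" "closed centralizer"
  using centralizer_subalgebra by (auto simp: cstar_subalgebra_def)

lemma centralizer_subspace: "subspace centralizer"
  by (rule cstar_subalgebra_subspace[OF centralizer_subalgebra])

lemma centralizerD: "x \<in> centralizer \<Longrightarrow> (w, A) \<in> ranges \<Longrightarrow> e w A * x = x * e w A"
proof -
  assume "x \<in> centralizer" "(w, A) \<in> ranges"
  moreover then have "e w A \<in> range_projections" by (auto simp: range_projections_def)
  ultimately show ?thesis by (simp add: commutant_def)
qed

lemma e_centralizer: "(w, A) \<in> ranges \<Longrightarrow> e w A \<in> centralizer"
  by (auto simp: commutant_def range_projections_def e_commute)

lemma diagonal_centralizer: "x \<in> span diagonal_monomials \<Longrightarrow> x \<in> centralizer"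
proof -
  have "diagonal_monomials \<subseteq> centralizer"
    by (auto simp: diagonal_monomials_def intro!: centralizer(4) e_centralizer)
  then have "span diagonal_monomials \<subseteq> centralizer" by (rule span_minimal[OF _ centralizer_subspace])
  then show "x \<in> span diagonal_monomials \<Longrightarrow> x \<in> centralizer" by blast
qed

section \<open>Elements of degree zero\<close>

text \<open>Such a \<open>z\<close> maps the complement of a range projection into its range, so pinching by this projection
  sends it to 0.\<close>

definition off_diagonal :: "'a \<Rightarrow> bool" where
  "off_diagonal z \<longleftrightarrow> (\<exists>(w, A)\<in>ranges. e w A * z = z \<and> z * e w A = 0)"

lemma off_diagonal_pinch:
  assumes z: "off_diagonal z" and vB: "(v, B) \<in> ranges" shows "off_diagonal (pinch (e v B) z)"
proof -
  obtain w A where w: "(w, A) \<in> ranges" "e w A * z = z" "z * e w A = 0"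
    using z by (auto simp: off_diagonal_def)
  let ?q = "e w A" and ?q' = "e v B"
  have c: "?q * ?q' = ?q' * ?q" by (rule e_commute[OF w(1) vB])
  have left: "?q * (?q' * x) = ?q' * (?q * x)" for x using c by (simp flip: mult.assoc)
  have right: "z * (?q' * ?q) = 0"
    using w(3) by (simp flip: c) (simp flip: mult.assoc)
  have "?q * (z * x) = z * x" for x using w(2) by (simp flip: mult.assoc)
  then have "?q * pinch ?q' z = pinch ?q' z"
    using w(2) by (simp add: pinch_def left_diff_distrib right_diff_distrib distrib_left left mult.assoc)
  moreover have "pinch ?q' z * ?q = 0"
    using w(3) right by (simp add: pinch_def left_diff_distrib distrib_right mult.assoc)
  ultimately show ?thesis using w(1) by (auto simp: off_diagonal_def)
qed

text \<open>Pinching by the projection of one term removes this term, fixes \<open>x\<close>, keeps the other terms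
  off-diagonal and does not increase the norm.\<close>

lemma norm_le_off_diagonal:
  assumes "x \<in> centralizer" "\<And>z. z \<in> set zs \<Longrightarrow> off_diagonal z"
  shows "norm x \<le> norm (x - sum_list zs)"
  using assms(2)
proof (induction "length zs" arbitrary: zs)
  case (Suc n)
  obtain z zs' where zs: "zs = z # zs'" using Suc.hyps(2) by (cases zs) auto
  obtain w A where w: "(w, A) \<in> ranges" "e w A * z = z" "z * e w A = 0"
    using Suc.prems zs by (fastforce simp: off_diagonal_def)
  let ?q = "e w A"
  have q: "projection ?q" using w(1) by (rule e_in_ranges_projection)
  have sum: "pinch ?q (sum_list ys) = sum_list (map (pinch ?q) ys)" for ys
    by (induction ys) (simp_all add: pinch_add, simp add: pinch_def)
  have "norm x \<le> norm (x - sum_list (map (pinch ?q) zs'))"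
    using Suc.hyps(2) Suc.prems zs w(1) by (intro Suc.hyps(1)) (auto intro: off_diagonal_pinch)
  also have "x - sum_list (map (pinch ?q) zs') = pinch ?q (x - sum_list zs)"
    using pinch_commute[OF q centralizerD[OF assms(1) w(1)]] pinch_eq_0[OF w(2,3)]
    by (simp add: zs pinch_diff pinch_add sum)
  also have "norm \<dots> \<le> norm (x - sum_list zs)" by (rule norm_pinch_le[OF q])
  finally show ?case .
qed simp

lemma monomial_degree_0:
  assumes "x \<in> monomials 0" shows "x \<in> diagonal_monomials \<or> off_diagonal x"
proof -
  obtain c \<alpha> \<beta> A where x: "x = c *\<^sub>C (S \<alpha> A * star (S \<beta> A))" "(\<alpha>, A) \<in> ranges" "(\<beta>, A) \<in> ranges"
    "length \<alpha> = length \<beta>" using assms by (auto simp: monomials_def)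
  show ?thesis
  proof (cases "\<alpha> = \<beta>")
    case True
    then show ?thesis using x by (auto simp: diagonal_monomials_def e_def)
  next
    case False
    have "star (S \<beta> A) * S \<alpha> A = 0"
      using x False by (intro star_S_S_same_length) (auto simp: ranges_def)
    then have "star (S \<beta> A) * e \<alpha> A = 0" by (simp add: e_def flip: mult.assoc)
    then have "x * e \<alpha> A = 0" using x by (simp add: mult_scaleC_left mult.assoc)
    moreover have "e \<alpha> A * x = c *\<^sub>C ((e \<alpha> A * S \<alpha> A) * star (S \<beta> A))"
      using x by (simp add: mult_scaleC_right mult.assoc)
    then have "e \<alpha> A * x = x" using x e_S[of \<alpha> A] by (simp add: ranges_def)
    ultimately show ?thesis using x(2) by (auto simp: off_diagonal_def)
  qed
qed

lemma span_monomials_degree_0: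
  assumes "y \<in> span (monomials 0)"
  shows "\<exists>d\<in>span diagonal_monomials. \<exists>zs. y = d + sum_list zs \<and> (\<forall>z\<in>set zs. off_diagonal z)"
  using assms
proof (induction rule: span_induct_alt)
  case base
  show ?case by (intro bexI[of _ 0] exI[of _ "[]"]) (auto simp: span_zero)
next
  case (step r x y)
  then obtain d zs where d: "d \<in> span diagonal_monomials" "y = d + sum_list zs" "\<forall>z\<in>set zs. off_diagonal z"
    by blast
  from monomial_degree_0[OF step(1)] show ?case
  proof
    assume "x \<in> diagonal_monomials"
    then have "r *\<^sub>R x + d \<in> span diagonal_monomials" by (intro span_add[OF span_scale[OF span_base] d(1)])
    then show ?thesis using d by (intro bexI[of _ "r *\<^sub>R x + d"] exI[of _ zs]) auto
  next
    assume "off_diagonal x"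
    then have "off_diagonal (r *\<^sub>R x)" by (auto simp: off_diagonal_def)
    then show ?thesis using d by (intro bexI[of _ d] exI[of _ "r *\<^sub>R x # zs"]) auto
  qed
qed

lemma centralizer_degree_0:
  assumes x: "x \<in> centralizer" "x \<in> closure (span (monomials 0))"
  shows "x \<in> closure (span diagonal_monomials)"
  unfolding closure_approachable
proof (intro allI impI)
  fix \<epsilon> :: real assume "0 < \<epsilon>"
  then obtain y where y: "y \<in> span (monomials 0)" "dist y x < \<epsilon>"
    using x(2) by (auto simp: closure_approachable)
  obtain d zs where d: "d \<in> span diagonal_monomials" "y = d + sum_list zs" "\<forall>z\<in>set zs. off_diagonal z"
    using span_monomials_degree_0[OF y(1)] by blast
  have "x - d \<in> centralizer"
    using subspace_diff[OF centralizer_subspace x(1) diagonal_centralizer[OF d(1)]] .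
  then have "norm (x - d) \<le> norm (x - d - sum_list zs)" using d(3) by (intro norm_le_off_diagonal) auto
  also have "\<dots> < \<epsilon>" using y(2) d(2) by (simp add: dist_norm norm_minus_commute algebra_simps)
  finally show "\<exists>d\<in>span diagonal_monomials. dist d x < \<epsilon>"
    using d(1) by (auto simp: dist_norm norm_minus_commute)
qed

section \<open>Elements of nonzero degree\<close>

lemma avoidable_span:
  assumes L: "condition_L L \<theta>" and k: "k \<noteq> 0" and "y \<in> span (monomials k)"
  shows "(\<mu>, B) \<in> ranges \<Longrightarrow> B \<noteq> bot \<Longrightarrow> avoidable y \<mu> B"
  using assms(3)
proof (induction arbitrary: \<mu> B rule: span_induct_alt)
  case base
  then show ?case by (intro avoidable_0) auto
next
  case (step r x y)
  obtain \<nu> C where C: "refines \<nu> C \<mu> B" "C \<noteq> bot" "e \<nu> C * y * e \<nu> C = 0"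
    using step.IH[OF step.prems] by (auto simp: avoidable_def)
  have \<nu>: "(\<nu>, C) \<in> ranges" by (rule refines_range[OF step.prems(1) C(1)])
  obtain c \<alpha> \<beta> A where x: "x = c *\<^sub>C (S \<alpha> A * star (S \<beta> A))" "(\<alpha>, A) \<in> ranges" "(\<beta>, A) \<in> ranges"
    "int (length \<alpha>) - int (length \<beta>) = k" using step(1) by (auto simp: monomials_def)
  have "avoidable (S \<alpha> A * star (S \<beta> A)) \<nu> C"
    using x \<nu> C(2) k by (intro avoidable_monomial[OF L]) (auto simp: ranges_def)
  then obtain \<nu>' C' where C': "refines \<nu>' C' \<nu> C" "C' \<noteq> bot" "e \<nu>' C' * (S \<alpha> A * star (S \<beta> A)) * e \<nu>' C' = 0"
    by (auto simp: avoidable_def)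
  let ?q = "e \<nu>' C'"
  have "?q * x * ?q = 0" using C'(3) x(1) by (simp add: mult_scaleC_left mult_scaleC_right)
  moreover have "?q * y * ?q = (?q * e \<nu> C) * y * (e \<nu> C * ?q)" by (simp add: e_refines[OF \<nu> C'(1)])
  then have "?q * y * ?q = ?q * (e \<nu> C * y * e \<nu> C) * ?q" by (simp only: mult.assoc)
  then have "?q * y * ?q = 0" using C(3) by simp
  ultimately have "?q * (r *\<^sub>R x + y) * ?q = 0" by (simp add: distrib_left distrib_right)
  then show ?case using refines_trans[OF C'(1) C(1)] C'(2) by (auto simp: avoidable_def)
qed

text \<open>On an atom of the projections that occur in \<open>d\<close>, each of them is 0 or 1, so \<open>d\<close> is a scalar there.\<close>

lemma diagonal_eigenvalue:
  assumes "d \<in> span diagonal_monomials"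
  shows "\<exists>J. finite J \<and> J \<subseteq> ranges \<and> (\<forall>g. separates J g \<longrightarrow>
    (\<forall>q. same_atom J g q \<longrightarrow> (\<exists>t. d * g = t *\<^sub>C g \<and> q * d = t *\<^sub>C q)) \<and>
    ((\<forall>(\<nu>, A)\<in>J. e \<nu> A * g = 0) \<longrightarrow> d * g = 0))"
  using assms
proof (induction rule: span_induct_alt)
  case base
  show ?case by (intro exI[of _ "{}"]) (auto intro!: exI[of _ 0])
next
  case (step r x y)
  then obtain J where J: "finite J" "J \<subseteq> ranges"
    "\<And>g q. separates J g \<Longrightarrow> same_atom J g q \<Longrightarrow> \<exists>t. y * g = t *\<^sub>C g \<and> q * y = t *\<^sub>C q"
    "\<And>g. separates J g \<Longrightarrow> (\<forall>(\<nu>, A)\<in>J. e \<nu> A * g = 0) \<Longrightarrow> y * g = 0" by blast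
  obtain c w A where x: "x = c *\<^sub>C e w A" "(w, A) \<in> ranges" using step(1) by (auto simp: diagonal_monomials_def)
  let ?J = "insert (w, A) J" and ?z = "r *\<^sub>R x + y"
  have eig: "\<exists>t. ?z * g = t *\<^sub>C g \<and> q * ?z = t *\<^sub>C q" if g: "separates ?J g" "same_atom ?J g q" for g q
  proof -
    have "separates J g" "same_atom J g q" using g by (auto simp: separates_def same_atom_def)
    then obtain t where t: "y * g = t *\<^sub>C g" "q * y = t *\<^sub>C q" using J(3) by blast
    consider "e w A * g = g" "q * e w A = q" | "e w A * g = 0" "q * e w A = 0"
      using g by (auto simp: separates_def same_atom_def)
    then show ?thesis
    proof cases
      case 1
      then show ?thesis using t
        by (intro exI[of _ "complex_of_real r * c + t"])
          (simp add: x distrib_left distrib_right mult_scaleC_left mult_scaleC_right scaleR_eq_scaleC scaleC_scaleC scaleC_add_left)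
    next
      case 2
      then show ?thesis using t
        by (intro exI[of _ t]) (simp add: x distrib_left distrib_right mult_scaleC_left mult_scaleC_right)
    qed
  qed
  have zero: "?z * g = 0" if "separates ?J g" "\<forall>(\<nu>, A)\<in>?J. e \<nu> A * g = 0" for g
  proof -
    have "y * g = 0" using that by (intro J(4)) (auto simp: separates_def)
    then show ?thesis using that by (simp add: x distrib_right mult_scaleC_left)
  qed
  show ?case using eig zero J(1,2) x(2) by (intro exI[of _ ?J]) blast
qed

text \<open>Cut \<open>d\<close> by each projection or its complement, whichever keeps the norm. The equation
  \<open>g\<^sup>* g = d g\<close> records that \<open>g\<close> is \<open>d\<close> times a projection that commutes with it.\<close>

lemma separating_corner:
  assumes "finite J" "J \<subseteq> ranges" and d: "d \<in> centralizer" "star d = d"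
  shows "\<exists>g\<in>centralizer. separates J g \<and> norm d \<le> norm g \<and> star g * g = d * g"
  using assms(1,2)
proof (induction J)
  case empty
  show ?case using d by (intro bexI[of _ d]) (auto simp: separates_def)
next
  case (insert x J)
  obtain w A where x: "x = (w, A)" by (cases x)
  let ?q = "e w A"
  have w: "(w, A) \<in> ranges" using insert.prems x by auto
  have q: "projection ?q" using w by (rule e_in_ranges_projection)
  obtain g where g: "g \<in> centralizer" "separates J g" "norm d \<le> norm g" "star g * g = d * g"
    using insert by auto
  have comm: "?q * g = g * ?q" "?q * star g = star g * ?q" "?q * d = d * ?q"
    using centralizerD[OF _ w] g(1) d(1) centralizer(5) by auto
  have qq: "?q * ?q = ?q" by (rule projection_idem[OF q])
  have q_sep: "separates J (?q * g)" "separates J (g - ?q * g)"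
  proof -
    have "e \<nu> C * (?q * g) = ?q * (e \<nu> C * g)" if "(\<nu>, C) \<in> J" for \<nu> C
      using e_commute[of \<nu> C w A] insert.prems that w by (auto simp flip: mult.assoc)
    then show "separates J (?q * g)" "separates J (g - ?q * g)"
      using g(2) by (auto simp: separates_def right_diff_distrib)
  qed
  have sq: "star (?q * g) = ?q * star g" using comm by (simp add: star_mult projection_star q)
  have quad: "star (?q * g) * (?q * g) = d * (?q * g)"
  proof -
    have "star (?q * g) * (?q * g) = ?q * (star g * ?q) * g" unfolding sq by (simp only: mult.assoc)
    also have "\<dots> = (?q * ?q) * (star g * g)" by (simp only: comm(2)[symmetric] mult.assoc)
    also have "\<dots> = (?q * d) * g" by (simp only: qq g(4) mult.assoc)
    finally show ?thesis by (simp only: comm(3) mult.assoc)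
  qed
  have cross: "star g * (?q * g) = d * (?q * g)" "?q * star g * g = d * (?q * g)"
  proof -
    have "star g * (?q * g) = ?q * (star g * g)" by (simp only: comm(2)[symmetric] mult.assoc[symmetric])
    also have "\<dots> = (?q * d) * g" by (simp only: g(4) mult.assoc)
    finally show "star g * (?q * g) = d * (?q * g)" by (simp only: comm(3) mult.assoc)
    have "?q * star g * g = (?q * d) * g" by (simp only: g(4) mult.assoc)
    then show "?q * star g * g = d * (?q * g)" by (simp only: comm(3) mult.assoc)
  qed
  have quad': "star (g - ?q * g) * (g - ?q * g) = d * (g - ?q * g)"
    using quad unfolding star_diff sq by (simp add: left_diff_distrib right_diff_distrib cross g(4))
  have qg: "?q * g \<in> centralizer" by (intro centralizer e_centralizer w g)
  have qg': "g - ?q * g \<in> centralizer" by (rule subspace_diff[OF centralizer_subspace g(1) qg])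
  have sep: "separates (insert x J) (?q * g)" "separates (insert x J) (g - ?q * g)"
    using q_sep w q by (auto simp: separates_def x projection_idem_left right_diff_distrib)
  from norm_le_max_corners[OF q comm(1)] show ?case
  proof
    assume "norm g \<le> norm (?q * g)"
    then show ?thesis using g(3) by (intro bexI[OF _ qg]) (simp add: sep quad)
  next
    assume "norm g \<le> norm (g - ?q * g)"
    then show ?thesis using g(3) by (intro bexI[OF _ qg']) (simp add: sep quad')
  qed
qed

text \<open>Take \<open>d = x\<^sup>* x\<close>. On some corner \<open>d\<close> is nearly the scalar \<open>\<parallel>x\<parallel>\<^sup>2\<close>, and a smaller corner avoids
  an approximation of \<open>x\<close>, on which \<open>x\<close> is therefore small.\<close>

lemma centralizer_nonzero_degree:
  assumes L: "condition_L L \<theta>" and nz: "\<And>A. A \<noteq> bot \<Longrightarrow> p A \<noteq> 0" and k: "k \<noteq> 0"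
    and x: "x \<in> centralizer" "x \<in> closure (span (monomials k))"
    and d: "star x * x \<in> closure (span diagonal_monomials)"
  shows "x = 0"
proof (rule ccontr)
  assume x0: "x \<noteq> 0"
  define M where "M = norm x"
  have M: "0 < M" using x0 by (simp add: M_def)
  let ?d = "star x * x"
  have dM: "norm ?d = M\<^sup>2" by (simp add: M_def norm_star_mult)
  \<comment> \<open>Any bounds \<open>a M\<^sup>2\<close> and \<open>b M\<close> with \<open>2 a + b\<^sup>2 < 1\<close> would do.\<close>
  have "0 < M\<^sup>2 / 16" "0 < M / 4" using M by auto
  then obtain d' y where d': "d' \<in> span diagonal_monomials" "dist d' ?d < M\<^sup>2 / 16"
    and y: "y \<in> span (monomials k)" "dist y x < M / 4"
    using d x(2) unfolding closure_approachable by blast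
  obtain J where J: "finite J" "J \<subseteq> ranges"
    "\<And>g q. separates J g \<Longrightarrow> same_atom J g q \<Longrightarrow> \<exists>t. d' * g = t *\<^sub>C g \<and> q * d' = t *\<^sub>C q"
    "\<And>g. separates J g \<Longrightarrow> (\<forall>(\<nu>, A)\<in>J. e \<nu> A * g = 0) \<Longrightarrow> d' * g = 0"
    using diagonal_eigenvalue[OF d'(1)] by blast
  have "?d \<in> centralizer" by (intro centralizer x(1))
  moreover have "star ?d = ?d" by (simp add: star_mult star_star)
  ultimately obtain g where g: "g \<in> centralizer" "separates J g" "norm ?d \<le> norm g" "star g * g = ?d * g"
    using separating_corner[OF J(1,2)] by blast
  have gM: "M\<^sup>2 \<le> norm g" "0 < norm g" using g(3) dM M zero_less_power[OF M, of 2] by linarith+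
  have "(norm g)\<^sup>2 = norm (?d * g)" using norm_star_mult[of g] g(4) by simp
  also have "\<dots> = norm ((?d - d') * g + d' * g)" by (simp add: left_diff_distrib)
  also have "\<dots> \<le> norm ((?d - d') * g) + norm (d' * g)" by (rule norm_triangle_ineq)
  also have "norm ((?d - d') * g) \<le> M\<^sup>2 / 16 * norm g"
    using d'(2) norm_mult_ineq[of "?d - d'" g] mult_right_mono[of "norm (?d - d')" "M\<^sup>2 / 16" "norm g"]
    by (simp add: dist_norm norm_minus_commute)
  finally have g2: "(norm g)\<^sup>2 \<le> M\<^sup>2 / 16 * norm g + norm (d' * g)" by simp
  have "\<exists>(\<nu>, A)\<in>J. e \<nu> A * g = g"
  proof (rule ccontr)
    assume "\<not> (\<exists>(\<nu>, A)\<in>J. e \<nu> A * g = g)"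
    then have "d' * g = 0" using g(2) by (intro J(4)) (auto simp: separates_def)
    then have "norm g * norm g \<le> M\<^sup>2 / 16 * norm g" using g2 by (simp add: power2_eq_square)
    then have "norm g \<le> M\<^sup>2 / 16" using gM(2) by simp
    then show False using gM(1) zero_less_power[OF M, of 2] by linarith
  qed
  then obtain \<kappa> B where \<kappa>: "(\<kappa>, B) \<in> ranges" "B \<noteq> bot" "same_atom J g (e \<kappa> B)"
    using atom_contains_range[OF J(1) g(2)] gM(2) by fastforce
  obtain t where t: "d' * g = t *\<^sub>C g" "e \<kappa> B * d' = t *\<^sub>C e \<kappa> B" using J(3)[OF g(2) \<kappa>(3)] by blast
  have "norm g * norm g \<le> (M\<^sup>2 / 16 + cmod t) * norm g"
    using g2 by (simp add: t norm_scaleC power2_eq_square distrib_right)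
  then have "norm g \<le> M\<^sup>2 / 16 + cmod t" using gM(2) by simp
  then have large: "15 / 16 * M\<^sup>2 \<le> cmod t" using gM(1) by simp
  obtain \<nu> C where \<nu>: "refines \<nu> C \<kappa> B" "C \<noteq> bot" "e \<nu> C * y * e \<nu> C = 0"
    using avoidable_span[OF L k y(1) \<kappa>(1,2)] by (auto simp: avoidable_def)
  have \<nu>r: "(\<nu>, C) \<in> ranges" by (rule refines_range[OF \<kappa>(1) \<nu>(1)])
  let ?q = "e \<nu> C"
  have q: "projection ?q" using \<nu>r by (rule e_in_ranges_projection)
  have "?q \<noteq> 0"
  proof
    assume "?q = 0"
    moreover have "star (S \<nu> C) * (?q * S \<nu> C) = p C"
      using \<nu>r by (simp add: e_S star_S_S ranges_def)
    ultimately show False using nz[OF \<nu>(2)] by simp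
  qed
  then have nq: "norm ?q = 1" using q by (rule norm_projection[rotated])
  have "?q * d' = ?q * (e \<kappa> B * d')" using e_refines[OF \<kappa>(1) \<nu>(1)] by (simp flip: mult.assoc)
  then have "?q * d' = t *\<^sub>C ?q" using e_refines[OF \<kappa>(1) \<nu>(1)] by (simp add: t(2) mult_scaleC_right)
  then have "?q * d' * ?q = t *\<^sub>C ?q" using q by (simp add: mult_scaleC_left projection_idem)
  then have "cmod t = norm (?q * d' * ?q)" using nq by (simp add: norm_scaleC)
  also have "?q * d' * ?q = ?q * (d' - ?d) * ?q + ?q * ?d * ?q" by (simp add: left_diff_distrib right_diff_distrib)
  also have "norm \<dots> \<le> norm (?q * (d' - ?d) * ?q) + norm (?q * ?d * ?q)" by (rule norm_triangle_ineq)
  also have "norm (?q * (d' - ?d) * ?q) \<le> M\<^sup>2 / 16"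
    using norm_projection_compression_le[OF q, of "d' - ?d"] d'(2) by (simp add: dist_norm)
  also have "norm (?q * ?d * ?q) \<le> (M / 4)\<^sup>2"
  proof -
    have comm: "?q * x = x * ?q" by (rule centralizerD[OF x(1) \<nu>r])
    have "?q * ?d * ?q = star (x * ?q) * (x * ?q)"
      by (simp add: star_mult projection_star[OF q] mult.assoc)
    then have square: "norm (?q * ?d * ?q) = (norm (x * ?q))\<^sup>2" by (simp add: norm_star_mult)
    have "x * ?q = ?q * x * ?q" using comm by (simp add: mult.assoc projection_idem[OF q])
    then have "x * ?q = ?q * (x - y) * ?q" using \<nu>(3) by (simp add: left_diff_distrib right_diff_distrib)
    then have "norm (x * ?q) \<le> M / 4"
      using norm_projection_compression_le[OF q, of "x - y"] y(2) by (simp add: dist_norm norm_minus_commute)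
    then show ?thesis unfolding square by (intro power_mono) auto
  qed
  finally have "cmod t \<le> M\<^sup>2 / 16 + (M / 4)\<^sup>2" by simp
  then have "15 / 16 * M\<^sup>2 \<le> M\<^sup>2 / 8" using large by (simp add: power2_eq_square)
  then show False using M by simp
qed

end

section \<open>Density of the monomials\<close>

locale gbds_universal = gbds L \<theta> \<I>
  for L :: "'l set" and \<theta> :: "'l \<Rightarrow> 'b::generalized_boolean_algebra \<Rightarrow> 'b" and \<I> +
  fixes p :: "'b \<Rightarrow> 'a::cstar_algebra" and s :: "'l \<Rightarrow> 'b \<Rightarrow> 'a"
  assumes alg: "gbds_cstar_algebra L \<theta> \<I> p s"
begin

sublocale gbds_relations L \<theta> \<I> p s
  using alg by unfold_locales (simp add: gbds_cstar_algebra_def universal_representation_def)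

lemma universal: "universal_representation L \<theta> \<I> p s"
  using alg by (simp add: gbds_cstar_algebra_def)

lemma p_nonzero: "A \<noteq> bot \<Longrightarrow> p A \<noteq> 0"
  by (rule universal_projection_nonzero[OF universal])

text \<open>The elements that, together with their adjoints, belong to the closed span of the monomials and
  multiply it into itself form a C*-subalgebra that contains the generators.\<close>

lemma monomials_dense: "closure (span (\<Union>k. monomials k)) = UNIV"
proof -
  let ?W = "closure (span (\<Union>k. monomials k))"
  have sub: "subspace ?W" by (intro subspace_closure subspace_span)
  have base: "x \<in> ?W" if "x \<in> monomials k" for x k
    by (rule subsetD[OF closure_subset], rule span_base) (use that in auto)
  have star: "star x \<in> ?W" if "x \<in> ?W" for x
    by (rule closure_span_closed_linear[OF bounded_linear_star _ that])
      (use star_monomial in \<open>blast intro: span_base\<close>)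
  have scale: "c *\<^sub>C x \<in> ?W" if "x \<in> ?W" for x c
    by (rule closure_span_closed_linear[OF bounded_linear_scaleC _ that])
      (use scaleC_monomial in \<open>blast intro: span_base\<close>)
  have left: "a * x \<in> ?W" if a: "\<And>y k. y \<in> monomials k \<Longrightarrow> \<exists>l. a * y \<in> insert 0 (monomials l)" and x: "x \<in> ?W" for a x
  proof (rule closure_span_closed_linear[OF bounded_linear_mult_right _ x])
    fix y assume "y \<in> (\<Union>k. monomials k)"
    then obtain l where "a * y \<in> insert 0 (monomials l)" using a by blast
    then show "a * y \<in> span (\<Union>k. monomials k)" by (auto intro: span_base span_zero)
  qed
  define N where "N = {x. x \<in> ?W \<and> star x \<in> ?W \<and> (\<forall>y\<in>?W. x * y \<in> ?W) \<and> (\<forall>y\<in>?W. star x * y \<in> ?W)}"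
  have "cstar_subalgebra N"
    unfolding cstar_subalgebra_def
  proof (intro conjI ballI allI)
    show "0 \<in> N" using subspace_0[OF sub] by (simp add: N_def)
    show "x + y \<in> N" if "x \<in> N" "y \<in> N" for x y
      using that subspace_add[OF sub] by (auto simp: N_def star_add distrib_right)
    show "x * y \<in> N" if "x \<in> N" "y \<in> N" for x y
      using that by (auto simp: N_def star_mult mult.assoc)
    show "c *\<^sub>C x \<in> N" if "x \<in> N" for x c
      using that scale by (auto simp: N_def star_scaleC mult_scaleC_left)
    show "star x \<in> N" if "x \<in> N" for x
      using that by (auto simp: N_def star_star)
    have cl: "closed (f -` ?W)" if "bounded_linear f" for f :: "'a \<Rightarrow> 'a"
      using that by (intro closed_vimage closed_closure) (auto intro: linear_continuous_on)
    have "N = ?W \<inter> star -` ?W \<inter> (\<Inter>y\<in>?W. (\<lambda>x. x * y) -` ?W) \<inter> (\<Inter>y\<in>?W. (\<lambda>x. star x * y) -` ?W)"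
      by (auto simp: N_def)
    moreover have "closed (\<Inter>y\<in>?W. (\<lambda>x. x * y) -` ?W)" "closed (\<Inter>y\<in>?W. (\<lambda>x. star x * y) -` ?W)"
      by (intro closed_INT ballI cl bounded_linear_mult_left
          bounded_linear_compose[OF bounded_linear_mult_left bounded_linear_star])+
    ultimately show "closed N" using cl[OF bounded_linear_star] by (simp add: closed_Int)
  qed
  moreover have "range p \<union> {s \<alpha> B |\<alpha> B. \<alpha> \<in> L \<and> B \<in> \<I> \<alpha>} \<subseteq> N"
  proof -
    have "p A \<in> N" for A
    proof -
      have "p A \<in> ?W"
        using S_star_S_monomial[of "[]" A "[]" A 1] base projection_idem[OF p_projection]
        by (simp add: ranges_def p_star)
      moreover have "p A * y \<in> ?W" if "y \<in> ?W" for y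
        using that p_mult_monomial by (intro left) blast+
      ultimately show ?thesis by (simp add: N_def p_star)
    qed
    moreover have "s a B \<in> N" if a: "a \<in> L" "B \<in> \<I> a" for a B
    proof -
      have "s a B = 1 *\<^sub>C (S [a] B * star (S [] B))" using a by (simp add: S_singleton p_star s_p)
      moreover have "([a], B) \<in> ranges" "([], B) \<in> ranges" using a by (auto simp: ranges_def)
      ultimately have "s a B \<in> ?W" using S_star_S_monomial[of "[a]" B "[]" B 1] base by metis
      moreover have "s a B * y \<in> ?W" if "y \<in> ?W" for y
        using that s_mult_monomial[OF _ a] by (intro left) blast+
      moreover have "star (s a B) * y \<in> ?W" if "y \<in> ?W" for y
        using that star_s_mult_monomial[OF _ a] by (intro left) blast+
      ultimately show ?thesis using star by (simp add: N_def)
    qed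
    ultimately show ?thesis by auto
  qed
  ultimately have "cstar_subalgebra hull (range p \<union> {s \<alpha> B |\<alpha> B. \<alpha> \<in> L \<and> B \<in> \<I> \<alpha>}) \<subseteq> N"
    by (intro hull_minimal)
  then have "N = UNIV" using alg by (auto simp: gbds_cstar_algebra_def)
  then show ?thesis by (auto simp: N_def)
qed

end

section \<open>The gauge action and Fourier coefficients\<close>

lemma sum_cis_roots_of_unity:
  fixes d :: int
  assumes m: "\<bar>d\<bar> < int m"
  shows "(\<Sum>j<m. cis (2 * pi * real j * of_int d / real m)) = (if d = 0 then of_nat m else 0)"
proof (cases "d = 0")
  case False
  have m0: "0 < m" using m by linarith
  define q where "q = cis (2 * pi * of_int d / real m)"
  have pow: "cis (2 * pi * real j * of_int d / real m) = q ^ j" for j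
    by (simp add: q_def Complex.DeMoivre mult_ac)
  have "q \<noteq> 1"
  proof
    assume "q = 1"
    then have "cos (2 * pi * of_int d / real m) = 1" by (simp add: q_def complex_eq_iff)
    then obtain n :: int where "2 * pi * of_int d / real m = of_int n * 2 * pi"
      using cos_one_2pi_int by auto
    then have "of_int d = of_int n * real m" using m0 by (simp add: field_simps)
    then have "d = n * int m" by (metis of_int_eq_iff of_int_mult of_int_of_nat_eq)
    then have "\<bar>d\<bar> = \<bar>n\<bar> * int m" by (simp add: abs_mult)
    moreover have "n \<noteq> 0" using \<open>d = n * int m\<close> False by auto
    then have "1 * int m \<le> \<bar>n\<bar> * int m" by (intro mult_right_mono) auto
    ultimately show False using m by simp
  qed
  moreover have "q ^ m = 1"
  proof -
    have "q ^ m = cis (2 * pi * of_int d)" using m0 by (simp add: q_def Complex.DeMoivre)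
    then show ?thesis by (simp add: cis_multiple_2pi)
  qed
  ultimately have "(\<Sum>j<m. q ^ j) = 0" by (simp add: geometric_sum)
  then show ?thesis using False by (simp add: pow)
qed simp

context gbds_universal
begin

lemma rotated_representation:
  assumes c: "c * cnj c = 1"
  shows "gbds_representation L \<theta> \<I> full_alg p (\<lambda>\<alpha> B. c *\<^sub>C s \<alpha> B)"
proof -
  have c': "cnj c * c = 1" using c by (simp add: mult.commute)
  show ?thesis
    using rep c c'
    by (simp add: s_p gbds_representation_def full_alg_simps star_scaleC mult_scaleC_left mult_scaleC_right
        scaleC_scaleC mult.assoc)
qed

definition gauge :: "real \<Rightarrow> 'a \<Rightarrow> 'a" where
  "gauge t = (SOME \<phi>. star_hom full_alg full_alg \<phi> \<and> (\<forall>A. \<phi> (p A) = p A) \<and>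
     (\<forall>\<alpha>\<in>L. \<forall>B\<in>\<I> \<alpha>. \<phi> (s \<alpha> B) = cis t *\<^sub>C s \<alpha> B))"

lemma gauge_hom: "star_hom full_alg full_alg (gauge t)"
  and gauge_p: "gauge t (p A) = p A"
  and gauge_s: "\<alpha> \<in> L \<Longrightarrow> B \<in> \<I> \<alpha> \<Longrightarrow> gauge t (s \<alpha> B) = cis t *\<^sub>C s \<alpha> B"
proof -
  have "gbds_representation L \<theta> \<I> full_alg p (\<lambda>\<alpha> B. cis t *\<^sub>C s \<alpha> B)"
    by (rule rotated_representation) (simp add: cis_cnj cis_mult)
  then have "\<exists>\<phi>. star_hom full_alg full_alg \<phi> \<and> (\<forall>A. \<phi> (p A) = p A) \<and>
     (\<forall>\<alpha>\<in>L. \<forall>B\<in>\<I> \<alpha>. \<phi> (s \<alpha> B) = cis t *\<^sub>C s \<alpha> B)"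
    by (rule universal_representation_hom[OF sys universal cstar_alg_full_alg])
  note h = someI_ex[OF this, folded gauge_def]
  show "star_hom full_alg full_alg (gauge t)" "gauge t (p A) = p A"
    "\<alpha> \<in> L \<Longrightarrow> B \<in> \<I> \<alpha> \<Longrightarrow> gauge t (s \<alpha> B) = cis t *\<^sub>C s \<alpha> B" using h by blast+
qed

lemma gauge_endomorphism: "star_endomorphism (gauge t)"
  using gauge_hom[of t] by unfold_locales (simp_all add: star_hom_def full_alg_simps)

lemmas gauge_mult = star_endomorphism.mult[OF gauge_endomorphism]
  and gauge_scaleC = star_endomorphism.scaleC[OF gauge_endomorphism]
  and gauge_star = star_endomorphism.star[OF gauge_endomorphism]
  and norm_gauge_le = star_endomorphism.norm_le[OF gauge_endomorphism]
  and bounded_linear_gauge = star_endomorphism.bounded_linear[OF gauge_endomorphism]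

lemma gauge_S: "w \<in> lists L \<Longrightarrow> A \<in> IW w \<Longrightarrow> gauge t (S w A) = cis (t * real (length w)) *\<^sub>C S w A"
proof (induction w)
  case (Cons a w)
  have a: "a \<in> L" "w \<in> lists L" "A \<in> IW (a # w)" using Cons.prems by auto
  then obtain B where B: "B \<in> \<I> a" "A \<le> fold \<theta> w B" by auto
  have "cis (t * real (length w)) * cis t = cis (t * real (length (a # w)))"
    by (simp add: cis_mult algebra_simps)
  then show ?case
    using Cons.IH[OF a(2) IW_tail[OF a]] a B
    by (simp add: S_Cons gauge_mult gauge_s mult_scaleC_left mult_scaleC_right scaleC_scaleC)
qed (simp add: gauge_p)

lemma gauge_monomial:
  assumes "x \<in> monomials k" shows "gauge t x = cis (t * of_int k) *\<^sub>C x"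
proof -
  obtain c \<alpha> \<beta> A where x: "x = c *\<^sub>C (S \<alpha> A * star (S \<beta> A))" "(\<alpha>, A) \<in> ranges" "(\<beta>, A) \<in> ranges"
    "int (length \<alpha>) - int (length \<beta>) = k" using assms by (auto simp: monomials_def)
  have k: "of_int k = real (length \<alpha>) - real (length \<beta>)" using x(4) by auto
  have "cis (t * real (length \<alpha>)) * cnj (cis (t * real (length \<beta>))) = cis (t * of_int k)"
    by (simp add: cis_cnj cis_mult k algebra_simps)
  then show ?thesis
    using x by (simp add: gauge_scaleC gauge_mult gauge_star gauge_S ranges_def star_scaleC mult_scaleC_left
        mult_scaleC_right scaleC_scaleC mult_ac)
qed

lemma gauge_e: "(w, A) \<in> ranges \<Longrightarrow> gauge t (e w A) = e w A"
  using gauge_monomial[of "e w A" 0 t] S_star_S_monomial[of w A w A 1] by (simp add: e_def)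

lemma gauge_centralizer: "x \<in> centralizer \<Longrightarrow> gauge t x \<in> centralizer"
  by (auto simp: commutant_def range_projections_def gauge_e simp flip: gauge_mult)
    (metis gauge_e gauge_mult)

text \<open>The average over the \<open>m\<close>-th roots of unity agrees with the \<open>k\<close>-th Fourier coefficient of the gauge
  action on each combination of monomials once \<open>m\<close> is large, and converges to it everywhere.\<close>

definition coefficient :: "nat \<Rightarrow> int \<Rightarrow> 'a \<Rightarrow> 'a" where
  "coefficient m k x = (1 / real m) *\<^sub>R (\<Sum>j<m. cis (- (2 * pi * real j * of_int k / real m)) *\<^sub>C gauge (2 * pi * real j / real m) x)"

lemma bounded_linear_coefficient: "bounded_linear (coefficient m k)"
  unfolding coefficient_def
  by (intro bounded_linear_const_scaleR bounded_linear_sum bounded_linear_compose[OF bounded_linear_scaleC] bounded_linear_gauge)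

lemma norm_coefficient_le: "norm (coefficient m k x) \<le> norm x"
proof (cases "m = 0")
  case False
  have "norm (\<Sum>j<m. cis (- (2 * pi * real j * of_int k / real m)) *\<^sub>C gauge (2 * pi * real j / real m) x)
      \<le> (\<Sum>j<m. norm x)"
    by (rule sum_norm_le) (simp add: norm_scaleC norm_gauge_le)
  then show ?thesis using False by (simp add: coefficient_def field_simps)
qed (simp add: coefficient_def)

lemma coefficient_centralizer: "x \<in> centralizer \<Longrightarrow> coefficient m k x \<in> centralizer"
  unfolding coefficient_def
  by (intro subspace_scale[OF centralizer_subspace] subspace_sum[OF centralizer_subspace] centralizer gauge_centralizer)

lemma coefficient_eigenvector:
  assumes "\<And>t. gauge t x = cis (t * of_int d) *\<^sub>C x" "\<bar>d - k\<bar> < int m"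
  shows "coefficient m k x = (if d = k then x else 0)"
proof -
  have sumC: "(\<Sum>j\<in>F. f j *\<^sub>C x) = (\<Sum>j\<in>F. f j) *\<^sub>C x" if "finite F" for f and F :: "nat set"
    using that by (induction F) (simp_all add: scaleC_add_left)
  have "cis (- (2 * pi * real j * of_int k / real m)) * cis (2 * pi * real j / real m * of_int d)
      = cis (2 * pi * real j * of_int (d - k) / real m)" for j
    by (simp add: cis_mult diff_divide_distrib algebra_simps)
  then have "coefficient m k x = (1 / real m) *\<^sub>R ((\<Sum>j<m. cis (2 * pi * real j * of_int (d - k) / real m)) *\<^sub>C x)"
    by (simp only: coefficient_def assms(1) scaleC_scaleC sumC finite_lessThan)
  also have "(\<Sum>j<m. cis (2 * pi * real j * of_int (d - k) / real m)) = (if d - k = 0 then of_nat m else 0)"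
    by (rule sum_cis_roots_of_unity[OF assms(2)])
  finally show ?thesis using assms(2) by (auto simp: scaleR_eq_scaleC scaleC_scaleC)
qed

lemma coefficient_polynomial:
  assumes "y \<in> span (\<Union>k. monomials k)"
  shows "\<exists>z\<in>span (monomials k). \<forall>\<^sub>F m in sequentially. coefficient m k y = z"
  using assms
proof (induction rule: span_induct_alt)
  case base
  show ?case
    using bounded_linear.linear[OF bounded_linear_coefficient, THEN linear_0] by (intro bexI[of _ 0]) (auto simp: span_zero)
next
  case (step r x y)
  obtain z where z: "z \<in> span (monomials k)" "\<forall>\<^sub>F m in sequentially. coefficient m k y = z" using step by blast
  obtain d where d: "x \<in> monomials d" using step(1) by blast
  have "\<forall>\<^sub>F m in sequentially. nat \<bar>d - k\<bar> < m" by (rule eventually_gt_at_top)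
  then have "\<forall>\<^sub>F m in sequentially. coefficient m k (r *\<^sub>R x + y) = r *\<^sub>R (if d = k then x else 0) + z"
    using z(2)
  proof eventually_elim
    case (elim m)
    have "coefficient m k x = (if d = k then x else 0)"
      using elim(1) gauge_monomial[OF d] by (intro coefficient_eigenvector) auto
    then show ?case
      using elim(2) linear_add[OF bounded_linear.linear[OF bounded_linear_coefficient]]
        linear_scale[OF bounded_linear.linear[OF bounded_linear_coefficient]] by simp
  qed
  moreover have "r *\<^sub>R (if d = k then x else 0) + z \<in> span (monomials k)"
    using d z(1) by (auto intro: span_add span_scale span_base span_zero)
  ultimately show ?case by blast
qed

lemma coefficient_diff: "coefficient m k (x - y) = coefficient m k x - coefficient m k y"
  by (rule linear_diff[OF bounded_linear.linear[OF bounded_linear_coefficient]])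

lemma coefficient_near:
  assumes "0 < \<epsilon>"
  shows "\<exists>z\<in>span (monomials k). \<forall>\<^sub>F m in sequentially. dist (coefficient m k x) z < \<epsilon>"
proof -
  have "x \<in> closure (span (\<Union>k. monomials k))" using monomials_dense by simp
  then obtain y where y: "y \<in> span (\<Union>k. monomials k)" "dist y x < \<epsilon>"
    using assms unfolding closure_approachable by blast
  obtain z where z: "z \<in> span (monomials k)" "\<forall>\<^sub>F m in sequentially. coefficient m k y = z"
    using coefficient_polynomial[OF y(1)] by blast
  from z(2) have "\<forall>\<^sub>F m in sequentially. dist (coefficient m k x) z < \<epsilon>"
  proof eventually_elim
    case (elim m)
    have "dist (coefficient m k x) z = norm (coefficient m k (x - y))"
      using elim by (simp add: dist_norm coefficient_diff)
    also have "\<dots> \<le> norm (x - y)" by (rule norm_coefficient_le)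
    also have "\<dots> < \<epsilon>" using y(2) by (simp add: dist_norm norm_minus_commute)
    finally show ?case .
  qed
  then show ?thesis using z(1) by blast
qed

lemma coefficient_convergent:
  obtains z where "(\<lambda>m. coefficient m k x) \<longlonglongrightarrow> z" "z \<in> closure (span (monomials k))"
proof -
  have "Cauchy (\<lambda>m. coefficient m k x)"
  proof (rule metric_CauchyI)
    fix \<epsilon> :: real assume "0 < \<epsilon>"
    then obtain z where "\<forall>\<^sub>F m in sequentially. dist (coefficient m k x) z < \<epsilon>/2"
      using coefficient_near[of "\<epsilon>/2" k x] by auto
    then obtain N where N: "\<And>m. N \<le> m \<Longrightarrow> dist (coefficient m k x) z < \<epsilon>/2"
      by (auto simp: eventually_sequentially)
    show "\<exists>N. \<forall>m\<ge>N. \<forall>n\<ge>N. dist (coefficient m k x) (coefficient n k x) < \<epsilon>"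
      using dist_triangle_half_l[OF N N] by blast
  qed
  then obtain z where z: "(\<lambda>m. coefficient m k x) \<longlonglongrightarrow> z" using Cauchy_convergent_iff convergent_def by blast
  have "z \<in> closure (span (monomials k))"
    unfolding closure_approachable
  proof (intro allI impI)
    fix \<epsilon> :: real assume e: "0 < \<epsilon>"
    then obtain y where y: "y \<in> span (monomials k)" "\<forall>\<^sub>F m in sequentially. dist (coefficient m k x) y < \<epsilon>/2"
      using coefficient_near[of "\<epsilon>/2" k x] by auto
    have "dist z y \<le> \<epsilon>/2"
    proof (rule tendsto_upperbound[OF tendsto_dist[OF z tendsto_const]])
      show "\<forall>\<^sub>F m in sequentially. dist (coefficient m k x) y \<le> \<epsilon>/2"
        using y(2) by eventually_elim simp
    qed simp
    then show "\<exists>y\<in>span (monomials k). dist y z < \<epsilon>" using y(1) e by (intro bexI[of _ y]) (auto simp: dist_commute)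
  qed
  then show ?thesis using that z by blast
qed

lemma gauge_homogeneous:
  assumes "x \<in> closure (span (monomials k))" shows "gauge t x = cis (t * of_int k) *\<^sub>C x"
proof -
  let ?f = "\<lambda>x. gauge t x - cis (t * of_int k) *\<^sub>C x"
  have "bounded_linear ?f" by (intro bounded_linear_sub bounded_linear_gauge bounded_linear_scaleC)
  then have "?f x \<in> closure (span {0})"
    by (rule closure_span_closed_linear[OF _ _ assms]) (simp add: gauge_monomial)
  then show ?thesis by simp
qed

lemma gauge_invariant_degree_0:
  assumes "\<And>t. gauge t x = x" shows "x \<in> closure (span (monomials 0))"
proof -
  obtain z where z: "(\<lambda>m. coefficient m 0 x) \<longlonglongrightarrow> z" "z \<in> closure (span (monomials 0))"
    by (rule coefficient_convergent)
  have "\<forall>\<^sub>F m in sequentially. coefficient m 0 x = x"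
    using eventually_gt_at_top[of 0] by eventually_elim (simp add: coefficient_eigenvector[of x 0] assms)
  then have "(\<lambda>m. coefficient m 0 x) \<longlonglongrightarrow> x" by (rule tendsto_eventually)
  then show ?thesis using z LIMSEQ_unique by blast
qed

text \<open>Up to aliasing modulo \<open>m\<close>, this is the Fejer mean, which gives degree \<open>d\<close> the weight \<open>1 - |d| / N\<close>.\<close>

definition fejer :: "nat \<Rightarrow> nat \<Rightarrow> 'a \<Rightarrow> 'a" where
  "fejer N m x = (1 / real N) *\<^sub>R (\<Sum>n<N. \<Sum>n'<N. coefficient m (int n - int n') x)"

text \<open>The Fejer kernel is a squared absolute value, hence nonnegative, and it has mean 1.\<close>

lemma norm_fejer_le:
  assumes N: "0 < N" "N \<le> m" shows "norm (fejer N m x) \<le> norm x"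
proof -
  define u where "u j = (\<Sum>n<N. cis (- (2 * pi * real j * real n / real m)))" for j
  have flip: "cis (- (2 * pi * real j * of_int (int n - int n') / real m)) = cis (2 * pi * real j * of_int (int n' - int n) / real m)" for j n n'
    by (rule arg_cong[of _ _ cis]) (cases "m = 0"; simp add: field_simps)
  have w: "(\<Sum>n<N. \<Sum>n'<N. cis (- (2 * pi * real j * of_int (int n - int n') / real m))) = complex_of_real ((cmod (u j))\<^sup>2)" for j
  proof -
    have "complex_of_real ((cmod (u j))\<^sup>2) = u j * cnj (u j)" by (rule complex_norm_square)
    also have "\<dots> = (\<Sum>n<N. \<Sum>n'<N. cis (- (2 * pi * real j * real n / real m)) * cis (2 * pi * real j * real n' / real m))"
      by (simp add: u_def sum_product cis_cnj)
    also have "\<dots> = (\<Sum>n<N. \<Sum>n'<N. cis (- (2 * pi * real j * of_int (int n - int n') / real m)))"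
      by (intro sum.cong refl) (simp add: cis_mult diff_divide_distrib algebra_simps)
    finally show ?thesis by simp
  qed
  have sumC: "(\<Sum>j\<in>F. f j *\<^sub>C y) = (\<Sum>j\<in>F. f j) *\<^sub>C y" if "finite F" for f y and F :: "nat set"
    using that by (induction F) (simp_all add: scaleC_add_left)
  let ?g = "\<lambda>j. gauge (2 * pi * real j / real m) x"
  have "fejer N m x = (1 / real N) *\<^sub>R (1 / real m) *\<^sub>R (\<Sum>n<N. \<Sum>n'<N. \<Sum>j<m.
      cis (- (2 * pi * real j * of_int (int n - int n') / real m)) *\<^sub>C ?g j)"
    by (simp only: fejer_def coefficient_def scaleR_sum_right)
  also have "(\<Sum>n<N. \<Sum>n'<N. \<Sum>j<m. cis (- (2 * pi * real j * of_int (int n - int n') / real m)) *\<^sub>C ?g j)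
      = (\<Sum>j<m. \<Sum>n<N. \<Sum>n'<N. cis (- (2 * pi * real j * of_int (int n - int n') / real m)) *\<^sub>C ?g j)"
    by (subst (2) sum.swap) (subst sum.swap, rule refl)
  also have "\<dots> = (\<Sum>j<m. complex_of_real ((cmod (u j))\<^sup>2) *\<^sub>C ?g j)"
    by (simp only: sumC finite_lessThan w)
  finally have eq: "fejer N m x = (1 / real N) *\<^sub>R (1 / real m) *\<^sub>R (\<Sum>j<m. complex_of_real ((cmod (u j))\<^sup>2) *\<^sub>C ?g j)" .
  have "complex_of_real (\<Sum>j<m. (cmod (u j))\<^sup>2)
      = (\<Sum>j<m. \<Sum>n<N. \<Sum>n'<N. cis (2 * pi * real j * of_int (int n' - int n) / real m))"
    by (simp add: w[symmetric] flip del: of_int_diff of_real_power)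
  also have "\<dots> = (\<Sum>n<N. \<Sum>n'<N. \<Sum>j<m. cis (2 * pi * real j * of_int (int n' - int n) / real m))"
    by (subst sum.swap) (subst (2) sum.swap, rule refl)
  also have "\<dots> = (\<Sum>n<N. \<Sum>n'<N. if n' = n then of_nat m else 0)"
  proof (intro sum.cong refl)
    fix n n' assume "n \<in> {..<N}" "n' \<in> {..<N}"
    then have "\<bar>int n' - int n\<bar> < int m" using N by auto
    then show "(\<Sum>j<m. cis (2 * pi * real j * of_int (int n' - int n) / real m)) = (if n' = n then of_nat m else 0)"
      using sum_cis_roots_of_unity[of "int n' - int n" m] by simp
  qed
  also have "\<dots> = complex_of_real (real N * real m)" by simp
  finally have total: "(\<Sum>j<m. (cmod (u j))\<^sup>2) = real N * real m" by (simp only: of_real_eq_iff)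
  have "norm (\<Sum>j<m. complex_of_real ((cmod (u j))\<^sup>2) *\<^sub>C ?g j) \<le> (\<Sum>j<m. (cmod (u j))\<^sup>2 * norm x)"
    by (rule sum_norm_le) (simp add: norm_scaleC norm_gauge_le mult_left_mono del: of_real_power)
  also have "\<dots> = real N * real m * norm x" by (simp add: total flip: sum_distrib_right)
  finally show ?thesis using N by (simp add: eq field_simps)
qed

lemma linear_fejer: "linear (fejer N m)"
  unfolding fejer_def
  by (intro linear_compose_scale_right linear_compose_sum ballI bounded_linear.linear[OF bounded_linear_coefficient])

lemma fejer_monomial:
  assumes x: "x \<in> monomials d" and m: "nat \<bar>d\<bar> + N < m" and N: "0 < N"
  shows "norm (fejer N m x - x) \<le> of_int \<bar>d\<bar> * norm x / real N"
proof -
  \<comment> \<open>For each \<open>n\<close> at most one \<open>n'\<close> contributes; it is missing for at most \<open>|d|\<close> values of \<open>n\<close>.\<close>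
  have inner: "(\<Sum>n'<N. coefficient m (int n - int n') x) = (if 0 \<le> int n - d \<and> int n - d < int N then x else 0)"
    if "n < N" for n
  proof -
    have "coefficient m (int n - int n') x = (if d = int n - int n' then x else 0)" if "n' < N" for n'
      using m that \<open>n < N\<close> by (intro coefficient_eigenvector gauge_monomial[OF x]) auto
    then have "(\<Sum>n'<N. coefficient m (int n - int n') x) = (\<Sum>n'<N. if n' = nat (int n - d) \<and> 0 \<le> int n - d then x else 0)"
      by (intro sum.cong) auto
    then show ?thesis by (cases "0 \<le> int n - d") (auto simp: nat_less_iff)
  qed
  let ?bad = "{n. n < N \<and> \<not> (0 \<le> int n - d \<and> int n - d < int N)}"
  have "real N *\<^sub>R (x - fejer N m x) = (\<Sum>n<N. x) - (\<Sum>n<N. \<Sum>n'<N. coefficient m (int n - int n') x)"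
    using N by (simp add: fejer_def scaleR_diff_right sum_constant_scaleR)
  also have "\<dots> = (\<Sum>n<N. if 0 \<le> int n - d \<and> int n - d < int N then 0 else x)"
    by (subst sum_subtractf[symmetric]) (intro sum.cong refl, simp add: inner)
  also have "\<dots> = (\<Sum>n\<in>?bad. x)"
    by (rule sum.mono_neutral_cong_right) auto
  finally have eq: "real N *\<^sub>R (x - fejer N m x) = real (card ?bad) *\<^sub>R x"
    by (simp add: sum_constant_scaleR)
  have "?bad \<subseteq> (if 0 \<le> d then {..<nat d} else {N - nat (- d)..<N})"
    by (auto split: if_splits)
  then have "card ?bad \<le> card (if 0 \<le> d then {..<nat d} else {N - nat (- d)..<N})"
    by (intro card_mono) auto
  also have "\<dots> \<le> nat \<bar>d\<bar>" by auto
  finally have "real (card ?bad) \<le> of_int \<bar>d\<bar>" by linarith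
  then have "real (card ?bad) * norm x \<le> of_int \<bar>d\<bar> * norm x"
    by (intro mult_right_mono) auto
  moreover have "real N * norm (x - fejer N m x) = real (card ?bad) * norm x"
    using arg_cong[OF eq, of norm] by simp
  ultimately have "real N * norm (fejer N m x - x) \<le> of_int \<bar>d\<bar> * norm x" by (simp add: norm_minus_commute)
  then show ?thesis using N by (simp add: pos_le_divide_eq mult.commute)
qed

lemma fejer_polynomial:
  assumes "y \<in> span (\<Union>k. monomials k)"
  shows "\<exists>C. \<forall>N>0. \<forall>\<^sub>F m in sequentially. norm (fejer N m y - y) \<le> C / real N"
  using assms
proof (induction rule: span_induct_alt)
  case base
  show ?case by (intro exI[of _ 0]) (simp add: linear_0[OF linear_fejer])
next
  case (step r x y)
  obtain C where C: "\<And>N. 0 < N \<Longrightarrow> \<forall>\<^sub>F m in sequentially. norm (fejer N m y - y) \<le> C / real N" using step by blast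
  obtain d where d: "x \<in> monomials d" using step(1) by blast
  have "\<forall>\<^sub>F m in sequentially. norm (fejer N m (r *\<^sub>R x + y) - (r *\<^sub>R x + y)) \<le> (\<bar>r\<bar> * (of_int \<bar>d\<bar> * norm x) + C) / real N"
    if N: "0 < N" for N
    using C[OF N] eventually_gt_at_top[of "nat \<bar>d\<bar> + N"]
  proof eventually_elim
    case (elim m)
    have "fejer N m (r *\<^sub>R x + y) - (r *\<^sub>R x + y) = r *\<^sub>R (fejer N m x - x) + (fejer N m y - y)"
      by (simp add: linear_add[OF linear_fejer] linear_scale[OF linear_fejer] scaleR_diff_right)
    also have "norm \<dots> \<le> \<bar>r\<bar> * norm (fejer N m x - x) + norm (fejer N m y - y)"
      by (rule norm_triangle_le) simp
    also have "\<dots> \<le> \<bar>r\<bar> * (of_int \<bar>d\<bar> * norm x / real N) + C / real N"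
      using fejer_monomial[OF d elim(2) N] elim(1) by (intro add_mono mult_left_mono) auto
    finally show ?case by (simp add: add_divide_distrib)
  qed
  then show ?case by blast
qed

text \<open>Since all other coefficients vanish in the limit, every Fejer mean of \<open>x\<close> is \<open>x0\<close>; and Fejer means
  converge to \<open>x\<close>, because they do so on the dense span of the monomials and are contractive.\<close>

lemma equal_zeroth_coefficient:
  assumes zero: "\<And>k. k \<noteq> 0 \<Longrightarrow> (\<lambda>m. coefficient m k x) \<longlonglongrightarrow> 0" and x0: "(\<lambda>m. coefficient m 0 x) \<longlonglongrightarrow> x0"
  shows "x = x0"
proof -
  have lim: "(\<lambda>m. fejer N m x) \<longlonglongrightarrow> x0" if N: "0 < N" for N
  proof -
    have "(\<lambda>m. coefficient m (int n - int n') x) \<longlonglongrightarrow> (if n' = n then x0 else 0)" for n n'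
      using zero[of "int n - int n'"] x0 by auto
    then have "(\<lambda>m. fejer N m x) \<longlonglongrightarrow> (1 / real N) *\<^sub>R (\<Sum>n<N. \<Sum>n'<N. if n' = n then x0 else 0)"
      unfolding fejer_def by (intro tendsto_intros)
    then show ?thesis using N by (simp add: sum_constant_scaleR)
  qed
  have "norm (x0 - x) \<le> 2 * \<epsilon>" if e: "0 < \<epsilon>" for \<epsilon>
  proof -
    have "x \<in> closure (span (\<Union>k. monomials k))" using monomials_dense by simp
    then obtain y where y: "y \<in> span (\<Union>k. monomials k)" "dist y x < \<epsilon>"
      using e unfolding closure_approachable by blast
    obtain C where C: "\<And>N. 0 < N \<Longrightarrow> \<forall>\<^sub>F m in sequentially. norm (fejer N m y - y) \<le> C / real N"
      using fejer_polynomial[OF y(1)] by blast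
    have bound: "norm (x0 - x) \<le> 2 * \<epsilon> + C / real N" if N: "0 < N" for N
    proof (rule tendsto_upperbound[OF tendsto_norm[OF tendsto_diff[OF lim[OF N] tendsto_const]]])
      show "\<forall>\<^sub>F m in sequentially. norm (fejer N m x - x) \<le> 2 * \<epsilon> + C / real N"
        using C[OF N] eventually_ge_at_top[of N]
      proof eventually_elim
        case (elim m)
        have "fejer N m x - x = fejer N m (x - y) + (fejer N m y - y) + (y - x)"
          by (simp add: linear_diff[OF linear_fejer])
        also have "norm \<dots> \<le> norm (fejer N m (x - y)) + norm (fejer N m y - y) + norm (y - x)"
          by (meson norm_triangle_ineq norm_triangle_le add_right_mono order_trans)
        also have "norm (fejer N m (x - y)) \<le> norm (x - y)" by (rule norm_fejer_le[OF N elim(2)])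
        finally show ?case using elim(1) y(2) by (simp add: dist_norm norm_minus_commute)
      qed
    qed simp
    have "(\<lambda>N. 2 * \<epsilon> + C / real N) \<longlonglongrightarrow> 2 * \<epsilon> + 0"
      by (intro tendsto_intros lim_const_over_n)
    then have "norm (x0 - x) \<le> 2 * \<epsilon> + 0"
      by (rule tendsto_lowerbound) (use bound in \<open>auto intro!: eventually_mono[OF eventually_gt_at_top[of 0]]\<close>)
    then show ?thesis by simp
  qed
  from this[of "norm (x0 - x) / 4"] have "norm (x0 - x) \<le> 0" by (cases "norm (x0 - x) = 0") auto
  then show ?thesis by simp
qed

section \<open>The diagonal is its own commutant\<close>

lemma centralizer_subset_diagonal:
  assumes L: "condition_L L \<theta>" and x: "x \<in> centralizer"
  shows "x \<in> closure (span diagonal_monomials)"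
proof -
  have lim_centralizer: "z \<in> centralizer" if "(\<lambda>m. coefficient m k x) \<longlonglongrightarrow> z" for k z
    using closed_sequentially[OF centralizer(6) _ that] coefficient_centralizer[OF x] by blast
  have "(\<lambda>m. coefficient m k x) \<longlonglongrightarrow> 0" if k: "k \<noteq> 0" for k
  proof -
    obtain z where z: "(\<lambda>m. coefficient m k x) \<longlonglongrightarrow> z" "z \<in> closure (span (monomials k))"
      by (rule coefficient_convergent)
    have zc: "z \<in> centralizer" using z(1) by (rule lim_centralizer)
    have "gauge t (star z * z) = star z * z" for t
      by (simp add: gauge_mult gauge_star gauge_homogeneous[OF z(2)] star_scaleC mult_scaleC_left mult_scaleC_right
          scaleC_scaleC cis_cnj cis_mult)
    then have "star z * z \<in> closure (span diagonal_monomials)"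
      by (intro centralizer_degree_0 gauge_invariant_degree_0 centralizer zc)
    then have "z = 0" by (intro centralizer_nonzero_degree[OF L p_nonzero k zc z(2)])
    then show ?thesis using z(1) by simp
  qed
  moreover obtain x0 where x0: "(\<lambda>m. coefficient m 0 x) \<longlonglongrightarrow> x0" "x0 \<in> closure (span (monomials 0))"
    by (rule coefficient_convergent)
  ultimately have "x = x0" by (intro equal_zeroth_coefficient)
  then show ?thesis using x0(2) x by (intro centralizer_degree_0) auto
qed

lemma abelian_core_eq:
  assumes "condition_L L \<theta>"
  shows "abelian_core L \<theta> \<I> p s = cstar_subalgebra hull range_projections"
proof -
  have none: "cycle_no_exits L \<theta> \<gamma> A \<longleftrightarrow> False" for \<gamma> A using assms by (auto simp: condition_L_def)
  show ?thesis
    unfolding abelian_core_def none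
    by (rule arg_cong[of _ _ "\<lambda>X. cstar_subalgebra hull X"])
      (auto simp: range_projections_def ranges_def e_def)
qed

lemma masa_hull_range_projections:
  assumes L: "condition_L L \<theta>" shows "masa (cstar_subalgebra hull range_projections)"
proof -
  let ?M = "cstar_subalgebra hull range_projections"
  have M: "cstar_subalgebra ?M" by (rule cstar_subalgebra_hull)
  have E: "range_projections \<subseteq> ?M" by (rule hull_subset)
  have "star x \<in> range_projections" if "x \<in> range_projections" for x
  proof -
    have "star x = x" using that by (auto simp: range_projections_def projection_star e_in_ranges_projection)
    then show ?thesis using that by simp
  qed
  moreover have "commuting range_projections"
    by (auto simp: commuting_def range_projections_def e_commute)
  ultimately have comm: "commuting ?M" by (rule commuting_hull)
  have "diagonal_monomials \<subseteq> ?M"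
  proof
    fix x assume "x \<in> diagonal_monomials"
    then obtain c q where q: "x = c *\<^sub>C q" "q \<in> range_projections"
      by (auto simp: diagonal_monomials_def range_projections_def)
    then have "q \<in> ?M" using E by blast
    then show "x \<in> ?M" using M q(1) by (simp add: cstar_subalgebra_def)
  qed
  then have "closure (span diagonal_monomials) \<subseteq> ?M"
    using M by (intro closure_span_subset cstar_subalgebra_subspace) (auto simp: cstar_subalgebra_def)
  then have "T = ?M" if T: "commuting T" "?M \<subseteq> T" for T
    using centralizer_subset_diagonal[OF L] T E by (fastforce simp: commuting_def commutant_def)
  then show ?thesis using M comm by (auto simp: masa_def)
qed

end

theorem corollary4p10:
  fixes L :: "'l set"
    and \<theta> :: "'l \<Rightarrow> 'b::generalized_boolean_algebra \<Rightarrow> 'b"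
    and \<I> :: "'l \<Rightarrow> 'b set"
    and p :: "'b \<Rightarrow> 'a::cstar_algebra"
    and s :: "'l \<Rightarrow> 'b \<Rightarrow> 'a"
  assumes "generalized_boolean_dynamical_system L \<theta> \<I>"
    and "gbds_cstar_algebra L \<theta> \<I> p s"
    and "condition_L L \<theta>"
  shows "masa (abelian_core L \<theta> \<I> p s)"
proof -
  interpret gbds_universal L \<theta> \<I> p s using assms by unfold_locales
  show ?thesis using masa_hull_range_projections[OF assms(3)] abelian_core_eq[OF assms(3)] by simp
qed

end
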